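(* Assume the degree matrix $\mathbf N$ (and mass matrix $\mathbf M$) are primitive-Frobenius, and let $\Lambda_{\mathcal U_\iota}>1$. Then the degree scaling limit $(\Xi_\iota,\hat\deg_{\Xi_\iota})$ exists, i.e. $\hat\deg_{\Xi_\iota}(v)=\lim_{n\to\infty}\deg_{\Xi_\iota^n}(v)/\Delta(\Xi_\iota^n)$ exists for every $v\in\bigcup_{n\ge0}V(\Xi_\iota^n)$. Moreover, there is a constant $C_{\deg}(\iota)\in(0,\infty)$ such that $\Delta(\Xi_\iota^n)\sim C_{\deg}(\iota)\,n^{\tau_{\deg}(\iota)-1}\Lambda_{\mathcal U_\iota}^n$ as $n\to\infty$, and if a vertex $v$ is born in generation $m(v)$ with birth type $\mathbf u(v)$, then \[ \hat\deg_{\Xi_\iota}(v)=\begin{cases}\alpha(\mathbf u(v))\,\Lambda_{\mathcal U_\iota}^{-m(v)}, & \lambda(\mathbf u(v))=\Lambda_{\mathcal U_\iota}\text{ and }\tau(\mathbf u(v))=\tau_{\deg}(\iota),\\ 0,&\text{otherwise},\end{cases} \] where $\alpha(\mathbf u):=c_{\deg}(\mathbf u)/C_{\deg}(\iota)$.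
   Context: $f\sim g$ means $f(n)/g(n)\to1$; $\|\cdot\|_1$ the $\ell^1$ norm; $\rho$ spectral radius; $\Delta(G)$ is the maximum vertex degree of $G$; degrees count all incident edges. EIGS: $K\ge1$ colours; for $i\in[K]$, $R_i$ is a finite connected directed graph with edges coloured in $[K]$ and planting vertices $\beta_i^+,\beta_i^-$ at undirected distance $\ge2$. $\Xi_\iota^0$ is a single directed edge of colour $\iota$; $\Xi_\iota^{n+1}$ replaces each edge $(a,b)$ of colour $i$ of $\Xi_\iota^n$ by a fresh copy of $R_i$ with $\beta_i^+=a,\beta_i^-=b$. Vertex sets are nested; $v$ is born in generation $m$ if it first appears in $\Xi_\iota^m$, and its birth type is $\mathbf u(v)=\boldsymbol\kappa_{\Xi_\iota^m}(v)$. Matrices: $[\mathbf M]_{ik}$ = number of colour-$k$ edges of $R_i$. $\boldsymbol\kappa_G(v)\in\mathbb N^{1\times2K}$: entry $2i-1$ = number of outgoing colour-$i$ edges at $v$, entry $2i$ = incoming colour-$i$ edges. $\mathbf N$: rows $2i-1,2i$ are $\boldsymbol\kappa_{R_i}(\beta_i^+),\boldsymbol\kappa_{R_i}(\beta_i^-)$. Frobenius notions (nonnegative square $\mathbf X$): $a$ reaches $b$ iff $[\mathbf X^n]_{ab}>0$ for some $n\ge0$; $\mathfrak r_{\mathbf X}(a)$ reachable indices; blocks = mutual-reachability classes with diagonal blocks $\mathbf B_k(\mathbf X)$; $\mathfrak R_{\mathbf X}(a)$ = blocks reachable from the block of $a$; primitive-Frobenius = all diagonal blocks primitive. $\varkappa_{\mathbf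 X}(a)$ = maximum over chains of distinct blocks $k_0,\dots,k_L$ ($k_0$ the block of $a$, each reaching the next) of the number of $r$ with $\rho(\mathbf B_{k_r}(\mathbf X))=\max_{\ell\in\mathfrak R_{\mathbf X}(a)}\rho(\mathbf B_\ell(\mathbf X))$. $\mathcal U_\iota=\{\boldsymbol\kappa_{\Xi_\iota^0}(v):v\in V(\Xi_\iota^0)\}\cup\bigcup_{j\in\mathfrak r_{\mathbf M}(\iota)}\{\boldsymbol\kappa_{R_j}(w):w\in V(R_j)\setminus\{\beta_j^\pm\}\}$. For nonzero $\mathbf u$: $\lambda(\mathbf u)=\max_{a:[\mathbf u]_a>0}\max_{\ell\in\mathfrak R_{\mathbf N}(a)}\rho(\mathbf B_\ell(\mathbf N))$; $\tau(\mathbf u)=\max\{\varkappa_{\mathbf N}(a):[\mathbf u]_a>0,\ \max_{\ell\in\mathfrak R_{\mathbf N}(a)}\rho(\mathbf B_\ell(\mathbf N))=\lambda(\mathbf u)\}$; $\Lambda_{\mathcal U_\iota}=\max_{\mathbf u\in\mathcal U_\iota}\lambda(\mathbf u)$; $\tau_{\deg}(\iota)=\max\{\tau(\mathbf u):\mathbf u\in\mathcal U_\iota,\ \lambda(\mathbf u)=\Lambda_{\mathcal U_\iota}\}$. $c_{\deg}(\mathbf u)\in(0,\infty)$ denotes the constant with $\|\mathbf u\mathbf N^n\|_1\sim c_{\deg}(\mathbf u)n^{\tau(\mathbf u)-1}\lambda(\mathbf u)^n$ (it exists). *)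

theory Defs
  imports
    "HOL-Library.Landau_Symbols"
    "Graph_Theory.Graph_Theory"
    "Jordan_Normal_Form.Spectral_Radius"
    "Jordan_Normal_Form.DL_Submatrix"
begin

section \<open>Edge-coloured directed graphs\<close>

text \<open>
  The \<open>K\<close> colours are the numbers \<open>0, \<dots>, K - 1\<close>. Accordingly the
  \<open>2K\<close> coordinates of degree vectors are numbered from 0: coordinate \<open>2i\<close> belongs to
  outgoing and coordinate \<open>2i + 1\<close> to incoming edges of colour \<open>i\<close>.
\<close>

record ('v, 'e) cgraph =
  graph :: "('v, 'e) pre_digraph"
  colour :: "'e \<Rightarrow> nat"

text \<open>Every incident edge is counted; a loop counts both as outgoing and as incoming.\<close>

definition deg :: "('v, 'e) cgraph \<Rightarrow> 'v \<Rightarrow> nat" where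
  "deg G v = out_degree (graph G) v + in_degree (graph G) v"

definition max_deg :: "('v, 'e) cgraph \<Rightarrow> nat" where
  "max_deg G = Max (deg G ` verts (graph G))"

definition kappa :: "nat \<Rightarrow> ('v, 'e) cgraph \<Rightarrow> 'v \<Rightarrow> real vec" where
  "kappa K G v = vec (2 * K) (\<lambda>a.
     real (card {e \<in> (if even a then out_arcs (graph G) v else in_arcs (graph G) v).
                 colour G e = a div 2}))"

definition undirected_dist :: "('v, 'e) pre_digraph \<Rightarrow> 'v \<Rightarrow> 'v \<Rightarrow> ereal" where
  "undirected_dist G u v = wf_digraph.\<mu> (with_proj (mk_symmetric G)) (\<lambda>_. 1) u v"


section \<open>Edge iterated graph systems\<close>

record ('v, 'e) eigs =
  num_colours :: nat
  repl :: "nat \<Rightarrow> ('v, 'e) cgraph"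
  beta_plus :: "nat \<Rightarrow> 'v"
  beta_minus :: "nat \<Rightarrow> 'v"

text \<open>Parallel edges and loops are not excluded.\<close>

definition is_eigs :: "('v, 'e) eigs \<Rightarrow> bool" where
  "is_eigs S \<longleftrightarrow> num_colours S \<ge> 1 \<and>
    (\<forall>i < num_colours S.
       fin_digraph (graph (repl S i)) \<and>
       Digraph_Component.connected (graph (repl S i)) \<and>
       (\<forall>e \<in> arcs (graph (repl S i)). colour (repl S i) e < num_colours S) \<and>
       beta_plus S i \<in> verts (graph (repl S i)) \<and>
       beta_minus S i \<in> verts (graph (repl S i)) \<and>
       undirected_dist (graph (repl S i)) (beta_plus S i) (beta_minus S i) \<ge> 2)"

text \<open>
  An edge of generation \<open>n\<close> is addressed by the list, most recent entry first, of the \<open>n\<close>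
  edges of replacement graphs that lead to it; the initial edge has address \<open>[]\<close>.
  \<open>Inner p w\<close> is the vertex \<open>w\<close> in the copy which replaced the edge with address \<open>p\<close>.
  Since \<open>p\<close> determines both the edge and its generation, these copies are fresh.
\<close>

datatype ('v, 'e) xvert = Seed_tail | Seed_head | Inner "'e list" 'v

definition place ::
    "('v, 'e) eigs \<Rightarrow> (('v, 'e) xvert, 'e list) cgraph \<Rightarrow> 'e list \<Rightarrow> 'v \<Rightarrow> ('v, 'e) xvert" where
  "place S G p w =
    (if w = beta_plus S (colour G p) then tail (graph G) p
     else if w = beta_minus S (colour G p) then head (graph G) p
     else Inner p w)"

definition replace_edges ::
    "('v, 'e) eigs \<Rightarrow> (('v, 'e) xvert, 'e list) cgraph \<Rightarrow> (('v, 'e) xvert, 'e list) cgraph" where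
  "replace_edges S G =
    \<lparr> graph =
        \<lparr> verts = verts (graph G) \<union>
            {place S G p w | p w. p \<in> arcs (graph G) \<and> w \<in> verts (graph (repl S (colour G p)))},
          arcs = {e # p | e p. p \<in> arcs (graph G) \<and> e \<in> arcs (graph (repl S (colour G p)))},
          tail = (\<lambda>q. place S G (tl q) (tail (graph (repl S (colour G (tl q)))) (hd q))),
          head = (\<lambda>q. place S G (tl q) (head (graph (repl S (colour G (tl q)))) (hd q))) \<rparr>,
      colour = (\<lambda>q. colour (repl S (colour G (tl q))) (hd q)) \<rparr>"

definition single_edge :: "nat \<Rightarrow> (('v, 'e) xvert, 'e list) cgraph" where
  "single_edge \<iota> =
    \<lparr> graph = \<lparr> verts = {Seed_tail, Seed_head}, arcs = {[]},
                tail = (\<lambda>_. Seed_tail), head = (\<lambda>_. Seed_head) \<rparr>,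
      colour = (\<lambda>_. \<iota>) \<rparr>"

primrec Xi :: "('v, 'e) eigs \<Rightarrow> nat \<Rightarrow> nat \<Rightarrow> (('v, 'e) xvert, 'e list) cgraph" where
  "Xi S \<iota> 0 = single_edge \<iota>"
| "Xi S \<iota> (Suc n) = replace_edges S (Xi S \<iota> n)"

definition Xi_verts :: "('v, 'e) eigs \<Rightarrow> nat \<Rightarrow> ('v, 'e) xvert set" where
  "Xi_verts S \<iota> = (\<Union>n. verts (graph (Xi S \<iota> n)))"

definition birth_gen :: "('v, 'e) eigs \<Rightarrow> nat \<Rightarrow> ('v, 'e) xvert \<Rightarrow> nat" where
  "birth_gen S \<iota> v = (LEAST m. v \<in> verts (graph (Xi S \<iota> m)))"

definition birth_type :: "('v, 'e) eigs \<Rightarrow> nat \<Rightarrow> ('v, 'e) xvert \<Rightarrow> real vec" where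
  "birth_type S \<iota> v = kappa (num_colours S) (Xi S \<iota> (birth_gen S \<iota> v)) v"

definition mass_matrix :: "('v, 'e) eigs \<Rightarrow> real mat" where
  "mass_matrix S = mat (num_colours S) (num_colours S) (\<lambda>(i, k).
     real (card {e \<in> arcs (graph (repl S i)). colour (repl S i) e = k}))"

definition degree_matrix :: "('v, 'e) eigs \<Rightarrow> real mat" where
  "degree_matrix S = mat (2 * num_colours S) (2 * num_colours S) (\<lambda>(a, b).
     kappa (num_colours S) (repl S (a div 2))
       (if even a then beta_plus S (a div 2) else beta_minus S (a div 2)) $ b)"


section \<open>Frobenius structure of nonnegative square matrices\<close>

definition reaches :: "real mat \<Rightarrow> nat \<Rightarrow> nat \<Rightarrow> bool" where
  "reaches X a b \<longleftrightarrow> (\<exists>n. (X ^\<^sub>m n) $$ (a, b) > 0)"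

definition reachable_indices :: "real mat \<Rightarrow> nat \<Rightarrow> nat set" where
  "reachable_indices X a = {b. b < dim_row X \<and> reaches X a b}"

definition block_of :: "real mat \<Rightarrow> nat \<Rightarrow> nat set" where
  "block_of X a = {b. b < dim_row X \<and> reaches X a b \<and> reaches X b a}"

definition blocks :: "real mat \<Rightarrow> nat set set" where
  "blocks X = block_of X ` {..<dim_row X}"

definition diagonal_block :: "real mat \<Rightarrow> nat set \<Rightarrow> real mat" where
  "diagonal_block X B = submatrix X B B"

definition block_radius :: "real mat \<Rightarrow> nat set \<Rightarrow> real" where
  "block_radius X B = spectral_radius (map_mat complex_of_real (diagonal_block X B))"

definition block_reaches :: "real mat \<Rightarrow> nat set \<Rightarrow> nat set \<Rightarrow> bool" where
  "block_reaches X B C \<longleftrightarrow> (\<exists>a\<in>B. \<exists>b\<in>C. reaches X a b)"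

definition reachable_blocks :: "real mat \<Rightarrow> nat \<Rightarrow> nat set set" where
  "reachable_blocks X a = {B \<in> blocks X. block_reaches X (block_of X a) B}"

definition primitive_mat :: "real mat \<Rightarrow> bool" where
  "primitive_mat A \<longleftrightarrow> square_mat A \<and>
     (\<forall>i < dim_row A. \<forall>j < dim_row A. A $$ (i, j) \<ge> 0) \<and>
     (\<exists>n > 0. \<forall>i < dim_row A. \<forall>j < dim_row A. (A ^\<^sub>m n) $$ (i, j) > 0)"

definition primitive_frobenius :: "real mat \<Rightarrow> bool" where
  "primitive_frobenius X \<longleftrightarrow> (\<forall>B \<in> blocks X. primitive_mat (diagonal_block X B))"

definition max_radius :: "real mat \<Rightarrow> nat \<Rightarrow> real" where
  "max_radius X a = Max (block_radius X ` reachable_blocks X a)"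

definition block_chain :: "real mat \<Rightarrow> nat \<Rightarrow> nat set list \<Rightarrow> bool" where
  "block_chain X a Bs \<longleftrightarrow> Bs \<noteq> [] \<and> hd Bs = block_of X a \<and> set Bs \<subseteq> blocks X \<and>
     distinct Bs \<and> successively (block_reaches X) Bs"

definition varkappa :: "real mat \<Rightarrow> nat \<Rightarrow> nat" where
  "varkappa X a = Max {length (filter (\<lambda>B. block_radius X B = max_radius X a) Bs) | Bs.
     block_chain X a Bs}"


section \<open>Degree growth\<close>

definition birth_types :: "('v, 'e) eigs \<Rightarrow> nat \<Rightarrow> real vec set" where
  "birth_types S \<iota> =
     kappa (num_colours S) (Xi S \<iota> 0) ` verts (graph (Xi S \<iota> 0)) \<union>
     (\<Union>j \<in> reachable_indices (mass_matrix S) \<iota>.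
        kappa (num_colours S) (repl S j) `
          (verts (graph (repl S j)) - {beta_plus S j, beta_minus S j}))"

definition growth :: "('v, 'e) eigs \<Rightarrow> real vec \<Rightarrow> real" where
  "growth S u = Max {max_radius (degree_matrix S) a | a. a < dim_vec u \<and> u $ a > 0}"

definition tau :: "('v, 'e) eigs \<Rightarrow> real vec \<Rightarrow> nat" where
  "tau S u = Max {varkappa (degree_matrix S) a | a.
     a < dim_vec u \<and> u $ a > 0 \<and> max_radius (degree_matrix S) a = growth S u}"

definition max_growth :: "('v, 'e) eigs \<Rightarrow> nat \<Rightarrow> real" where
  "max_growth S \<iota> = Max (growth S ` birth_types S \<iota>)"

definition tau_deg :: "('v, 'e) eigs \<Rightarrow> nat \<Rightarrow> nat" where
  "tau_deg S \<iota> = Max {tau S u | u. u \<in> birth_types S \<iota> \<and> growth S u = max_growth S \<iota>}"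

definition l1_norm :: "real vec \<Rightarrow> real" where
  "l1_norm u = (\<Sum>a < dim_vec u. \<bar>u $ a\<bar>)"

text \<open>The exponents \<open>tau S u - 1\<close> are not truncated: the chain ending in a block of maximal
  radius shows \<open>tau S u \<ge> 1\<close>.\<close>

definition c_deg :: "('v, 'e) eigs \<Rightarrow> real vec \<Rightarrow> real" where
  "c_deg S u = (THE c. c > 0 \<and>
     (\<lambda>n. l1_norm (row (mat_of_row u * degree_matrix S ^\<^sub>m n) 0)) \<sim>[sequentially]
     (\<lambda>n. c * real n ^ (tau S u - 1) * growth S u ^ n))"

definition deg_ratio :: "('v, 'e) eigs \<Rightarrow> nat \<Rightarrow> ('v, 'e) xvert \<Rightarrow> nat \<Rightarrow> real" where
  "deg_ratio S \<iota> v n = real (deg (Xi S \<iota> n) v) / real (max_deg (Xi S \<iota> n))"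

definition deg_hat :: "('v, 'e) eigs \<Rightarrow> nat \<Rightarrow> ('v, 'e) xvert \<Rightarrow> real" where
  "deg_hat S \<iota> v = lim (deg_ratio S \<iota> v)"

end

theory Submission
  imports Defs "HOL-Real_Asymp.Real_Asymp"
begin

text \<open>
  The degree vector of a vertex evolves by right multiplication with the degree matrix \<open>N\<close>, so a
  vertex of birth type \<open>u\<close> has degree \<open>\<parallel>u N\<^sup>k\<parallel>\<^sub>1\<close> at age \<open>k\<close>.  As every row of \<open>N\<close> sums to at least 1,
  this is nondecreasing in \<open>k\<close>, and the maximum degree of generation \<open>n\<close> is attained at the oldest
  vertex of one of the finitely many birth types.

  The growth of \<open>N\<^sup>k 1\<close> is computed by induction along the block order.  A path either stays in the
  block of its starting index, or leaves it at a first edge; so a row sum is a sum of powers of a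
  primitive block, which behave like \<open>\<rho>\<^sup>n\<close> by Perron's theorem, and of convolutions of such powers
  with row sums of lower blocks.  The convolution of \<open>r\<^sup>n\<close> with \<open>n\<^sup>k m\<^sup>n\<close> grows like the larger of the
  two, except that in the resonant case \<open>r = m\<close> it gains a factor \<open>n\<close>: this is what counting the
  blocks of maximal radius along chains records.
\<close>

section \<open>Growth of convolutions\<close>

text \<open>Primitivity, as opposed to mere irreducibility, makes the normalised powers of a block
  converge instead of oscillating with a period. \<open>block_radius\<close> is a spectral radius
  over the complex numbers, and Perron's theorem is reached from there: the moduli of an eigenvector
  for an eigenvalue of largest modulus satisfy \<rho> w \<le> A w, and a positive power of A would
  turn any slack into growth at a rate above \<rho>, which the spectral bound forbids. Hence A w =
  \<rho> w; weighting by w makes the block stochastic, and a positive stochastic matrix contracts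
  oscillations. Sums are handled at a single scale n^k l^n: each summand has a limit there, namely 0
  if it is of lower order. All limits are nonnegative, so nothing cancels and one positive limit
  suffices. Row sums and the coordinates of a birth type are treated in this way; birth types are
  compared at a common scale too, where a delay of m generations costs the factor \<Lambda>^-m. Rows
  of N sum to at least 1 because a planting vertex lies in a connected graph with at least two
  vertices and so has an incident edge.\<close>

text \<open>Normalising by \<open>n + 1\<close> instead of \<open>n\<close> keeps the denominator nonzero at \<open>n = 0\<close>.\<close>

definition grows :: "(nat \<Rightarrow> real) \<Rightarrow> real \<Rightarrow> nat \<Rightarrow> real \<Rightarrow> bool" where
  "grows f c k l \<longleftrightarrow> (\<lambda>n. f n / (real (Suc n) ^ k * l ^ n)) \<longlonglongrightarrow> c"

lemma grows_asymp_equiv: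
  assumes "grows f c k l" "c > 0" "l > 0"
  shows "f \<sim>[sequentially] (\<lambda>n. c * real n ^ k * l ^ n)"
proof -
  have a: "(\<lambda>n. real (Suc n) / real n) \<longlonglongrightarrow> 1"
    by real_asymp
  have "(\<lambda>n. f n / (real (Suc n) ^ k * l ^ n) * (real (Suc n) / real n) ^ k / c)
      \<longlonglongrightarrow> c * 1 ^ k / c"
    using assms a unfolding grows_def by (intro tendsto_intros) auto
  moreover have "eventually (\<lambda>n. f n / (real (Suc n) ^ k * l ^ n) * (real (Suc n) / real n) ^ k / c
      = f n / (c * real n ^ k * l ^ n)) sequentially"
    using eventually_gt_at_top[of 0]
    by eventually_elim (use assms in \<open>simp add: power_divide field_simps del: of_nat_Suc\<close>)
  ultimately have "(\<lambda>n. f n / (c * real n ^ k * l ^ n)) \<longlonglongrightarrow> 1"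
    using assms by (auto elim: Lim_transform_eventually)
  then show ?thesis
    by (rule asymp_equivI'_const[where c = 1, simplified])
qed

text \<open>\<open>asymp_equiv\<close> reads 0/0 as 1, so it agrees with the plain quotient only
  where \<open>g\<close> is nonzero.\<close>

lemma asymp_equiv_tendsto_ratio:
  fixes f g :: "nat \<Rightarrow> real"
  assumes "f \<sim>[sequentially] g" "eventually (\<lambda>n. g n \<noteq> 0) sequentially"
  shows "(\<lambda>n. f n / g n) \<longlonglongrightarrow> 1"
  using assms(1) unfolding asymp_equiv_def
  by (rule Lim_transform_eventually) (use assms(2) in \<open>auto elim: eventually_mono\<close>)

text \<open>This direction serves uniqueness: two constants admissible in \<open>c_deg\<close>
  become limits of one sequence.\<close>

lemma asymp_equiv_grows:
  assumes "f \<sim>[sequentially] (\<lambda>n. c * real n ^ k * l ^ n)" "c > 0" "l > 0"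
  shows "grows f c k l"
proof -
  have "eventually (\<lambda>n. c * real n ^ k * l ^ n \<noteq> 0) sequentially"
    using eventually_gt_at_top[of 0] by eventually_elim (use assms in auto)
  then have "(\<lambda>n. f n / (c * real n ^ k * l ^ n)) \<longlonglongrightarrow> 1"
    using asymp_equiv_tendsto_ratio assms(1) by blast
  moreover have a: "(\<lambda>n. real n / real (Suc n)) \<longlonglongrightarrow> 1"
    by real_asymp
  ultimately have "(\<lambda>n. f n / (c * real n ^ k * l ^ n) * (real n / real (Suc n)) ^ k * c)
      \<longlonglongrightarrow> 1 * 1 ^ k * c"
    by (intro tendsto_intros)
  moreover have "eventually (\<lambda>n. f n / (c * real n ^ k * l ^ n) * (real n / real (Suc n)) ^ k * c
      = f n / (real (Suc n) ^ k * l ^ n)) sequentially"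
    using eventually_gt_at_top[of 0]
    by eventually_elim (use assms in \<open>simp add: power_divide field_simps del: of_nat_Suc\<close>)
  ultimately show ?thesis
    unfolding grows_def by (auto elim: Lim_transform_eventually)
qed

lemma grows_unique: "grows f c k l \<Longrightarrow> grows f d k l \<Longrightarrow> c = d"
  unfolding grows_def by (rule LIMSEQ_unique)

lemma summable_poly_geometric:
  fixes q :: real
  assumes "0 < q" "q < 1"
  shows "summable (\<lambda>n. real (Suc n) ^ k * q ^ n)"
proof -
  have a: "(\<lambda>n. real (Suc (Suc n)) / real (Suc n)) \<longlonglongrightarrow> 1"
    by real_asymp
  have "(\<lambda>n. (real (Suc (Suc n)) / real (Suc n)) ^ k * q) \<longlonglongrightarrow> 1 ^ k * q"
    by (intro tendsto_intros a)
  \<comment> \<open>The ratio of consecutive terms tends to q itself, so the ratio test needs a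
    bound strictly between q and 1.\<close>
  moreover obtain c where c: "q < c" "c < 1" using dense[OF assms(2)] by blast
  ultimately have "\<forall>\<^sub>F n in sequentially. (real (Suc (Suc n)) / real (Suc n)) ^ k * q < c"
    by (intro order_tendstoD(2)) auto
  then obtain N where N: "\<And>n. n \<ge> N \<Longrightarrow> (real (Suc (Suc n)) / real (Suc n)) ^ k * q < c"
    by (auto simp: eventually_sequentially)
  show ?thesis
  proof (rule summable_ratio_test[OF c(2)])
    fix n assume "N \<le> n"
    from N[OF this] have "real (Suc (Suc n)) ^ k * q \<le> c * real (Suc n) ^ k"
      by (simp add: power_divide divide_simps split: if_splits)
    from mult_right_mono[OF this, of "q ^ n"] 
    show "norm (real (Suc (Suc n)) ^ k * q ^ Suc n) \<le> c * norm (real (Suc n) ^ k * q ^ n)"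
      using assms by (simp add: abs_mult mult_ac)
  qed
qed

section \<open>Comparing and shifting growth scales\<close>

lemma null_comparison:
  fixes f g :: "nat \<Rightarrow> real"
  assumes "\<forall>\<^sub>F n in sequentially. norm (f n) \<le> g n" "g \<longlonglongrightarrow> 0"
  shows "f \<longlonglongrightarrow> 0"
  by (rule tendsto_rabs_zero_cancel, rule tendsto_sandwich[OF _ _ tendsto_const assms(2)])
    (use assms(1) in auto)

text \<open>Puts summands of different orders on one scale: a term of lower order still has a limit
  there, namely 0. For equal bases the quotient of the scales is a negative power of
  \<open>Suc n\<close>; for a larger base the geometric factor wins whatever k and k' are.\<close>

lemma grows_weaken:
  assumes "grows f c k l" "0 < l" "l < l' \<or> l = l' \<and> k < k'"
  shows "grows f 0 k' l'"
proof -
  have "(\<lambda>n. real (Suc n) ^ k / real (Suc n) ^ k' * (l / l') ^ n) \<longlonglongrightarrow> 0"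
  proof (cases "l = l'")
    case True
    then have "k < k'" using assms by auto
    then have e: "real (Suc n) ^ k / real (Suc n) ^ k' * (l / l') ^ n = inverse (real (Suc n)) ^ (k' - k)" for n
      using True assms(2) by (simp add: power_diff field_simps del: of_nat_Suc)
    have "(\<lambda>n. inverse (real (Suc n)) ^ (k' - k)) \<longlonglongrightarrow> 0 ^ (k' - k)"
      by (intro tendsto_intros LIMSEQ_inverse_real_of_nat)
    then show ?thesis unfolding e using \<open>k < k'\<close> by (simp only: power_0_left) simp
  next
    case False
    then have "0 < l / l'" "l / l' < 1" using assms by (auto simp: divide_simps)
    note z = summable_LIMSEQ_zero[OF summable_poly_geometric[OF this, of k]]
    show ?thesis
    \<comment> \<open>Dropping the denominator, which is at least 1, leaves the terms of a
      convergent series.\<close>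
    proof (rule null_comparison[OF _ z])
      show "\<forall>\<^sub>F n in sequentially. norm (real (Suc n) ^ k / real (Suc n) ^ k' * (l / l') ^ n)
          \<le> real (Suc n) ^ k * (l / l') ^ n"
      proof (intro always_eventually allI)
        fix n
        have "real (Suc n) ^ k / real (Suc n) ^ k' \<le> real (Suc n) ^ k / 1"
          by (intro divide_left_mono) auto
        moreover have "(l / l') ^ n \<ge> 0" using \<open>0 < l / l'\<close> by simp
        ultimately show "norm (real (Suc n) ^ k / real (Suc n) ^ k' * (l / l') ^ n)
          \<le> real (Suc n) ^ k * (l / l') ^ n"
          by (metis abs_of_nonneg div_by_1 divide_nonneg_nonneg mult_nonneg_nonneg mult_right_mono of_nat_0_le_iff real_norm_def zero_le_power)
      qed
    qed
  qed
  then have "(\<lambda>n. f n / (real (Suc n) ^ k * l ^ n) * (real (Suc n) ^ k / real (Suc n) ^ k' * (l / l') ^ n))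
    \<longlonglongrightarrow> c * 0"
    using assms(1) unfolding grows_def by (intro tendsto_intros)
  moreover have "f n / (real (Suc n) ^ k * l ^ n) * (real (Suc n) ^ k / real (Suc n) ^ k' * (l / l') ^ n)
     = f n / (real (Suc n) ^ k' * l' ^ n)" for n
    using assms(2,3) by (simp add: power_divide field_simps del: of_nat_Suc)
  ultimately show ?thesis unfolding grows_def by simp
qed

lemma grows_sum:
  assumes "\<And>i. i \<in> I \<Longrightarrow> grows (f i) (c i) k l"
  shows "grows (\<lambda>n. \<Sum>i\<in>I. f i n) (\<Sum>i\<in>I. c i) k l"
  using assms unfolding grows_def sum_divide_distrib by (intro tendsto_sum) auto

lemma grows_add: "grows f c k l \<Longrightarrow> grows g d k l \<Longrightarrow> grows (\<lambda>n. f n + g n) (c + d) k l"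
  unfolding grows_def add_divide_distrib by (rule tendsto_add)

lemma grows_cmult: "grows f c k l \<Longrightarrow> grows (\<lambda>n. a * f n) (a * c) k l"
  unfolding grows_def times_divide_eq_right[symmetric] by (rule tendsto_mult_left)

text \<open>A vertex born in generation m has age n - m in generation n; the factor l^-m of the
  degree formula arises here. The truncation of n - m concerns only the finitely many n < m.\<close>

lemma grows_shift:
  assumes "grows f c k l" "l > 0"
  shows "grows (\<lambda>n. f (n - m)) (c / l ^ m) k l"
proof -
  have "(\<lambda>n. f n / (real (Suc n) ^ k * l ^ n) * (real (Suc n) / real (Suc (n + m))) ^ k / l ^ m)
     \<longlonglongrightarrow> c * 1 ^ k / l ^ m"
    using assms unfolding grows_def
    by (intro tendsto_intros) (auto, real_asymp)
  moreover have "f n / (real (Suc n) ^ k * l ^ n) * (real (Suc n) / real (Suc (n + m))) ^ k / l ^ m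
     = f (n + m - m) / (real (Suc (n + m)) ^ k * l ^ (n + m))" for n
    using assms(2) by (simp add: power_add power_divide field_simps del: of_nat_Suc of_nat_add)
  ultimately have "(\<lambda>n. f (n + m - m) / (real (Suc (n + m)) ^ k * l ^ (n + m))) \<longlonglongrightarrow> c / l ^ m"
    by simp
  then show ?thesis unfolding grows_def by (rule LIMSEQ_offset)
qed

text \<open>Dominated convergence (Tannery's theorem) for sums whose range grows with n: past a
  fixed N the tail of \<open>a\<close> is small against the bound \<open>D\<close>, and below N
  there are finitely many convergent terms.\<close>

lemma tendsto_triangular_sum:
  fixes a :: "nat \<Rightarrow> real" and b :: "nat \<Rightarrow> nat \<Rightarrow> real"
  assumes "\<And>i. a i \<ge> 0" "summable a" "\<And>i. (\<lambda>n. b n i) \<longlonglongrightarrow> \<beta>"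
    and "\<And>n i. i < n \<Longrightarrow> \<bar>b n i\<bar> \<le> D"
  shows "(\<lambda>n. \<Sum>i<n. a i * b n i) \<longlonglongrightarrow> suminf a * \<beta>"
proof -
  have D: "D \<ge> 0" using assms(4)[of 0 1] by auto
  have \<beta>: "\<bar>\<beta>\<bar> \<le> D"
  proof (rule tendsto_upperbound[OF tendsto_rabs[OF assms(3)[of 0]]])
    show "\<forall>\<^sub>F n in sequentially. \<bar>b n 0\<bar> \<le> D"
      using eventually_gt_at_top[of 0] by eventually_elim (use assms(4) in auto)
  qed simp
  have null: "(\<lambda>n. \<Sum>i<n. a i * (b n i - \<beta>)) \<longlonglongrightarrow> 0"
  proof (rule LIMSEQ_I)
    fix r :: real assume r: "0 < r"
    \<comment> \<open>The tail contributes at most 2 D t, because b and \<beta> differ by at most 2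
      D. The + 1 covers D = 0.\<close>
    define t where "t = r / (4 * (D + 1))"
    have t: "t > 0" "2 * D * t < r / 2" using r D by (auto simp: t_def field_simps)
    obtain N where N: "suminf a - sum a {..<N} < t"
      using LIMSEQ_D[OF summable_LIMSEQ[OF assms(2)] t(1)] by (auto simp: abs_less_iff)
    have "(\<lambda>n. \<Sum>i<N. a i * \<bar>b n i - \<beta>\<bar>) \<longlonglongrightarrow> (\<Sum>i<N. a i * \<bar>\<beta> - \<beta>\<bar>)"
      by (intro tendsto_intros assms)
    then obtain M where M: "\<And>n. n \<ge> M \<Longrightarrow> \<bar>\<Sum>i<N. a i * \<bar>b n i - \<beta>\<bar>\<bar> < r / 2"
      using LIMSEQ_D[of _ 0 "r / 2"] r by fastforce
    have "norm ((\<Sum>i<n. a i * (b n i - \<beta>)) - 0) < r" if n: "n \<ge> max N M" for n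
    proof -
      have split: "sum g {..<n} = sum g {..<N} + sum g {N..<n}" for g :: "nat \<Rightarrow> real"
        using n sum.atLeastLessThan_concat[of 0 N n g] by (simp add: lessThan_atLeast0)
      have "norm (\<Sum>i<n. a i * (b n i - \<beta>)) \<le> (\<Sum>i<n. a i * \<bar>b n i - \<beta>\<bar>)"
        using assms(1) by (intro sum_norm_le) (simp add: abs_mult)
      also have "\<dots> = (\<Sum>i<N. a i * \<bar>b n i - \<beta>\<bar>) + (\<Sum>i\<in>{N..<n}. a i * \<bar>b n i - \<beta>\<bar>)"
        by (rule split)
      also have "(\<Sum>i\<in>{N..<n}. a i * \<bar>b n i - \<beta>\<bar>) \<le> (\<Sum>i\<in>{N..<n}. a i * (2 * D))"
        using assms(1,4) \<beta> by (intro sum_mono mult_left_mono) (fastforce simp: abs_le_iff)+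
      also have "\<dots> = 2 * D * (sum a {..<n} - sum a {..<N})"
        using split[of a] by (simp add: sum_distrib_left mult_ac)
      also have "\<dots> \<le> 2 * D * t"
        using N sum_le_suminf[OF assms(2), of "{..<n}"] assms(1) D by (intro mult_left_mono) auto
      finally have "norm (\<Sum>i<n. a i * (b n i - \<beta>)) \<le> (\<Sum>i<N. a i * \<bar>b n i - \<beta>\<bar>) + 2 * D * t"
        by simp
      moreover have "(\<Sum>i<N. a i * \<bar>b n i - \<beta>\<bar>) < r / 2" using M[of n] n by auto
      ultimately show ?thesis using t(2) by simp
    qed
    then show "\<exists>no. \<forall>n\<ge>no. norm ((\<Sum>i<n. a i * (b n i - \<beta>)) - 0) < r" by blast
  qed
  have "(\<lambda>n. (\<Sum>i<n. a i * (b n i - \<beta>)) + (\<Sum>i<n. a i) * \<beta>) \<longlonglongrightarrow> 0 + suminf a * \<beta>"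
    by (intro tendsto_intros null summable_LIMSEQ assms)
  then show ?thesis
    by (simp add: right_diff_distrib sum_subtractf sum_distrib_right)
qed

text \<open>Takes the place of dominated convergence in the resonant case, where the weights are
  spread evenly over 0, ..., n - 1.\<close>

lemma cesaro_null:
  fixes e :: "nat \<Rightarrow> real"
  assumes "e \<longlonglongrightarrow> 0"
  shows "(\<lambda>n. (\<Sum>i<n. \<bar>e i\<bar>) / real (Suc n)) \<longlonglongrightarrow> 0"
proof (rule LIMSEQ_I)
  fix r :: real assume r: "0 < r"
  obtain N where N: "\<And>n. n \<ge> N \<Longrightarrow> \<bar>e n\<bar> < r / 2"
    using LIMSEQ_D[OF assms, of "r / 2"] r by auto
  define B where "B = (\<Sum>i<N. \<bar>e i\<bar>)"
  have "(\<lambda>n. B / real (Suc n)) \<longlonglongrightarrow> 0" by real_asymp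
  then obtain M where M: "\<And>n. n \<ge> M \<Longrightarrow> \<bar>B / real (Suc n)\<bar> < r / 2"
    using LIMSEQ_D[of "\<lambda>n. B / real (Suc n)" 0 "r / 2"] r by auto
  have "norm ((\<Sum>i<n. \<bar>e i\<bar>) / real (Suc n) - 0) < r" if n: "n \<ge> max N M" for n
  proof -
    have "(\<Sum>i<n. \<bar>e i\<bar>) = B + (\<Sum>i\<in>{N..<n}. \<bar>e i\<bar>)"
      unfolding B_def using n sum.atLeastLessThan_concat[of 0 N n "\<lambda>i. \<bar>e i\<bar>"]
      by (simp add: lessThan_atLeast0)
    also have "(\<Sum>i\<in>{N..<n}. \<bar>e i\<bar>) \<le> (\<Sum>i\<in>{N..<n}. r / 2)"
      using N by (intro sum_mono) (auto intro: less_imp_le)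
    also have "\<dots> \<le> real (Suc n) * (r / 2)" using r n
      by (simp add: of_nat_diff algebra_simps)
    finally have "(\<Sum>i<n. \<bar>e i\<bar>) \<le> B + real (Suc n) * (r / 2)" by simp
    then have "(\<Sum>i<n. \<bar>e i\<bar>) / real (Suc n) \<le> (B + real (Suc n) * (r / 2)) / real (Suc n)"
      by (intro divide_right_mono) auto
    then have "(\<Sum>i<n. \<bar>e i\<bar>) / real (Suc n) \<le> B / real (Suc n) + r / 2"
      by (simp add: add_divide_distrib del: of_nat_Suc)
    also have "\<dots> < r" using M[of n] n abs_ge_self[of "B / real (Suc n)"] by linarith
    finally show ?thesis by (simp add: sum_nonneg)
  qed
  then show "\<exists>no. \<forall>n\<ge>no. norm ((\<Sum>i<n. \<bar>e i\<bar>) / real (Suc n) - 0) < r" by blast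
qed

text \<open>A Riemann sum for the integral of x^k over [0, 1], evaluated by telescoping: the
  difference of (j+1)^(k+1) and j^(k+1) lies between (k+1) j^k and (k+1) (j+1)^k.\<close>

lemma sum_powers_tendsto:
  "(\<lambda>n. (\<Sum>j<n. real (Suc j) ^ k) / real (Suc n) ^ Suc k) \<longlonglongrightarrow> 1 / real (Suc k)"
proof -
  have step: "real (Suc j) ^ Suc k - real j ^ Suc k \<le> real (Suc k) * real (Suc j) ^ k"
    "real (Suc k) * real j ^ k \<le> real (Suc j) ^ Suc k - real j ^ Suc k" for j
  proof -
    have eq: "real (Suc j) ^ Suc k - real j ^ Suc k = (\<Sum>p<Suc k. real (Suc j) ^ p * real j ^ (k - p))"
      by (subst diff_power_eq_sum) simp
    have "(\<Sum>p<Suc k. real (Suc j) ^ p * real j ^ (k - p)) \<le> (\<Sum>p<Suc k. real (Suc j) ^ p * real (Suc j) ^ (k - p))"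
      by (intro sum_mono mult_left_mono power_mono) auto
    also have "\<dots> = (\<Sum>p<Suc k. real (Suc j) ^ k)"
      by (intro sum.cong refl) (simp add: power_add[symmetric] del: of_nat_Suc)
    finally show "real (Suc j) ^ Suc k - real j ^ Suc k \<le> real (Suc k) * real (Suc j) ^ k"
      unfolding eq by simp
    have "(\<Sum>p<Suc k. real (Suc j) ^ p * real j ^ (k - p)) \<ge> (\<Sum>p<Suc k. real j ^ p * real j ^ (k - p))"
      by (intro sum_mono mult_right_mono power_mono) auto
    moreover have "(\<Sum>p<Suc k. real j ^ p * real j ^ (k - p)) = (\<Sum>p<Suc k. real j ^ k)"
      by (intro sum.cong refl) (simp add: power_add[symmetric])
    ultimately show "real (Suc k) * real j ^ k \<le> real (Suc j) ^ Suc k - real j ^ Suc k"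
      unfolding eq by simp
  qed
  have lo: "real n ^ Suc k \<le> real (Suc k) * (\<Sum>j<n. real (Suc j) ^ k)" for n
  proof -
    have "real n ^ Suc k = (\<Sum>j<n. real (Suc j) ^ Suc k - real j ^ Suc k)"
      by (subst sum_lessThan_telescope) simp
    also have "\<dots> \<le> (\<Sum>j<n. real (Suc k) * real (Suc j) ^ k)"
      by (intro sum_mono step)
    finally show ?thesis by (simp add: sum_distrib_left)
  qed
  have hi: "real (Suc k) * (\<Sum>j<n. real (Suc j) ^ k) \<le> real (Suc n) ^ Suc k" for n
  proof -
    have "(\<Sum>j<n. real (Suc k) * real (Suc j) ^ k) \<le> (\<Sum>j<n. real (Suc (Suc j)) ^ Suc k - real (Suc j) ^ Suc k)"
      by (intro sum_mono step)
    also have "\<dots> = real (Suc n) ^ Suc k - 1"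
      by (subst sum_lessThan_telescope[of "\<lambda>j. real (Suc j) ^ Suc k"]) simp
    finally show ?thesis by (simp add: sum_distrib_left)
  qed
  show ?thesis
  proof (rule tendsto_sandwich)
    show "(\<lambda>n. (real n / real (Suc n)) ^ Suc k / real (Suc k)) \<longlonglongrightarrow> 1 / real (Suc k)"
    proof -
      have a: "(\<lambda>n. real n / real (Suc n)) \<longlonglongrightarrow> 1" by real_asymp
      have "(\<lambda>n. (real n / real (Suc n)) ^ Suc k / real (Suc k)) \<longlonglongrightarrow> 1 ^ Suc k / real (Suc k)"
        by (intro tendsto_intros a) simp
      then show ?thesis by simp
    qed
    show "(\<lambda>n. 1 / real (Suc k)) \<longlonglongrightarrow> 1 / real (Suc k)" by simp
    have pos: "real (Suc n) ^ Suc k > 0" for n by simp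
    have "(real n / real (Suc n)) ^ Suc k / real (Suc k) \<le> (\<Sum>j<n. real (Suc j) ^ k) / real (Suc n) ^ Suc k" for n
      using lo[of n] pos[of n] by (simp add: power_divide divide_simps del: of_nat_Suc power_Suc) (simp add: algebra_simps)
    then show "\<forall>\<^sub>F n in sequentially. (real n / real (Suc n)) ^ Suc k / real (Suc k) \<le> (\<Sum>j<n. real (Suc j) ^ k) / real (Suc n) ^ Suc k"
      by simp
    have "(\<Sum>j<n. real (Suc j) ^ k) / real (Suc n) ^ Suc k \<le> 1 / real (Suc k)" for n
      using hi[of n] pos[of n] by (simp add: divide_simps del: of_nat_Suc power_Suc) (simp add: algebra_simps)
    then show "\<forall>\<^sub>F n in sequentially. (\<Sum>j<n. real (Suc j) ^ k) / real (Suc n) ^ Suc k \<le> 1 / real (Suc k)"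
      by simp
  qed
qed

text \<open>The lengths n - \<open>Suc j\<close> and j add up to n - 1: the missing step is the edge
  by which a path leaves a block, between its part inside and its part afterwards.\<close>

definition conv :: "(nat \<Rightarrow> real) \<Rightarrow> (nat \<Rightarrow> real) \<Rightarrow> nat \<Rightarrow> real" where
  "conv q g n = (\<Sum>j<n. q (n - Suc j) * g j)"

lemma conv_alt: "conv q g n = (\<Sum>i<n. q i * g (n - Suc i))"
  unfolding conv_def by (subst sum.nat_diff_reindex[symmetric]) (auto intro!: sum.cong)

lemma power_split: "i < n \<Longrightarrow> x ^ n = x * x ^ i * x ^ (n - Suc i)"
  for x :: real
  by (metis Suc_leI le_add_diff_inverse power_Suc power_add)

section \<open>The three regimes of a convolution\<close>

lemma grows_bounded:
  assumes "grows f c k l" "l > 0"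
  obtains D where "D \<ge> 0" "\<And>n. \<bar>f n\<bar> \<le> D * real (Suc n) ^ k * l ^ n"
proof -
  have "Bseq (\<lambda>n. f n / (real (Suc n) ^ k * l ^ n))"
    using assms(1) unfolding grows_def by (meson convergentI convergent_imp_Bseq)
  then obtain D where D: "D > 0" "\<And>n. norm (f n / (real (Suc n) ^ k * l ^ n)) \<le> D"
    unfolding Bseq_def by auto
  have "\<bar>f n\<bar> \<le> D * real (Suc n) ^ k * l ^ n" for n
    using D(2)[of n] assms(2) by (simp add: abs_mult divide_simps mult_ac del: of_nat_Suc)
  with D(1) show ?thesis by (intro that[of D]) auto
qed

text \<open>The sum is the generating function of \<open>g\<close> at 1/r, which converges because r
  > m. It is positive because a sequence with limit d > 0 at its scale cannot vanish
  identically.\<close>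

lemma suminf_grows_pos:
  assumes g: "grows g d k m" "d > 0" "m > 0" "\<And>n. g n \<ge> 0" and r: "r > m"
  shows "summable (\<lambda>j. g j / r ^ j)" "suminf (\<lambda>j. g j / r ^ j) > 0"
proof -
  obtain D where D: "D \<ge> 0" "\<And>n. \<bar>g n\<bar> \<le> D * real (Suc n) ^ k * m ^ n"
    using grows_bounded[OF g(1,3)] by blast
  have "summable (\<lambda>n. D * (real (Suc n) ^ k * (m / r) ^ n))"
    using g(3) r by (intro summable_mult summable_poly_geometric) auto
  then show sm: "summable (\<lambda>j. g j / r ^ j)"
  proof (rule summable_comparison_test')
    fix n show "norm (g n / r ^ n) \<le> D * (real (Suc n) ^ k * (m / r) ^ n)"
      using D(2)[of n] g(3) r by (simp add: power_divide divide_simps mult_ac)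
  qed
  obtain j where "g j > 0"
  proof (rule ccontr)
    assume "\<not> thesis"
    then have "g n = 0" for n using g(4)[of n] that[of n] by linarith
    then have "grows g 0 k m" unfolding grows_def by simp
    then show False using grows_unique[OF g(1)] g(2) by auto
  qed
  then show "suminf (\<lambda>j. g j / r ^ j) > 0"
    using g r by (intro suminf_pos2[OF sm, of j]) auto
qed

text \<open>The mass sits at bounded j: dividing by r^n leaves the summable weights g j / r^j
  against the convergent quotient of q. The limit is p / r times the generating function of
  \<open>g\<close> at 1/r.\<close>

lemma grows_conv_left:
  assumes q: "grows q p 0 r" "p > 0" "r > 0"
    and g: "grows g d k m" "d > 0" "m > 0" "\<And>n. g n \<ge> 0"
    and rm: "m < r"
  shows "\<exists>c>0. grows (conv q g) c 0 r"
proof -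
  obtain D where D: "D \<ge> 0" "\<And>n. \<bar>q n\<bar> \<le> D * real (Suc n) ^ 0 * r ^ n"
    using grows_bounded[OF q(1,3)] by blast
  note s = suminf_grows_pos[OF g rm]
  define b where "b n i = q (n - Suc i) / r ^ (n - Suc i)" for n i
  have "(\<lambda>n. \<Sum>i<n. g i / r ^ i * b n i) \<longlonglongrightarrow> suminf (\<lambda>j. g j / r ^ j) * p"
  proof (rule tendsto_triangular_sum[where D = D])
    show "(\<lambda>n. b n i) \<longlonglongrightarrow> p" for i
    proof (rule LIMSEQ_offset[of _ "Suc i"])
      show "(\<lambda>n. b (n + Suc i) i) \<longlonglongrightarrow> p"
        using q(1) by (simp add: b_def grows_def)
    qed
    show "\<bar>b n i\<bar> \<le> D" for n i
      using D(2)[of "n - Suc i"] q(3) by (simp add: b_def divide_simps)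
  qed (use g q s in auto)
  from tendsto_mult_left[OF this, of "1 / r"]
  have "(\<lambda>n. 1 / r * (\<Sum>i<n. g i / r ^ i * b n i)) \<longlonglongrightarrow> 1 / r * (suminf (\<lambda>j. g j / r ^ j) * p)" .
  moreover have "1 / r * (\<Sum>i<n. g i / r ^ i * b n i) = conv q g n / (real (Suc n) ^ 0 * r ^ n)" for n
  proof -
    have "1 / r * (g i / r ^ i * b n i) = q (n - Suc i) * g i / r ^ n" if "i < n" for i
    proof -
      have "r ^ n = r * r ^ i * r ^ (n - Suc i)"
        using that by (intro power_split) auto
      then show ?thesis using q(3) by (simp add: b_def mult_ac)
    qed
    then show ?thesis unfolding conv_def sum_distrib_left sum_divide_distrib by simp
  qed
  ultimately have "grows (conv q g) (1 / r * (suminf (\<lambda>j. g j / r ^ j) * p)) 0 r"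
    by (simp add: grows_def)
  then show ?thesis using s q by (intro exI[of _ "1 / r * (suminf (\<lambda>j. g j / r ^ j) * p)"]) simp
qed

text \<open>Mirror image of \<open>grows_conv_left\<close>: the mass sits at bounded times of
  \<open>q\<close>, with weights q i / m^i, and \<open>g\<close> supplies the whole scale including
  the polynomial factor.\<close>

lemma grows_conv_right:
  assumes q: "grows q p 0 r" "p > 0" "r > 0" "\<And>n. q n \<ge> 0"
    and g: "grows g d k m" "d > 0" "m > 0"
    and rm: "r < m"
  shows "\<exists>c>0. grows (conv q g) c k m"
proof -
  obtain D where D: "D \<ge> 0" "\<And>n. \<bar>g n\<bar> \<le> D * real (Suc n) ^ k * m ^ n"
    using grows_bounded[OF g(1,3)] by blast
  note s = suminf_grows_pos[OF q rm]
  define b where "b n i = g (n - Suc i) / (real (Suc n) ^ k * m ^ (n - Suc i))" for n i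
  have "(\<lambda>n. \<Sum>i<n. q i / m ^ i * b n i) \<longlonglongrightarrow> suminf (\<lambda>j. q j / m ^ j) * d"
  proof (rule tendsto_triangular_sum[where D = D])
    show "(\<lambda>n. b n i) \<longlonglongrightarrow> d" for i
    proof (rule LIMSEQ_offset[of _ "Suc i"])
      \<comment> \<open>\<open>b\<close> is normalised by the k-th power belonging to n, not to the
        shifted argument of \<open>g\<close>; for fixed i the quotient of the two tends to
        1.\<close>
      have "(\<lambda>n. g n / (real (Suc n) ^ k * m ^ n) * (real (Suc n) / real (Suc (n + Suc i))) ^ k)
          \<longlonglongrightarrow> d * 1 ^ k"
        using g(1) unfolding grows_def by (intro tendsto_intros) (assumption, real_asymp)
      moreover have "g n / (real (Suc n) ^ k * m ^ n) * (real (Suc n) / real (Suc (n + Suc i))) ^ k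
         = b (n + Suc i) i" for n
        by (simp add: b_def power_divide field_simps del: of_nat_Suc of_nat_add)
      ultimately show "(\<lambda>n. b (n + Suc i) i) \<longlonglongrightarrow> d" by simp
    qed
    show "\<bar>b n i\<bar> \<le> D" if "i < n" for n i
    proof -
      have "\<bar>g (n - Suc i)\<bar> \<le> D * real (Suc (n - Suc i)) ^ k * m ^ (n - Suc i)" by (rule D)
      also have "\<dots> \<le> D * real (Suc n) ^ k * m ^ (n - Suc i)"
        using D(1) g(3) by (intro mult_right_mono mult_left_mono power_mono) auto
      finally show ?thesis using g(3) by (simp add: b_def abs_mult divide_simps mult_ac del: of_nat_Suc)
    qed
  qed (use g q s in auto)
  from tendsto_mult_left[OF this, of "1 / m"]
  have "(\<lambda>n. 1 / m * (\<Sum>i<n. q i / m ^ i * b n i)) \<longlonglongrightarrow> 1 / m * (suminf (\<lambda>j. q j / m ^ j) * d)" .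
  moreover have "1 / m * (\<Sum>i<n. q i / m ^ i * b n i) = conv q g n / (real (Suc n) ^ k * m ^ n)" for n
  proof -
    have "1 / m * (q i / m ^ i * b n i) = q i * g (n - Suc i) / (real (Suc n) ^ k * m ^ n)" if "i < n" for i
    proof -
      have "m ^ n = m * m ^ i * m ^ (n - Suc i)"
        using that by (intro power_split) auto
      then show ?thesis using g(3) by (simp add: b_def mult_ac)
    qed
    then show ?thesis unfolding conv_alt sum_distrib_left sum_divide_distrib by simp
  qed
  ultimately have "grows (conv q g) (1 / m * (suminf (\<lambda>j. q j / m ^ j) * d)) k m"
    by (simp add: grows_def)
  then show ?thesis using s g by (intro exI[of _ "1 / m * (suminf (\<lambda>j. q j / m ^ j) * d)"]) simp
qed

text \<open>With equal bases no bounded range of j dominates. The normalised summand is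
  \<open>w n j\<close> times a product that is close to p d once j and n - j are both large, and the
  weights \<open>w n j\<close> add up to about 1/(k+1). So the limit is p d / ((k+1) r).\<close>

lemma grows_conv_resonant:
  assumes q: "grows q p 0 r" "p > 0" "r > 0"
    and g: "grows g d k r" "d > 0"
  shows "\<exists>c>0. grows (conv q g) c (Suc k) r"
proof -
  define Q where "Q n = q n / r ^ n" for n
  define G where "G n = g n / (real (Suc n) ^ k * r ^ n)" for n
  have Q: "Q \<longlonglongrightarrow> p" and G: "G \<longlonglongrightarrow> d"
    using q(1) g(1) by (simp_all add: Q_def[abs_def] G_def[abs_def] grows_def)
  obtain D where D: "\<And>n. \<bar>G n\<bar> \<le> D"
    using G by (metis Bseq_def convergentI convergent_imp_Bseq real_norm_def)
  have D0: "D \<ge> 0" using D[of 0] by linarith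
  define w where "w n j = real (Suc j) ^ k / real (Suc n) ^ Suc k" for n j
  have w0: "w n j \<ge> 0" for n j by (simp add: w_def)
  have w1: "w n j \<le> 1 / real (Suc n)" if "j < n" for n j
  proof -
    have "real (Suc j) ^ k \<le> real (Suc n) ^ k" using that by (intro power_mono) auto
    then show ?thesis by (simp add: w_def divide_simps mult_ac del: of_nat_Suc)
  qed
  \<comment> \<open>The error of replacing Q by its limit: as G is bounded and the weights are at
    most 1/(n+1), a Cesaro mean controls it. \<open>e2\<close> does the same for G.\<close>
  have e1: "(\<lambda>n. \<Sum>j<n. w n j * (G j * (Q (n - Suc j) - p))) \<longlonglongrightarrow> 0"
  proof (rule null_comparison)
    have "(\<lambda>n. Q n - p) \<longlonglongrightarrow> 0" using Q by (simp add: LIM_zero_iff)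
    from tendsto_mult_left[OF cesaro_null[OF this], of D]
    show "(\<lambda>n. D * ((\<Sum>i<n. \<bar>Q i - p\<bar>) / real (Suc n))) \<longlonglongrightarrow> 0" by simp
    show "\<forall>\<^sub>F n in sequentially. norm (\<Sum>j<n. w n j * (G j * (Q (n - Suc j) - p)))
       \<le> D * ((\<Sum>i<n. \<bar>Q i - p\<bar>) / real (Suc n))"
    proof (intro always_eventually allI)
      fix n
      have "norm (\<Sum>j<n. w n j * (G j * (Q (n - Suc j) - p)))
         \<le> (\<Sum>j<n. norm (w n j * (G j * (Q (n - Suc j) - p))))" by (rule norm_sum)
      also have "\<dots> \<le> (\<Sum>j<n. 1 / real (Suc n) * (D * \<bar>Q (n - Suc j) - p\<bar>))"
        using w0 w1 D D0 by (intro sum_mono) (auto simp: abs_mult simp del: of_nat_Suc times_divide_eq_left mult_1_left intro!: mult_mono)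
      also have "\<dots> = (\<Sum>j<n. 1 / real (Suc n) * (D * \<bar>Q j - p\<bar>))"
        by (rule sum.nat_diff_reindex[of "\<lambda>j. 1 / real (Suc n) * (D * \<bar>Q j - p\<bar>)"])
      also have "\<dots> = D * ((\<Sum>i<n. \<bar>Q i - p\<bar>) / real (Suc n))"
        by (simp add: sum_distrib_left sum_divide_distrib del: of_nat_Suc)
      finally show "norm (\<Sum>j<n. w n j * (G j * (Q (n - Suc j) - p)))
       \<le> D * ((\<Sum>i<n. \<bar>Q i - p\<bar>) / real (Suc n))" .
    qed
  qed
  have e2: "(\<lambda>n. \<Sum>j<n. w n j * (G j - d)) \<longlonglongrightarrow> 0"
  proof (rule null_comparison)
    have "(\<lambda>n. G n - d) \<longlonglongrightarrow> 0" using G by (simp add: LIM_zero_iff)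
    from cesaro_null[OF this]
    show "(\<lambda>n. (\<Sum>i<n. \<bar>G i - d\<bar>) / real (Suc n)) \<longlonglongrightarrow> 0" .
    show "\<forall>\<^sub>F n in sequentially. norm (\<Sum>j<n. w n j * (G j - d)) \<le> (\<Sum>i<n. \<bar>G i - d\<bar>) / real (Suc n)"
    proof (intro always_eventually allI)
      fix n
      have "norm (\<Sum>j<n. w n j * (G j - d)) \<le> (\<Sum>j<n. norm (w n j * (G j - d)))" by (rule norm_sum)
      also have "\<dots> \<le> (\<Sum>j<n. 1 / real (Suc n) * \<bar>G j - d\<bar>)"
        using w0 w1 by (intro sum_mono) (auto simp: abs_mult simp del: of_nat_Suc times_divide_eq_left mult_1_left intro!: mult_right_mono)
      finally show "norm (\<Sum>j<n. w n j * (G j - d)) \<le> (\<Sum>i<n. \<bar>G i - d\<bar>) / real (Suc n)"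
        by (simp add: sum_divide_distrib del: of_nat_Suc)
    qed
  qed
  have e3: "(\<lambda>n. \<Sum>j<n. w n j) \<longlonglongrightarrow> 1 / real (Suc k)"
    using sum_powers_tendsto[of k] by (simp add: w_def sum_divide_distrib del: power_Suc of_nat_Suc)
  \<comment> \<open>This is G Q = G (Q - p) + p (G - d) + p d. The division by r accounts for the
    step across, since the exponents of the two factors add up to n - 1.\<close>
  have "(\<lambda>n. ((\<Sum>j<n. w n j * (G j * (Q (n - Suc j) - p))) + p * (\<Sum>j<n. w n j * (G j - d)) + p * d * (\<Sum>j<n. w n j)) / r)
    \<longlonglongrightarrow> (0 + p * 0 + p * d * (1 / real (Suc k))) / r"
    using q(3) by (intro tendsto_intros e1 e2 e3) auto
  moreover have "((\<Sum>j<n. w n j * (G j * (Q (n - Suc j) - p))) + p * (\<Sum>j<n. w n j * (G j - d)) + p * d * (\<Sum>j<n. w n j)) / r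
     = conv q g n / (real (Suc n) ^ Suc k * r ^ n)" for n
  proof -
    have "w n j * (G j * (Q (n - Suc j) - p)) + p * (w n j * (G j - d)) + p * d * w n j
       = w n j * G j * Q (n - Suc j)" for j by (simp add: algebra_simps)
    then have "((\<Sum>j<n. w n j * (G j * (Q (n - Suc j) - p))) + p * (\<Sum>j<n. w n j * (G j - d)) + p * d * (\<Sum>j<n. w n j)) / r
      = (\<Sum>j<n. w n j * G j * Q (n - Suc j) / r)"
      unfolding sum_distrib_left sum.distrib[symmetric] sum_divide_distrib by (simp only:)
    also have "\<dots> = (\<Sum>j<n. q (n - Suc j) * g j / (real (Suc n) ^ Suc k * r ^ n))"
    proof (rule sum.cong[OF refl])
      fix j assume "j \<in> {..<n}"
      then have "r ^ n = r * r ^ j * r ^ (n - Suc j)" by (intro power_split) auto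
      then show "w n j * G j * Q (n - Suc j) / r = q (n - Suc j) * g j / (real (Suc n) ^ Suc k * r ^ n)"
        using q(3) by (simp add: w_def G_def Q_def mult_ac del: of_nat_Suc)
    qed
    finally show ?thesis by (simp only: conv_def sum_divide_distrib)
  qed
  ultimately have "grows (conv q g) (p * d * (1 / real (Suc k)) / r) (Suc k) r"
    by (simp add: grows_def)
  then show ?thesis using q g by (intro exI[of _ "p * d * (1 / real (Suc k)) / r"]) simp
qed

section \<open>Perron limits of primitive blocks\<close>

text \<open>These stand for the powers of a diagonal block, keeping the original indices instead of the
  reindexing by \<open>pick\<close>.\<close>

primrec restricted_power :: "nat set \<Rightarrow> (nat \<Rightarrow> nat \<Rightarrow> real) \<Rightarrow> nat \<Rightarrow> nat \<Rightarrow> nat \<Rightarrow> real" where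
  "restricted_power B A 0 a b = of_bool (a = b)"
| "restricted_power B A (Suc n) a b = (\<Sum>c\<in>B. A a c * restricted_power B A n c b)"

lemma restricted_power_add:
  assumes "finite B" "a \<in> B"
  shows "restricted_power B A (m + n) a b =
    (\<Sum>c\<in>B. restricted_power B A m a c * restricted_power B A n c b)"
  using assms(2)
proof (induction m arbitrary: a)
  case 0
  have "(\<Sum>c\<in>B. of_bool (a = c) * restricted_power B A n c b) =
      (\<Sum>c\<in>B. if c = a then restricted_power B A n c b else 0)"
    by (intro sum.cong) auto
  then show ?case using assms(1) 0 by (simp only: restricted_power.simps) simp
next
  case (Suc m)
  have "restricted_power B A (Suc m + n) a b =
      (\<Sum>d\<in>B. A a d * (\<Sum>c\<in>B. restricted_power B A m d c * restricted_power B A n c b))"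
    using Suc.IH by (auto intro!: sum.cong)
  also have "\<dots> = (\<Sum>c\<in>B. (\<Sum>d\<in>B. A a d * restricted_power B A m d c) * restricted_power B A n c b)"
    unfolding sum_distrib_left sum_distrib_right by (subst sum.swap) (simp add: mult.assoc)
  finally show ?case by simp
qed

lemma restricted_power_Suc_right:
  assumes "finite B" "a \<in> B" "b \<in> B"
  shows "restricted_power B A (Suc n) a b = (\<Sum>c\<in>B. restricted_power B A n a c * A c b)"
proof -
  have "restricted_power B A 1 c b = A c b" for c
  proof -
    have "(\<Sum>d\<in>B. A c d * of_bool (d = b)) = (\<Sum>d\<in>B. if d = b then A c d else 0)"
      by (intro sum.cong) auto
    then show ?thesis using assms by (simp only: restricted_power.simps One_nat_def) simp
  qed
  then show ?thesis using restricted_power_add[OF assms(1,2), of A n 1 b] by simp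
qed

lemma restricted_power_nonneg:
  assumes "\<And>a b. a \<in> B \<Longrightarrow> b \<in> B \<Longrightarrow> A a b \<ge> 0" "a \<in> B" "b \<in> B"
  shows "restricted_power B A n a b \<ge> 0"
  using assms(2) by (induction n arbitrary: a) (auto intro!: sum_nonneg mult_nonneg_nonneg assms)

lemma restricted_power_scale:
  "restricted_power B (\<lambda>a b. s * A a b) n a b = s ^ n * restricted_power B A n a b"
  by (induction n arbitrary: a) (auto simp: sum_distrib_left mult_ac intro!: sum.cong)

text \<open>\<open>f\<close> is \<open>pick B\<close> for a diagonal block and the identity for a
  whole matrix. Matrix powers are built up on the right and \<open>restricted_power\<close> on the
  left, hence the appeal to \<open>restricted_power_Suc_right\<close>.\<close>

lemma pow_mat_restricted_power:
  assumes A: "A \<in> carrier_mat k k" and f: "bij_betw f {..<k} B"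
    and e: "\<And>i j. i < k \<Longrightarrow> j < k \<Longrightarrow> A $$ (i, j) = a (f i) (f j)"
    and "i < k" "j < k"
  shows "(A ^\<^sub>m n) $$ (i, j) = restricted_power B a n (f i) (f j)"
  using assms(4,5)
proof (induction n arbitrary: i j)
  case 0
  then show ?case using A f by (auto simp: bij_betw_def inj_on_def)
next
  case (Suc n)
  have fin: "finite B" and m: "\<And>i. i < k \<Longrightarrow> f i \<in> B"
    using f by (auto simp: bij_betw_finite bij_betw_def)
  have "(A ^\<^sub>m Suc n) $$ (i, j) = (\<Sum>l<k. (A ^\<^sub>m n) $$ (i, l) * A $$ (l, j))"
    using A Suc.prems by (simp add: scalar_prod_def lessThan_atLeast0 pow_mat_dim_square[OF A])
  also have "\<dots> = (\<Sum>l<k. restricted_power B a n (f i) (f l) * a (f l) (f j))"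
    using Suc e by (intro sum.cong) auto
  also have "\<dots> = (\<Sum>c\<in>B. restricted_power B a n (f i) c * a c (f j))"
    using sum.reindex_bij_betw[OF f, of "\<lambda>c. restricted_power B a n (f i) c * a c (f j)"] by simp
  also have "\<dots> = restricted_power B a (Suc n) (f i) (f j)"
    using restricted_power_Suc_right[OF fin] m Suc.prems by simp
  finally show ?case .
qed

section \<open>Spectral radius of a diagonal block\<close>

lemma bij_betw_pick:
  assumes "finite B"
  shows "bij_betw (pick B) {..<card B} B"
proof -
  \<comment> \<open>The position i is recovered from \<open>pick B i\<close> by counting the smaller
    elements of B.\<close>
  have "card {a \<in> B. a < pick B i} = i" if "i < card B" for i
    using that by (intro card_pick) auto
  then have inj: "inj_on (pick B) {..<card B}"
    unfolding inj_on_def by (metis lessThan_iff)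
  have "pick B ` {..<card B} = B"
    using assms pick_in_set card_image[OF inj]
    by (intro card_subset_eq) auto
  with inj show ?thesis by (simp add: bij_betw_def)
qed

text \<open>Everything that is taken from complex spectral theory. \<open>w\<close> consists of the
  moduli of an eigenvector for an eigenvalue of largest modulus, and the triangle inequality turns
  the eigenvalue equation into an inequality. The growth bound holds because the block divided by q
  has spectral radius below 1, so its powers stay bounded.\<close>

lemma block_radius_super_eigenvector:
  assumes X: "X \<in> carrier_mat d d" and B: "B \<subseteq> {..<d}" "B \<noteq> {}"
    and nonneg: "\<And>a b. a \<in> B \<Longrightarrow> b \<in> B \<Longrightarrow> X $$ (a, b) \<ge> 0"
  obtains w where "\<And>a. w a \<ge> 0" "\<exists>a\<in>B. w a > 0"
    "\<And>a. a \<in> B \<Longrightarrow> block_radius X B * w a \<le> (\<Sum>b\<in>B. X $$ (a, b) * w b)"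
    "block_radius X B \<ge> 0"
    "\<And>q. q > block_radius X B \<Longrightarrow> q > 0 \<Longrightarrow>
      \<exists>c. \<forall>n. \<forall>a\<in>B. \<forall>b\<in>B. restricted_power B (\<lambda>a b. X $$ (a, b)) n a b \<le> c * q ^ n"
proof -
  define k where "k = card B"
  define P where "P = diagonal_block X B"
  define PC where "PC = map_mat complex_of_real P"
  define \<rho> where "\<rho> = block_radius X B"
  have fin: "finite B" using B finite_subset by blast
  have k: "k > 0" using fin B by (auto simp: k_def card_gt_0_iff)
  have f: "bij_betw (pick B) {..<k} B" unfolding k_def by (rule bij_betw_pick[OF fin])
  then have fB: "\<And>i. i < k \<Longrightarrow> pick B i \<in> B" by (auto simp: bij_betw_def)
  have card: "card {i. i < d \<and> i \<in> B} = k"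
    unfolding k_def using B by (intro arg_cong[of _ _ card]) auto
  have P: "P \<in> carrier_mat k k"
    using X card unfolding P_def diagonal_block_def by (intro carrier_matI) (auto simp: dim_submatrix)
  have Pe: "P $$ (i, j) = X $$ (pick B i, pick B j)" if "i < k" "j < k" for i j
    using X card that unfolding P_def diagonal_block_def by (intro submatrix_index) auto
  have PC: "PC \<in> carrier_mat k k" using P by (simp add: PC_def)
  have \<rho>: "\<rho> = spectral_radius PC" by (simp add: \<rho>_def block_radius_def PC_def P_def)
  have sum_pick: "(\<Sum>j<k. g (pick B j)) = (\<Sum>b\<in>B. g b)" for g :: "nat \<Rightarrow> real"
    by (rule sum.reindex_bij_betw[OF f])
  from spectral_radius_mem_max(1)[OF PC k] obtain z v
    where z: "\<rho> = norm z" and v: "eigenvector PC v z"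
    unfolding \<rho> spectrum_def eigenvalue_def by auto
  have vc: "v \<in> carrier_vec k" "v \<noteq> 0\<^sub>v k" "PC *\<^sub>v v = z \<cdot>\<^sub>v v"
    using v PC by (auto simp: eigenvector_def)
  define w where "w a = norm (v $ (the_inv_into {..<k} (pick B) a))" for a
  have wp: "w (pick B i) = norm (v $ i)" if "i < k" for i
    using f that by (simp add: w_def bij_betw_def the_inv_into_f_f)
  have ex: "\<exists>a\<in>B. w a > 0"
  proof -
    have "\<exists>i<k. v $ i \<noteq> 0" using vc by (metis carrier_vecD eq_vecI index_zero_vec)
    then show ?thesis using wp fB by (metis zero_less_norm_iff)
  qed
  have sup: "\<rho> * w a \<le> (\<Sum>b\<in>B. X $$ (a, b) * w b)" if a: "a \<in> B" for a
  proof -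
    obtain i where i: "i < k" "a = pick B i" using f a by (auto simp: bij_betw_def)
    have "z * v $ i = (PC *\<^sub>v v) $ i" using vc i by simp
    also have "\<dots> = (\<Sum>j<k. complex_of_real (P $$ (i, j)) * v $ j)"
      using P vc(1) i unfolding PC_def by (simp add: scalar_prod_def lessThan_atLeast0)
    finally have "norm (z * v $ i) \<le> (\<Sum>j<k. norm (complex_of_real (P $$ (i, j)) * v $ j))"
      by (simp add: norm_sum)
    also have "\<dots> = (\<Sum>j<k. X $$ (a, pick B j) * w (pick B j))"
      using i Pe nonneg fB by (intro sum.cong) (auto simp: norm_mult wp)
    also have "\<dots> = (\<Sum>b\<in>B. X $$ (a, b) * w b)" by (rule sum_pick)
    finally show ?thesis using i wp by (simp add: norm_mult z)
  qed
  have bd: "\<exists>c. \<forall>n. \<forall>a\<in>B. \<forall>b\<in>B. restricted_power B (\<lambda>a b. X $$ (a, b)) n a b \<le> c * q ^ n"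
    if q: "q > \<rho>" "q > 0" for q
  proof -
    define Q where "Q = mat k k (\<lambda>(i, j). P $$ (i, j) / q)"
    define QC where "QC = map_mat complex_of_real Q"
    have Q: "Q \<in> carrier_mat k k" by (simp add: Q_def)
    then have QC: "QC \<in> carrier_mat k k" by (simp add: QC_def)
    from spectral_radius_mem_max(1)[OF QC k] obtain y u
      where y: "spectral_radius QC = norm y" and u: "eigenvector QC u y"
      unfolding spectrum_def eigenvalue_def by auto
    \<comment> \<open>Undoes the scaling: an eigenvalue y of the block over q gives the eigenvalue q
      y of the block, so q |y| \<le> \<rho> < q.\<close>
    have "eigenvector PC u (of_real q * y)"
    proof -
      have uc: "u \<in> carrier_vec k" "u \<noteq> 0\<^sub>v k" "QC *\<^sub>v u = y \<cdot>\<^sub>v u"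
        using u QC by (auto simp: eigenvector_def)
      have "PC *\<^sub>v u = (of_real q * y) \<cdot>\<^sub>v u"
      proof (rule eq_vecI)
        fix i assume "i < dim_vec ((of_real q * y) \<cdot>\<^sub>v u)"
        then have i: "i < k" using uc by simp
        have "y * u $ i = (QC *\<^sub>v u) $ i" using uc i by simp
        also have "\<dots> = (\<Sum>j<k. complex_of_real (P $$ (i, j) / q) * u $ j)"
          using uc(1) i unfolding QC_def Q_def by (simp add: scalar_prod_def lessThan_atLeast0)
        finally have "of_real q * y * u $ i = (\<Sum>j<k. complex_of_real (P $$ (i, j)) * u $ j)"
          using q by (simp add: sum_distrib_left mult.assoc)
        also have "\<dots> = (PC *\<^sub>v u) $ i"
          using P uc(1) i unfolding PC_def by (simp add: scalar_prod_def lessThan_atLeast0)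
        finally show "(PC *\<^sub>v u) $ i = ((of_real q * y) \<cdot>\<^sub>v u) $ i" using uc i by simp
      qed (use uc PC in auto)
      then show ?thesis using uc PC by (auto simp: eigenvector_def)
    qed
    then have "of_real q * y \<in> spectrum PC" by (auto simp: spectrum_def eigenvalue_def)
    then have "norm (of_real q * y) \<le> \<rho>"
      unfolding \<rho> by (intro spectral_radius_mem_max(2)[OF PC k] imageI)
    then have "q * norm y \<le> \<rho>" using q by (simp add: norm_mult)
    then have "q * norm y < q * 1" using q by linarith
    then have "spectral_radius QC < 1" using q y by simp
    from spectral_radius_jnf_norm_bound_less_1_upper_triangular[OF QC this]
    obtain c where c: "\<And>n. norm_bound (QC ^\<^sub>m n) c" by blast
    have "restricted_power B (\<lambda>a b. X $$ (a, b)) n a b \<le> c * q ^ n" if ab: "a \<in> B" "b \<in> B" for n a b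
    proof -
      obtain i j where ij: "i < k" "a = pick B i" "j < k" "b = pick B j"
        using f ab unfolding bij_betw_def by blast
      have "restricted_power B (\<lambda>a b. (1 / q) * X $$ (a, b)) n a b = (Q ^\<^sub>m n) $$ (i, j)"
        unfolding ij(2,4)
        by (rule pow_mat_restricted_power[OF Q f, symmetric]) (auto simp: Q_def Pe ij)
      moreover have "norm ((QC ^\<^sub>m n) $$ (i, j)) \<le> c"
        using c[of n] ij QC unfolding norm_bound_def by (auto split: if_splits)
      then have "\<bar>(Q ^\<^sub>m n) $$ (i, j)\<bar> \<le> c"
        using ij Q unfolding QC_def of_real_hom.mat_hom_pow[OF Q, symmetric]
        by (simp add: pow_mat_dim_square[OF Q])
      ultimately have "(1 / q) ^ n * restricted_power B (\<lambda>a b. X $$ (a, b)) n a b \<le> c"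
        by (simp only: restricted_power_scale)
      then show ?thesis using q by (simp add: power_divide divide_simps)
    qed
    then show ?thesis by blast
  qed
  show ?thesis
    by (rule that[of w]) (use sup bd ex in \<open>auto simp: w_def z simp flip: \<rho>_def\<close>)
qed

text \<open>Suppose h = A w - \<rho> w is not 0. The positive power A^m makes it strictly positive,
  so y = A^m w satisfies A y \<ge> (\<rho> + \<epsilon>) y for some \<epsilon> > 0, and iterating
  makes A^n y outgrow the bound \<open>bd\<close>. Hence the inequality for \<open>w\<close> is an
  equation.\<close>

lemma perron_eigenvector:
  fixes A :: "nat \<Rightarrow> nat \<Rightarrow> real" and B :: "nat set"
  defines "R \<equiv> restricted_power B A"
  assumes B: "finite B"
    and nonneg: "\<And>a b. a \<in> B \<Longrightarrow> b \<in> B \<Longrightarrow> A a b \<ge> 0"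
    and m: "m > 0" "\<And>a b. a \<in> B \<Longrightarrow> b \<in> B \<Longrightarrow> R m a b > 0"
    and w: "\<And>a. w a \<ge> 0" "\<exists>a\<in>B. w a > 0"
      "\<And>a. a \<in> B \<Longrightarrow> \<rho> * w a \<le> (\<Sum>b\<in>B. A a b * w b)"
    and \<rho>: "\<rho> \<ge> 0"
    and bd: "\<And>q. q > \<rho> \<Longrightarrow> q > 0 \<Longrightarrow> \<exists>c. \<forall>n. \<forall>a\<in>B. \<forall>b\<in>B. R n a b \<le> c * q ^ n"
  shows "\<rho> > 0" "\<And>a. a \<in> B \<Longrightarrow> w a > 0"
    "\<And>n a. a \<in> B \<Longrightarrow> (\<Sum>b\<in>B. R n a b * w b) = \<rho> ^ n * w a"
proof -
  have R0: "R n a b \<ge> 0" if "a \<in> B" "b \<in> B" for n a b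
    unfolding R_def using nonneg that by (rule restricted_power_nonneg)
  have pos: "(\<Sum>b\<in>B. R m a b * h b) > 0"
    if "a \<in> B" "\<And>b. b \<in> B \<Longrightarrow> h b \<ge> 0" "\<exists>b\<in>B. h b > 0" for a and h :: "nat \<Rightarrow> real"
  proof -
    from that(3) obtain b where b: "b \<in> B" "h b > 0" by blast
    have "0 < R m a b * h b" using m that(1) b by simp
    also have "\<dots> \<le> (\<Sum>b\<in>B. R m a b * h b)"
      using B b that R0 by (intro member_le_sum) auto
    finally show ?thesis .
  qed
  define y where "y a = (\<Sum>b\<in>B. R m a b * w b)" for a
  have y: "y a > 0" if "a \<in> B" for a unfolding y_def using pos that w by auto
  define h where "h a = (\<Sum>b\<in>B. A a b * w b) - \<rho> * w a" for a
  have h0: "h a \<ge> 0" if "a \<in> B" for a using w(3) that by (simp add: h_def)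
  have Ay: "(\<Sum>b\<in>B. A a b * y b) = \<rho> * y a + (\<Sum>b\<in>B. R m a b * h b)" if a: "a \<in> B" for a
  proof -
    have "(\<Sum>b\<in>B. A a b * y b) = (\<Sum>c\<in>B. R (Suc m) a c * w c)"
      unfolding y_def R_def restricted_power.simps sum_distrib_left sum_distrib_right
      by (subst sum.swap) (simp add: mult.assoc)
    also have "\<dots> = (\<Sum>c\<in>B. (\<Sum>b\<in>B. R m a b * A b c) * w c)"
      using restricted_power_Suc_right[OF B a] by (simp add: R_def)
    also have "\<dots> = (\<Sum>b\<in>B. R m a b * (\<Sum>c\<in>B. A b c * w c))"
      unfolding sum_distrib_left sum_distrib_right by (subst sum.swap) (simp add: mult.assoc)
    also have "\<dots> = (\<Sum>b\<in>B. \<rho> * (R m a b * w b) + R m a b * h b)"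
      by (intro sum.cong) (auto simp: h_def algebra_simps)
    finally show ?thesis by (simp add: sum.distrib sum_distrib_left y_def)
  qed
  have eq: "h a = 0" if a: "a \<in> B" for a
  proof (rule ccontr)
    assume "h a \<noteq> 0"
    then have "\<exists>a\<in>B. h a > 0" using h0 a by force
    then have hp: "(\<Sum>b\<in>B. R m a b * h b) > 0" if "a \<in> B" for a using pos h0 that by auto
    \<comment> \<open>The largest \<epsilon> for which \<epsilon> y stays below A^m h in every
      coordinate.\<close>
    define \<epsilon> where "\<epsilon> = Min ((\<lambda>a. (\<Sum>b\<in>B. R m a b * h b) / y a) ` B)"
    have \<epsilon>: "\<epsilon> > 0" unfolding \<epsilon>_def using B a hp y by (subst Min_gr_iff) auto
    have \<epsilon>y: "\<epsilon> * y a \<le> (\<Sum>b\<in>B. R m a b * h b)" if "a \<in> B" for a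
    proof -
      have "\<epsilon> \<le> (\<Sum>b\<in>B. R m a b * h b) / y a" unfolding \<epsilon>_def using B that by (intro Min_le) auto
      then show ?thesis using y[OF that] by (simp add: field_simps)
    qed
    have grow: "(\<rho> + \<epsilon>) ^ n * y a \<le> (\<Sum>b\<in>B. R n a b * y b)" if "a \<in> B" for n a
      using that
    proof (induction n arbitrary: a)
      case 0
      have "(\<Sum>b\<in>B. R 0 a b * y b) = (\<Sum>b\<in>B. if b = a then y b else 0)"
        by (intro sum.cong) (auto simp: R_def)
      then show ?case using B 0 by simp
    next
      case (Suc n)
      have "(\<rho> + \<epsilon>) ^ Suc n * y a \<le> (\<rho> + \<epsilon>) ^ n * (\<Sum>b\<in>B. A a b * y b)"
        using Ay[OF Suc.prems] \<epsilon>y[OF Suc.prems] \<epsilon> \<rho>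
        unfolding power_Suc2 mult.assoc by (intro mult_left_mono) (auto simp: distrib_right)
      also have "\<dots> \<le> (\<Sum>b\<in>B. A a b * (\<Sum>c\<in>B. R n b c * y c))"
        unfolding sum_distrib_left[of "(\<rho> + \<epsilon>) ^ n"] mult.left_commute[of "(\<rho> + \<epsilon>) ^ n"]
        using nonneg Suc by (intro sum_mono mult_left_mono) auto
      also have "\<dots> = (\<Sum>c\<in>B. R (Suc n) a c * y c)"
        unfolding R_def restricted_power.simps sum_distrib_left sum_distrib_right
        by (subst sum.swap) (simp add: mult.assoc)
      finally show ?case .
    qed
    \<comment> \<open>Halfway: \<open>bd\<close> applies to q, and yet (\<rho> + \<epsilon>) / q
      exceeds 1.\<close>
    define q where "q = \<rho> + \<epsilon> / 2"
    have q: "q > \<rho>" "q > 0" using \<epsilon> \<rho> by (auto simp: q_def)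
    obtain c where c: "\<And>n a b. a \<in> B \<Longrightarrow> b \<in> B \<Longrightarrow> R n a b \<le> c * q ^ n" using bd[OF q] by blast
    obtain n where n: "c * (\<Sum>b\<in>B. y b) / y a < ((\<rho> + \<epsilon>) / q) ^ n"
      using real_arch_pow[of "(\<rho> + \<epsilon>) / q"] q \<epsilon> by (auto simp: q_def)
    have "(\<rho> + \<epsilon>) ^ n * y a \<le> (\<Sum>b\<in>B. R n a b * y b)" by (rule grow[OF a])
    also have "\<dots> \<le> (\<Sum>b\<in>B. c * q ^ n * y b)"
      using c a y by (intro sum_mono mult_right_mono) (auto intro: less_imp_le)
    also have "\<dots> = (c * (\<Sum>b\<in>B. y b)) * q ^ n" by (simp add: sum_distrib_left mult_ac)
    finally have "((\<rho> + \<epsilon>) / q) ^ n \<le> c * (\<Sum>b\<in>B. y b) / y a"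
      using q y[OF a] by (simp add: power_divide divide_simps)
    with n show False by simp
  qed
  show ev: "(\<Sum>b\<in>B. R n a b * w b) = \<rho> ^ n * w a" if "a \<in> B" for n a
    using that
  proof (induction n arbitrary: a)
    case 0
    have "(\<Sum>b\<in>B. R 0 a b * w b) = (\<Sum>b\<in>B. if b = a then w b else 0)"
      by (intro sum.cong) (auto simp: R_def)
    then show ?case using B 0 by simp
  next
    case (Suc n)
    have "(\<Sum>c\<in>B. R (Suc n) a c * w c) = (\<Sum>b\<in>B. A a b * (\<Sum>c\<in>B. R n b c * w c))"
      unfolding R_def restricted_power.simps sum_distrib_left sum_distrib_right
      by (subst sum.swap) (simp add: mult.assoc)
    also have "\<dots> = \<rho> ^ n * (\<Sum>b\<in>B. A a b * w b)"
      using Suc.IH by (simp add: sum_distrib_left mult.left_commute)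
    also have "(\<Sum>b\<in>B. A a b * w b) = \<rho> * w a"
      using eq[OF Suc.prems] by (simp add: h_def)
    finally show ?case by simp
  qed
  \<comment> \<open>The eigenvector equation at n = m identifies \<rho>^m w with the positive vector
    y. This excludes zeros of \<open>w\<close> and, as m > 0, also \<rho> = 0.\<close>
  have *: "\<rho> ^ m * w a > 0" if "a \<in> B" for a using ev[OF that, of m] y[OF that] by (simp add: y_def)
  show "w a > 0" if "a \<in> B" for a
    using *[OF that] w(1)[of a] by (cases "w a = 0") auto
  obtain a where "a \<in> B" using w(2) by blast
  from *[OF this] show "\<rho> > 0"
    using \<rho> m(1) by (cases "\<rho> = 0") (auto simp: power_0_left)
qed

text \<open>Conjugating A / \<rho> by the diagonal matrix of \<open>w\<close> gives a stochastic
  matrix with powers \<open>K n\<close>, and \<open>f n\<close> is column b of \<open>K n\<close>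
  divided by \<open>w b\<close>. Averaging can only shrink the range from \<open>lo\<close> to
  \<open>hi\<close>; since the entries of \<open>K m\<close> are bounded below by \<delta> > 0, the
  range collapses to a point.\<close>

lemma perron_limit:
  fixes A :: "nat \<Rightarrow> nat \<Rightarrow> real" and B :: "nat set"
  defines "R \<equiv> restricted_power B A"
  assumes B: "finite B"
    and nonneg: "\<And>a b. a \<in> B \<Longrightarrow> b \<in> B \<Longrightarrow> A a b \<ge> 0"
    and m: "\<And>a b. a \<in> B \<Longrightarrow> b \<in> B \<Longrightarrow> R m a b > 0"
    and w: "\<And>a. a \<in> B \<Longrightarrow> w a > 0"
    and \<rho>: "\<rho> > 0"
    and ev: "\<And>n a. a \<in> B \<Longrightarrow> (\<Sum>b\<in>B. R n a b * w b) = \<rho> ^ n * w a"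
    and ab: "a \<in> B" "b \<in> B"
  shows "\<exists>p>0. grows (\<lambda>n. R n a b) p 0 \<rho>"
proof -
  have R0: "R n a b \<ge> 0" if "a \<in> B" "b \<in> B" for n a b
    unfolding R_def using nonneg that by (rule restricted_power_nonneg)
  define K where "K n a c = R n a c * w c / (\<rho> ^ n * w a)" for n a c
  define f where "f n a = R n a b / (\<rho> ^ n * w a)" for n a
  have K0: "K n a c \<ge> 0" if "a \<in> B" "c \<in> B" for n a c
    using R0[OF that] w[OF that(1)] w[OF that(2)] \<rho> by (simp add: K_def)
  have K1: "(\<Sum>c\<in>B. K n a c) = 1" if "a \<in> B" for n a
    unfolding K_def sum_divide_distrib[symmetric] using ev[OF that] w[OF that] \<rho> by simp
  have fK: "f (k + n) a = (\<Sum>c\<in>B. K k a c * f n c)" if "a \<in> B" for k n a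
  proof -
    have "f (k + n) a = (\<Sum>c\<in>B. R k a c * R n c b / (\<rho> ^ (k + n) * w a))"
      unfolding f_def R_def restricted_power_add[OF B that] sum_divide_distrib ..
    also have "\<dots> = (\<Sum>c\<in>B. K k a c * f n c)"
    proof (intro sum.cong refl)
      fix c assume "c \<in> B"
      with w[of c] show "R k a c * R n c b / (\<rho> ^ (k + n) * w a) = K k a c * f n c"
        using \<rho> by (simp add: K_def f_def power_add)
    qed
    finally show ?thesis .
  qed
  define hi where "hi n = Max (f n ` B)" for n
  define lo where "lo n = Min (f n ` B)" for n
  have Bne: "B \<noteq> {}" using ab by auto
  have hi: "f n a \<le> hi n" and lo: "lo n \<le> f n a" if "a \<in> B" for n a
    using B that by (auto simp: hi_def lo_def)
  have lohi: "lo n \<le> hi n" for n using hi[OF ab(1)] lo[OF ab(1)] order_trans by blast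
  have hi_le: "hi n \<le> x" if "\<And>a. a \<in> B \<Longrightarrow> f n a \<le> x" for n x
    using B Bne that by (auto simp: hi_def)
  have lo_ge: "lo n \<ge> x" if "\<And>a. a \<in> B \<Longrightarrow> f n a \<ge> x" for n x
    using B Bne that by (auto simp: lo_def)
  have dec: "hi (k + n) \<le> hi n" for k n
  proof (rule hi_le)
    fix a assume a: "a \<in> B"
    have "f (k + n) a \<le> (\<Sum>c\<in>B. K k a c * hi n)"
      unfolding fK[OF a] using K0 a hi by (intro sum_mono mult_left_mono) auto
    then show "f (k + n) a \<le> hi n" using K1[OF a] by (simp flip: sum_distrib_right)
  qed
  have inc: "lo (k + n) \<ge> lo n" for k n
  proof (rule lo_ge)
    fix a assume a: "a \<in> B"
    have "f (k + n) a \<ge> (\<Sum>c\<in>B. K k a c * lo n)"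
      unfolding fK[OF a] using K0 a lo by (intro sum_mono mult_left_mono) auto
    then show "lo n \<le> f (k + n) a" using K1[OF a] by (simp flip: sum_distrib_right)
  qed
  define \<delta> where "\<delta> = Min ((\<lambda>(a, c). K m a c) ` (B \<times> B))"
  have \<delta>: "\<delta> > 0" unfolding \<delta>_def using B Bne m w \<rho> by (subst Min_gr_iff) (auto simp: K_def)
  have \<delta>K: "\<delta> \<le> K m a c" if "a \<in> B" "c \<in> B" for a c
    unfolding \<delta>_def using B that by (intro Min_le) auto
  \<comment> \<open>Each row of \<open>K m\<close> gives weight at least \<delta> to an index where
    \<open>f n\<close> is minimal, which pulls the average below \<open>hi n\<close> by \<delta>
    times the range.\<close>
  have contract: "hi (m + n) \<le> hi n - \<delta> * (hi n - lo n)" for n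
  proof (rule hi_le)
    fix a assume a: "a \<in> B"
    have "lo n \<in> f n ` B" unfolding lo_def using B Bne by (intro Min_in) auto
    then obtain c where c: "c \<in> B" "f n c = lo n" by auto
    have "\<delta> * (hi n - lo n) \<le> K m a c * (hi n - f n c)"
      using \<delta>K[OF a c(1)] c lohi[of n] by (auto intro: mult_right_mono)
    also have "\<dots> \<le> (\<Sum>c\<in>B. K m a c * (hi n - f n c))"
      using B c K0 a hi by (intro member_le_sum) auto
    also have "\<dots> = hi n - f (m + n) a"
      unfolding fK[OF a] right_diff_distrib sum_subtractf sum_distrib_right[symmetric] K1[OF a] by simp
    finally show "f (m + n) a \<le> hi n - \<delta> * (hi n - lo n)" by simp
  qed
  have "decseq hi" unfolding decseq_def using dec by (metis le_add_diff_inverse2)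
  moreover have "lo 0 \<le> hi n" for n using inc[of 0 n] lohi[of n] by simp
  ultimately obtain H where H: "hi \<longlonglongrightarrow> H" using decseq_convergent by blast
  have "incseq lo" unfolding incseq_def using inc by (metis le_add_diff_inverse2)
  moreover have "lo n \<le> hi 0" for n using dec[of n 0] lohi[of n] by simp
  ultimately obtain L where L: "lo \<longlonglongrightarrow> L" "\<And>n. lo n \<le> L" using incseq_convergent by blast
  have "(\<lambda>n. hi (m + n)) \<longlonglongrightarrow> H" using LIMSEQ_ignore_initial_segment[OF H, of m] by (simp add: add.commute)
  moreover have "(\<lambda>n. hi n - \<delta> * (hi n - lo n)) \<longlonglongrightarrow> H - \<delta> * (H - L)"
    by (intro tendsto_intros H L)
  ultimately have "H \<le> H - \<delta> * (H - L)" using contract by (intro LIMSEQ_le) auto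
  then have "H \<le> L" using \<delta> by (simp add: mult_le_0_iff)
  moreover have "L \<le> H" using lohi by (intro LIMSEQ_le[OF L(1) H]) auto
  ultimately have "hi \<longlonglongrightarrow> L" using H by (simp add: order_antisym)
  have fl: "(\<lambda>n. f n a) \<longlonglongrightarrow> L"
    by (rule tendsto_sandwich[OF _ _ L(1) \<open>hi \<longlonglongrightarrow> L\<close>])
      (simp_all add: hi[OF ab(1)] lo[OF ab(1)])
  \<comment> \<open>As \<open>lo\<close> never decreases, one positive value keeps the limit away
    from 0; at time m all entries are positive.\<close>
  have "lo m > 0" unfolding lo_def using B Bne m w \<rho> ab by (subst Min_gr_iff) (auto simp: f_def)
  then have "L > 0" using L(2)[of m] by simp
  from tendsto_mult_left[OF fl, of "w a"] have "(\<lambda>n. w a * f n a) \<longlonglongrightarrow> w a * L" .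
  then have "grows (\<lambda>n. R n a b) (w a * L) 0 \<rho>"
    using w[OF ab(1)] by (simp add: grows_def f_def)
  with \<open>L > 0\<close> w[OF ab(1)] show ?thesis by (intro exI[of _ "w a * L"]) simp
qed

lemma primitive_block_growth:
  assumes X: "X \<in> carrier_mat d d" and B: "B \<subseteq> {..<d}" "B \<noteq> {}"
    and prim: "primitive_mat (diagonal_block X B)"
  shows "block_radius X B > 0"
    and "\<And>a b. a \<in> B \<Longrightarrow> b \<in> B \<Longrightarrow>
      \<exists>p>0. grows (\<lambda>n. restricted_power B (\<lambda>a b. X $$ (a, b)) n a b) p 0 (block_radius X B)"
proof -
  define k where "k = card B"
  define P where "P = diagonal_block X B"
  have fin: "finite B" using B finite_subset by blast
  have f: "bij_betw (pick B) {..<k} B" unfolding k_def by (rule bij_betw_pick[OF fin])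
  have card: "card {i. i < d \<and> i \<in> B} = k"
    unfolding k_def using B by (intro arg_cong[of _ _ card]) auto
  have P: "P \<in> carrier_mat k k"
    using X card unfolding P_def diagonal_block_def by (intro carrier_matI) (auto simp: dim_submatrix)
  have Pe: "P $$ (i, j) = X $$ (pick B i, pick B j)" if "i < k" "j < k" for i j
    using X card that unfolding P_def diagonal_block_def by (intro submatrix_index) auto
  have ex: "\<exists>i<k. \<exists>j<k. a = pick B i \<and> b = pick B j" if "a \<in> B" "b \<in> B" for a b
    using f that unfolding bij_betw_def by blast
  have nonneg: "X $$ (a, b) \<ge> 0" if "a \<in> B" "b \<in> B" for a b
    using ex[OF that] prim P Pe by (auto simp: primitive_mat_def simp flip: P_def)
  obtain m where m: "m > 0" "\<And>i j. i < k \<Longrightarrow> j < k \<Longrightarrow> (P ^\<^sub>m m) $$ (i, j) > 0"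
    using prim P by (auto simp: primitive_mat_def simp flip: P_def)
  have m': "restricted_power B (\<lambda>a b. X $$ (a, b)) m a b > 0" if ab: "a \<in> B" "b \<in> B" for a b
  proof -
    obtain i j where ij: "i < k" "j < k" "a = pick B i" "b = pick B j" using ex[OF ab] by blast
    have "(P ^\<^sub>m m) $$ (i, j) = restricted_power B (\<lambda>a b. X $$ (a, b)) m a b"
      unfolding ij(3,4) by (rule pow_mat_restricted_power[OF P f]) (auto simp: Pe ij)
    then show ?thesis using m ij by metis
  qed
  obtain w where w: "\<And>a. w a \<ge> 0" "\<exists>a\<in>B. w a > 0"
    "\<And>a. a \<in> B \<Longrightarrow> block_radius X B * w a \<le> (\<Sum>b\<in>B. X $$ (a, b) * w b)"
    "block_radius X B \<ge> 0"
    "\<And>q. q > block_radius X B \<Longrightarrow> q > 0 \<Longrightarrow>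
      \<exists>c. \<forall>n. \<forall>a\<in>B. \<forall>b\<in>B. restricted_power B (\<lambda>a b. X $$ (a, b)) n a b \<le> c * q ^ n"
    by (rule block_radius_super_eigenvector[OF X B nonneg]) (assumption | rule that, assumption+)+
  note pe = perron_eigenvector[of B "\<lambda>a b. X $$ (a, b)", OF fin nonneg m(1) m' w]
  show "block_radius X B > 0" by (rule pe(1))
  show "\<exists>p>0. grows (\<lambda>n. restricted_power B (\<lambda>a b. X $$ (a, b)) n a b) p 0 (block_radius X B)"
    if "a \<in> B" "b \<in> B" for a b
    by (rule perron_limit[OF fin nonneg m' pe(2) pe(1) pe(3) that])
qed

section \<open>Row sums of powers of a block triangular matrix\<close>

lemma sum_pos_imp_term_pos:
  fixes f :: "'a \<Rightarrow> real"
  assumes "sum f A > 0"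
  obtains x where "x \<in> A" "f x > 0"
  using assms sum_nonpos[of A f] by (meson not_le)

locale primitive_blocks =
  fixes X :: "real mat" and d :: nat
  assumes X: "X \<in> carrier_mat d d"
    and nonneg: "\<And>a b. a < d \<Longrightarrow> b < d \<Longrightarrow> X $$ (a, b) \<ge> 0"
    and prim: "primitive_frobenius X"
begin

section \<open>Reachability and blocks\<close>

abbreviation entry :: "nat \<Rightarrow> nat \<Rightarrow> real" where
  "entry a b \<equiv> X $$ (a, b)"

lemma dim_row_X [simp]: "dim_row X = d"
  using X by auto

lemma pow_entry:
  assumes "a < d" "b < d"
  shows "(X ^\<^sub>m n) $$ (a, b) = restricted_power {..<d} entry n a b"
  using pow_mat_restricted_power[OF X, of id "{..<d}" entry a b n] assms by simp

lemma reaches_iff: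
  "a < d \<Longrightarrow> b < d \<Longrightarrow> reaches X a b \<longleftrightarrow> (\<exists>n. restricted_power {..<d} entry n a b > 0)"
  by (simp add: reaches_def pow_entry)

lemma power_nonneg: "a < d \<Longrightarrow> b < d \<Longrightarrow> restricted_power {..<d} entry n a b \<ge> 0"
  using restricted_power_nonneg[of "{..<d}" entry] nonneg by auto

lemma reaches_refl: "a < d \<Longrightarrow> reaches X a a"
  using reaches_iff[of a a] by (auto intro!: exI[of _ 0])

lemma reaches_trans:
  assumes "a < d" "b < d" "c < d" "reaches X a b" "reaches X b c"
  shows "reaches X a c"
proof -
  obtain m n where mn: "restricted_power {..<d} entry m a b > 0" "restricted_power {..<d} entry n b c > 0"
    using assms reaches_iff by blast
  have "0 < restricted_power {..<d} entry m a b * restricted_power {..<d} entry n b c"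
    using mn by simp
  also have "\<dots> \<le> (\<Sum>c'<d. restricted_power {..<d} entry m a c' * restricted_power {..<d} entry n c' c)"
    using assms power_nonneg by (intro member_le_sum) auto
  also have "\<dots> = restricted_power {..<d} entry (m + n) a c"
    using restricted_power_add[of "{..<d}" a entry m n c] assms by simp
  finally show ?thesis using assms reaches_iff by blast
qed

lemma reaches_edge:
  assumes "a < d" "b < d" "entry a b > 0"
  shows "reaches X a b"
proof -
  have "0 < entry a b * restricted_power {..<d} entry 0 b b" using assms by simp
  also have "\<dots> \<le> (\<Sum>c<d. entry a c * restricted_power {..<d} entry 0 c b)"
    using assms nonneg by (intro member_le_sum) (auto simp del: restricted_power.simps intro!: mult_nonneg_nonneg power_nonneg)
  also have "\<dots> = restricted_power {..<d} entry 1 a b" by simp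
  finally show ?thesis using assms reaches_iff by blast
qed

lemma block_of_subset: "block_of X a \<subseteq> {..<d}"
  by (auto simp: block_of_def)

lemma finite_block_of: "finite (block_of X a)"
  by (simp add: block_of_def)

lemma mem_block_of_self: "a < d \<Longrightarrow> a \<in> block_of X a"
  using reaches_refl by (simp add: block_of_def)

lemma block_of_eq_iff:
  assumes "a < d" "b < d"
  shows "block_of X a = block_of X b \<longleftrightarrow> reaches X a b \<and> reaches X b a"
proof
  assume "block_of X a = block_of X b"
  then have "b \<in> block_of X a" using mem_block_of_self assms by auto
  then show "reaches X a b \<and> reaches X b a" by (auto simp: block_of_def)
next
  assume "reaches X a b \<and> reaches X b a"
  then show "block_of X a = block_of X b"
    using assms reaches_trans unfolding block_of_def dim_row_X by blast
qed

lemma block_of_eq: "a < d \<Longrightarrow> b \<in> block_of X a \<Longrightarrow> block_of X b = block_of X a"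
  using block_of_eq_iff[of b a] by (auto simp: block_of_def)

lemma blocks_eq: "blocks X = block_of X ` {..<d}"
  by (simp add: blocks_def)

lemma block_reaches_iff:
  assumes "a < d" "b < d"
  shows "block_reaches X (block_of X a) (block_of X b) \<longleftrightarrow> reaches X a b"
proof
  assume "block_reaches X (block_of X a) (block_of X b)"
  then obtain a' b' where "a' \<in> block_of X a" "b' \<in> block_of X b" "reaches X a' b'"
    by (auto simp: block_reaches_def)
  then have "a' < d" "b' < d" "reaches X a a'" "reaches X b' b" "reaches X a' b'"
    by (auto simp: block_of_def)
  then show "reaches X a b" using assms reaches_trans by blast
next
  assume "reaches X a b"
  then show "block_reaches X (block_of X a) (block_of X b)"
    using mem_block_of_self assms by (auto simp: block_reaches_def)
qed

definition reach :: "nat \<Rightarrow> nat set" where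
  "reach a = {b. b < d \<and> reaches X a b}"

lemma finite_reach [simp]: "finite (reach a)"
  by (simp add: reach_def)

lemma reachable_blocks_eq: "a < d \<Longrightarrow> reachable_blocks X a = block_of X ` reach a"
  using block_reaches_iff by (auto simp: reachable_blocks_def blocks_eq reach_def)

lemma max_radius_eq:
  "a < d \<Longrightarrow> max_radius X a = Max ((\<lambda>b. block_radius X (block_of X b)) ` reach a)"
  by (simp add: max_radius_def reachable_blocks_eq image_image)

lemma block_radius_le_max_radius:
  "a < d \<Longrightarrow> b < d \<Longrightarrow> reaches X a b \<Longrightarrow> block_radius X (block_of X b) \<le> max_radius X a"
  unfolding max_radius_eq by (intro Max_ge) (auto simp: reach_def)

lemma max_radius_attained:
  assumes "a < d"
  obtains b where "b < d" "reaches X a b" "block_radius X (block_of X b) = max_radius X a"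
proof -
  have "max_radius X a \<in> (\<lambda>b. block_radius X (block_of X b)) ` reach a"
    unfolding max_radius_eq[OF assms] using reaches_refl[OF assms] assms
    by (intro Max_in) (auto simp: reach_def)
  then show ?thesis using that by (auto simp: reach_def)
qed

lemma max_radius_mono:
  assumes "a < d" "b < d" "reaches X a b"
  shows "max_radius X b \<le> max_radius X a"
proof -
  obtain c where "c < d" "reaches X b c" "block_radius X (block_of X c) = max_radius X b"
    using max_radius_attained assms by blast
  then show ?thesis using block_radius_le_max_radius[of a c] reaches_trans assms by metis
qed

lemma block_radius_pos: "a < d \<Longrightarrow> block_radius X (block_of X a) > 0"
  using primitive_block_growth(1)[OF X block_of_subset, of a] prim mem_block_of_self[of a]
  by (auto simp: primitive_frobenius_def blocks_eq)

lemma max_radius_pos: "a < d \<Longrightarrow> max_radius X a > 0"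
  using block_radius_le_max_radius[of a a] block_radius_pos[of a] reaches_refl[of a] by linarith

section \<open>Chains of blocks and \<open>varkappa\<close>\<close>

definition chain_count :: "real \<Rightarrow> nat set list \<Rightarrow> nat" where
  "chain_count \<rho> Bs = length (filter (\<lambda>B. block_radius X B = \<rho>) Bs)"

text \<open>Chains are distinct lists over a finite set of blocks, so the \<open>Max\<close> in
  \<open>varkappa\<close> is attained.\<close>

lemma finite_chains: "finite {chain_count \<rho> Bs | Bs. block_chain X a Bs}"
proof -
  have "finite {Bs. set Bs \<subseteq> blocks X \<and> distinct Bs}"
    by (rule finite_subset_distinct) (simp add: blocks_eq)
  then have "finite {Bs. block_chain X a Bs}"
    by (rule rev_finite_subset) (auto simp: block_chain_def)
  then show ?thesis by simp
qed

lemma varkappa_ge: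
  "block_chain X a Bs \<Longrightarrow> chain_count (max_radius X a) Bs \<le> varkappa X a"
  unfolding varkappa_def chain_count_def[symmetric] by (intro Max_ge finite_chains) auto

lemma block_chain_singleton: "a < d \<Longrightarrow> block_chain X a [block_of X a]"
  by (auto simp: block_chain_def blocks_eq)

lemma varkappa_attained:
  assumes "a < d"
  obtains Bs where "block_chain X a Bs" "varkappa X a = chain_count (max_radius X a) Bs"
proof -
  have "varkappa X a \<in> {chain_count (max_radius X a) Bs | Bs. block_chain X a Bs}"
    unfolding varkappa_def chain_count_def[symmetric]
    using block_chain_singleton[OF assms] by (intro Max_in finite_chains) auto
  then show ?thesis using that by auto
qed

text \<open>Jump from the block of \<open>a\<close> straight to one of maximal radius, if that is
  another block. Consequently the exponents \<open>varkappa X a - 1\<close> are not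
  truncated.\<close>

lemma varkappa_pos:
  assumes "a < d"
  shows "varkappa X a \<ge> 1"
proof -
  obtain b where b: "b < d" "reaches X a b" "block_radius X (block_of X b) = max_radius X a"
    using max_radius_attained assms by blast
  show ?thesis
  proof (cases "block_of X a = block_of X b")
    case True
    then show ?thesis using varkappa_ge[OF block_chain_singleton[OF assms]] b by (simp add: chain_count_def)
  next
    case False
    then have "block_chain X a [block_of X a, block_of X b]"
      using assms b block_reaches_iff by (auto simp: block_chain_def blocks_eq)
    from varkappa_ge[OF this] show ?thesis using b by (simp add: chain_count_def split: if_splits)
  qed
qed

lemma block_chain_elem_reachable:
  assumes "a < d" "block_chain X a Bs" "B \<in> set Bs"
  obtains b where "b < d" "B = block_of X b" "reaches X a b"
proof -
  have "\<exists>b<d. B = block_of X b \<and> reaches X a b"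
    if "Bs \<noteq> []" "hd Bs = block_of X a" "set Bs \<subseteq> blocks X" "successively (block_reaches X) Bs"
      "B \<in> set Bs" "a < d" for Bs a B
    using that
  proof (induction Bs arbitrary: a)
    case (Cons C Cs)
    show ?case
    proof (cases "B = C")
      case True
      then show ?thesis using Cons.prems reaches_refl by auto
    next
      case False
      then have ne: "Cs \<noteq> []" "B \<in> set Cs" using Cons.prems by auto
      then obtain e where e: "e < d" "hd Cs = block_of X e"
        using Cons.prems(3) by (cases Cs) (auto simp: blocks_eq)
      have "block_reaches X C (hd Cs)" using Cons.prems(4) ne by (cases Cs) auto
      then have "reaches X a e" using e Cons.prems block_reaches_iff by auto
      moreover obtain b where "b < d" "B = block_of X b" "reaches X e b"
        using Cons.IH[of e] Cons.prems ne e by (auto simp: successively_Cons)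
      ultimately show ?thesis using reaches_trans Cons.prems(6) e by blast
    qed
  qed simp
  then show ?thesis using assms that unfolding block_chain_def by blast
qed

text \<open>There is no way back through such an edge (\<open>exitsD\<close>), so a path from
  \<open>a\<close> uses at most one of them.\<close>

definition exits :: "nat \<Rightarrow> (nat \<times> nat) set" where
  "exits a = {(b, c). b \<in> block_of X a \<and> c < d \<and> c \<notin> block_of X a \<and> entry b c > 0}"

lemma exitsD:
  assumes "a < d" "(b, c) \<in> exits a"
  shows "b < d" "c < d" "reaches X a c" "\<not> reaches X c a"
proof -
  have *: "b \<in> block_of X a" "c < d" "c \<notin> block_of X a" "entry b c > 0"
    using assms by (auto simp: exits_def)
  then have b: "b < d" "reaches X a b" "reaches X b a" by (auto simp: block_of_def)
  with * assms show "reaches X a c" using reaches_edge reaches_trans by blast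
  with * show "b < d" "c < d" "\<not> reaches X c a" using b by (auto simp: block_of_def)
qed

text \<open>Follow a path to \<open>e\<close>: the edge by which it first leaves the block is the
  exit, and the rest of the path leads from c to \<open>e\<close>.\<close>

lemma exit_towards:
  assumes "a < d" "e < d" "reaches X a e" "e \<notin> block_of X a"
  obtains b c where "(b, c) \<in> exits a" "reaches X c e"
proof -
  have "\<exists>b c. (b, c) \<in> exits a \<and> reaches X c e"
    if "restricted_power {..<d} entry n x e > 0" "x \<in> block_of X a" for n x
    using that
  proof (induction n arbitrary: x)
    case 0
    then show ?case using assms by (auto split: if_splits)
  next
    case (Suc n)
    have x: "x < d" using Suc.prems by (auto simp: block_of_def)
    have "(\<Sum>y<d. entry x y * restricted_power {..<d} entry n y e) > 0" using Suc.prems by simp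
    then obtain y where y: "y < d" "entry x y * restricted_power {..<d} entry n y e > 0"
      by (rule sum_pos_imp_term_pos) auto
    then have y': "entry x y > 0" "restricted_power {..<d} entry n y e > 0"
      using nonneg[of x y] power_nonneg[of y e n] assms x by (auto simp: zero_less_mult_iff)
    show ?case
    proof (cases "y \<in> block_of X a")
      case True
      then show ?thesis using Suc.IH y' by blast
    next
      case False
      then have "(x, y) \<in> exits a" using Suc.prems y y' by (auto simp: exits_def)
      moreover have "reaches X y e" using y y' assms reaches_iff by blast
      ultimately show ?thesis by blast
    qed
  qed
  moreover obtain n where "restricted_power {..<d} entry n a e > 0" using assms reaches_iff by blast
  ultimately show ?thesis using that mem_block_of_self[OF assms(1)] by blast
qed

text \<open>Prepend the block of \<open>a\<close> to an optimal chain from c. It does not occur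
  there already, since c would then reach back to \<open>a\<close>.\<close>

lemma varkappa_exit_ge:
  assumes a: "a < d" and e: "(b, c) \<in> exits a" and m: "max_radius X c = max_radius X a"
  shows "varkappa X c + (if block_radius X (block_of X a) = max_radius X a then 1 else 0) \<le> varkappa X a"
proof -
  note ex = exitsD[OF a e]
  obtain Bs where Bs: "block_chain X c Bs" "varkappa X c = chain_count (max_radius X c) Bs"
    using varkappa_attained ex by blast
  have "block_of X a \<notin> set Bs"
  proof
    assume "block_of X a \<in> set Bs"
    then obtain y where "y < d" "block_of X a = block_of X y" "reaches X c y"
      using block_chain_elem_reachable[OF ex(2) Bs(1)] by metis
    then have "reaches X c a" using block_of_eq_iff[of a y] reaches_trans[of c y a] a ex by blast
    then show False using ex by blast
  qed
  moreover have "block_reaches X (block_of X a) (hd Bs)"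
    using Bs(1) block_reaches_iff[OF a ex(2)] ex by (simp add: block_chain_def)
  ultimately have "block_chain X a (block_of X a # Bs)"
    using Bs(1) a by (auto simp: block_chain_def blocks_eq successively_Cons)
  from varkappa_ge[OF this] show ?thesis using Bs m by (simp add: chain_count_def split: if_splits)
qed

text \<open>Some exit attains equality in \<open>varkappa_exit_ge\<close>, or an optimal chain has
  no block of maximal radius besides its first. A chain may jump over blocks, so no edge need join
  its first two; an exit c towards the second one is chosen, and the block of c is inserted if the
  chain lacks it.\<close>

lemma varkappa_cases:
  assumes a: "a < d"
  defines "r \<equiv> block_radius X (block_of X a)" and "\<rho> \<equiv> max_radius X a"
  shows "r = \<rho> \<and> varkappa X a = 1 \<or>
    (\<exists>(b, c)\<in>exits a. max_radius X c = \<rho> \<and>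
      varkappa X a = varkappa X c + (if r = \<rho> then 1 else 0))"
proof -
  obtain Bs where Bs: "block_chain X a Bs" "varkappa X a = chain_count \<rho> Bs"
    using varkappa_attained a by (auto simp: \<rho>_def)
  then obtain Cs where Cs: "Bs = block_of X a # Cs" by (cases Bs) (auto simp: block_chain_def)
  have count: "varkappa X a = (if r = \<rho> then 1 else 0) + chain_count \<rho> Cs"
    using Bs Cs by (simp add: chain_count_def r_def)
  show ?thesis
  proof (cases "chain_count \<rho> Cs = 0")
    case True
    then show ?thesis using count varkappa_pos[OF a] by (auto split: if_splits)
  next
    case False
    then have ne: "Cs \<noteq> []" by (auto simp: chain_count_def)
    then obtain e where e: "e < d" "hd Cs = block_of X e"
      using Bs Cs by (cases Cs) (auto simp: block_chain_def blocks_eq)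
    have "block_reaches X (block_of X a) (hd Cs)" "hd Cs \<noteq> block_of X a"
      using Bs Cs ne unfolding block_chain_def
      by (simp_all add: successively_Cons) (metis hd_in_set)
    then have ae: "reaches X a e" "e \<notin> block_of X a"
      using e a block_reaches_iff block_of_eq[OF a] by auto
    obtain b c where bc: "(b, c) \<in> exits a" "reaches X c e" using exit_towards[OF a e(1) ae] by blast
    note ex = exitsD[OF a bc(1)]
    have tail: "block_chain X e Cs"
      using Bs Cs ne e by (auto simp: block_chain_def successively_Cons)
    \<comment> \<open>If the block of c occurs in \<open>Cs\<close>, it is the first one: c reaches
      e, and e reaches all of \<open>Cs\<close>. Otherwise it is put in front, which cannot lower
      the count.\<close>
    obtain Ds where Ds: "block_chain X c Ds" "set Cs \<subseteq> set Ds" "chain_count \<rho> Cs \<le> chain_count \<rho> Ds"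
    proof (cases "block_of X c \<in> set Cs")
      case True
      then obtain y where y: "y < d" "block_of X c = block_of X y" "reaches X e y"
        using block_chain_elem_reachable[OF e(1) tail] by metis
      then have "reaches X e c" using block_of_eq_iff[of c y] ex reaches_trans[of e y c] e by blast
      then have "block_of X c = block_of X e" using block_of_eq_iff[of c e] bc ex e by blast
      then have "block_chain X c Cs" using tail by (simp add: block_chain_def)
      then show ?thesis using that by blast
    next
      case False
      then have "block_chain X c (block_of X c # Cs)"
        using tail ex e bc block_reaches_iff[of c e]
        by (auto simp: block_chain_def successively_Cons blocks_eq)
      then show ?thesis by (rule that) (auto simp: chain_count_def)
    qed
    have "filter (\<lambda>B. block_radius X B = \<rho>) Cs \<noteq> []" using False by (auto simp: chain_count_def)
    then obtain B where "B \<in> set Cs" "block_radius X B = \<rho>" by (auto simp: filter_empty_conv)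
    then obtain y where y: "y < d" "reaches X c y" "block_radius X (block_of X y) = \<rho>"
      using block_chain_elem_reachable[OF ex(2) Ds(1)] Ds(2) by (metis subsetD)
    then have m: "max_radius X c = \<rho>"
      using block_radius_le_max_radius[of c y] max_radius_mono[of a c] a ex by (simp add: \<rho>_def)
    then have "chain_count \<rho> Cs \<le> varkappa X c" using varkappa_ge[OF Ds(1)] Ds(3) by simp
    moreover have "varkappa X c + (if r = \<rho> then 1 else 0) \<le> varkappa X a"
      using varkappa_exit_ge[OF a bc(1)] m by (simp add: r_def \<rho>_def)
    ultimately show ?thesis using count m bc(1) by (intro disjI2 bexI[of _ "(b, c)"]) auto
  qed
qed

section \<open>Row sums: first exits and growth\<close>

definition row_sum :: "nat \<Rightarrow> nat \<Rightarrow> real" where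
  "row_sum a n = (\<Sum>b<d. (X ^\<^sub>m n) $$ (a, b))"

lemma row_sum_eq: "a < d \<Longrightarrow> row_sum a n = (\<Sum>b<d. restricted_power {..<d} entry n a b)"
  unfolding row_sum_def using pow_entry by (intro sum.cong) auto

lemma row_sum_0: "a < d \<Longrightarrow> row_sum a 0 = 1"
  using X by (simp add: row_sum_def)

lemma row_sum_Suc:
  assumes "a < d"
  shows "row_sum a (Suc n) = (\<Sum>b<d. entry a b * row_sum b n)"
proof -
  have "row_sum a (Suc n) = (\<Sum>c<d. \<Sum>b<d. entry a b * restricted_power {..<d} entry n b c)"
    using assms by (simp add: row_sum_eq)
  also have "\<dots> = (\<Sum>b<d. \<Sum>c<d. entry a b * restricted_power {..<d} entry n b c)"
    by (rule sum.swap)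
  also have "\<dots> = (\<Sum>b<d. entry a b * row_sum b n)"
    by (intro sum.cong refl) (auto simp: row_sum_eq sum_distrib_left)
  finally show ?thesis .
qed

text \<open>The summand j = n is split off: it belongs to paths that leave at once, which is
  possible only from b itself.\<close>

lemma conv_power_Suc:
  assumes "finite B"
  shows "conv (\<lambda>n. restricted_power B entry n a b) g (Suc n) =
    of_bool (a = b) * g n + (\<Sum>b'\<in>B. entry a b' * conv (\<lambda>n. restricted_power B entry n b' b) g n)"
proof -
  have "conv (\<lambda>n. restricted_power B entry n a b) g (Suc n)
    = of_bool (a = b) * g n + (\<Sum>j<n. restricted_power B entry (n - j) a b * g j)"
    by (simp add: conv_def)
  also have "(\<Sum>j<n. restricted_power B entry (n - j) a b * g j) =
      (\<Sum>j<n. \<Sum>b'\<in>B. entry a b' * restricted_power B entry (n - Suc j) b' b * g j)"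
  proof (rule sum.cong[OF refl])
    fix j assume "j \<in> {..<n}"
    then have "n - j = Suc (n - Suc j)" by auto
    then show "restricted_power B entry (n - j) a b * g j =
      (\<Sum>b'\<in>B. entry a b' * restricted_power B entry (n - Suc j) b' b * g j)"
      by (simp only: restricted_power.simps sum_distrib_right)
  qed
  also have "\<dots> = (\<Sum>b'\<in>B. entry a b' * conv (\<lambda>n. restricted_power B entry n b' b) g n)"
    unfolding conv_def sum_distrib_left by (subst sum.swap) (simp add: mult.assoc)
  finally show ?thesis .
qed

text \<open>First-exit decomposition: a path of length \<open>n\<close> from \<open>a\<close> either stays in the block \<open>B\<close>
  of \<open>a\<close> or leaves it at a first edge \<open>(b, c)\<close>.\<close>

lemma row_sum_first_exit:
  fixes a0 :: nat
  defines "B \<equiv> block_of X a0"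
  assumes "a \<in> B"
  shows "row_sum a n = (\<Sum>b\<in>B. restricted_power B entry n a b) +
    (\<Sum>b\<in>B. \<Sum>c\<in>{..<d} - B. entry b c * conv (\<lambda>n. restricted_power B entry n a b) (row_sum c) n)"
  using assms(2)
proof (induction n arbitrary: a)
  case 0
  have B: "finite B" "B \<subseteq> {..<d}" using block_of_subset finite_block_of by (auto simp: B_def)
  have "(\<Sum>b\<in>B. restricted_power B entry 0 a b) = (\<Sum>b\<in>B. if b = a then 1 else 0)"
    by (intro sum.cong) auto
  then show ?case using 0 B by (simp add: row_sum_0 conv_def subset_iff)
next
  case (Suc n)
  have B: "finite B" "B \<subseteq> {..<d}" using block_of_subset finite_block_of by (auto simp: B_def)
  let ?C = "{..<d} - B"
  let ?q = "\<lambda>a b n. restricted_power B entry n a b"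
  have "row_sum a (Suc n) = (\<Sum>b<d. entry a b * row_sum b n)"
    using row_sum_Suc Suc.prems B by auto
  also have "\<dots> = (\<Sum>b\<in>?C. entry a b * row_sum b n) + (\<Sum>b\<in>B. entry a b * row_sum b n)"
    by (rule sum.subset_diff[OF B(2)]) simp
  also have "(\<Sum>b\<in>B. entry a b * row_sum b n) =
      (\<Sum>b'\<in>B. entry a b' * ((\<Sum>b\<in>B. ?q b' b n) + (\<Sum>b\<in>B. \<Sum>c\<in>?C. entry b c * conv (?q b' b) (row_sum c) n)))"
    by (intro sum.cong) (auto simp: Suc.IH)
  also have "\<dots> = (\<Sum>b\<in>B. ?q a b (Suc n)) +
      (\<Sum>b\<in>B. \<Sum>c\<in>?C. entry b c * (\<Sum>b'\<in>B. entry a b' * conv (?q b' b) (row_sum c) n))"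
  proof -
    have "(\<Sum>b'\<in>B. entry a b' * (\<Sum>b\<in>B. ?q b' b n)) = (\<Sum>b\<in>B. ?q a b (Suc n))"
      unfolding restricted_power.simps sum_distrib_left by (rule sum.swap)
    moreover have "(\<Sum>b'\<in>B. entry a b' * (\<Sum>b\<in>B. \<Sum>c\<in>?C. entry b c * conv (?q b' b) (row_sum c) n)) =
      (\<Sum>b\<in>B. \<Sum>c\<in>?C. entry b c * (\<Sum>b'\<in>B. entry a b' * conv (?q b' b) (row_sum c) n))"
    proof -
      have "(\<Sum>b'\<in>B. entry a b' * (\<Sum>b\<in>B. \<Sum>c\<in>?C. entry b c * conv (?q b' b) (row_sum c) n)) =
        (\<Sum>b\<in>B. \<Sum>b'\<in>B. \<Sum>c\<in>?C. entry a b' * (entry b c * conv (?q b' b) (row_sum c) n))"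
        unfolding sum_distrib_left by (rule sum.swap)
      also have "\<dots> = (\<Sum>b\<in>B. \<Sum>c\<in>?C. \<Sum>b'\<in>B. entry a b' * (entry b c * conv (?q b' b) (row_sum c) n))"
        by (rule sum.cong[OF refl], rule sum.swap)
      finally show ?thesis by (simp add: sum_distrib_left mult_ac)
    qed
    ultimately show ?thesis by (simp only: distrib_left sum.distrib)
  qed
  \<comment> \<open>Immediate exits, spread over all b to match the \<open>of_bool\<close> term of
    \<open>conv_power_Suc\<close>.\<close>
  also have "(\<Sum>b\<in>?C. entry a b * row_sum b n) =
      (\<Sum>b\<in>B. \<Sum>c\<in>?C. entry b c * (of_bool (a = b) * row_sum c n))"
  proof -
    have "(\<Sum>b\<in>B. \<Sum>c\<in>?C. entry b c * (of_bool (a = b) * row_sum c n)) =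
      (\<Sum>b\<in>B. if b = a then \<Sum>c\<in>?C. entry b c * row_sum c n else 0)"
      by (intro sum.cong) auto
    then show ?thesis using B Suc.prems by simp
  qed
  finally show ?case
    unfolding conv_power_Suc[OF B(1)] distrib_left sum.distrib by (simp only: add_ac)
qed

text \<open>The contribution of one exit, viewed at the scale of \<open>a\<close>. By
  \<open>varkappa_exit_ge\<close> its own order is never larger; the limit is positive if c realises
  \<open>varkappa X a\<close>.\<close>

lemma exit_term_grows:
  assumes a: "a < d" and bc: "(b, c) \<in> exits a"
    and c: "C > 0" "grows (row_sum c) C (varkappa X c - 1) (max_radius X c)"
  defines "r \<equiv> block_radius X (block_of X a)" and "\<rho> \<equiv> max_radius X a"
  shows "\<exists>y\<ge>0. grows (conv (\<lambda>n. restricted_power (block_of X a) entry n a b) (row_sum c)) y (varkappa X a - 1) \<rho>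
    \<and> (max_radius X c = \<rho> \<and> varkappa X a = varkappa X c + (if r = \<rho> then 1 else 0) \<longrightarrow> y > 0)"
proof -
  note ex = exitsD[OF a bc]
  let ?B = "block_of X a"
  let ?q = "\<lambda>n. restricted_power ?B entry n a b"
  define m where "m = max_radius X c"
  have b: "b \<in> ?B" using bc by (auto simp: exits_def)
  have "primitive_mat (diagonal_block X ?B)"
    using prim a by (auto simp: primitive_frobenius_def blocks_eq)
  with primitive_block_growth(2)[OF X block_of_subset _ this mem_block_of_self[OF a] b] b
  obtain p where p: "p > 0" "grows ?q p 0 r" by (auto simp: r_def)
  have r: "r > 0" using block_radius_pos[OF a] by (simp add: r_def)
  have m0: "m > 0" using max_radius_pos ex by (simp add: m_def)
  have le: "m \<le> \<rho>" "r \<le> \<rho>"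
    using max_radius_mono[of a c] block_radius_le_max_radius[of a a] reaches_refl a ex
    by (auto simp: m_def \<rho>_def r_def)
  have q0: "?q n \<ge> 0" for n
    using block_of_subset[of a] b mem_block_of_self[OF a] nonneg
    by (intro restricted_power_nonneg) auto
  have s0: "row_sum c n \<ge> 0" for n
    using ex power_nonneg by (auto simp: row_sum_eq intro!: sum_nonneg)
  have k: "varkappa X c \<ge> 1" "varkappa X a \<ge> 1" using varkappa_pos ex a by auto
  have vk: "varkappa X c + (if r = \<rho> then 1 else 0) \<le> varkappa X a" if "m = \<rho>"
    using varkappa_exit_ge[OF a bc] that by (simp add: m_def r_def \<rho>_def)
  note c' = c(2)[folded m_def]
  \<comment> \<open>(k', l) is the true order of the convolution: (0, r) for m < r,
    (\<open>varkappa X c\<close>, r) for m = r and (\<open>varkappa X c - 1\<close>, m) for r <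
    m.\<close>
  have "\<exists>y>0. \<exists>k' l. grows (conv ?q (row_sum c)) y k' l \<and> l > 0 \<and>
     (l < \<rho> \<or> l = \<rho> \<and> k' \<le> varkappa X a - 1) \<and>
     (m = \<rho> \<and> varkappa X a = varkappa X c + (if r = \<rho> then 1 else 0) \<longrightarrow> l = \<rho> \<and> k' = varkappa X a - 1)"
  proof -
    consider "m < r" | "m = r" | "r < m" by linarith
    then show ?thesis
    proof cases
      case 1
      obtain y where y: "y > 0" "grows (conv ?q (row_sum c)) y 0 r"
        using grows_conv_left[OF p(2,1) r c' c(1) m0 s0 1] by blast
      show ?thesis using y r le 1 by (intro exI[of _ y] conjI exI[of _ 0] exI[of _ r]) auto
    next
      case 2
      then have c'': "grows (row_sum c) C (varkappa X c - 1) r" using c' by simp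
      obtain y where y: "y > 0" "grows (conv ?q (row_sum c)) y (Suc (varkappa X c - 1)) r"
        using grows_conv_resonant[OF p(2,1) r c'' c(1)] by blast
      show ?thesis using y r le 2 vk k
        by (intro exI[of _ y] conjI exI[of _ "Suc (varkappa X c - 1)"] exI[of _ r]) auto
    next
      case 3
      obtain y where y: "y > 0" "grows (conv ?q (row_sum c)) y (varkappa X c - 1) m"
        using grows_conv_right[OF p(2,1) r q0 c' c(1) m0 3] by blast
      show ?thesis using y m0 le 3 vk k
        by (intro exI[of _ y] conjI exI[of _ "varkappa X c - 1"] exI[of _ m]) (auto split: if_splits)
    qed
  qed
  then obtain y k' l where y: "y > 0" "grows (conv ?q (row_sum c)) y k' l" "l > 0"
    "l < \<rho> \<or> l = \<rho> \<and> k' \<le> varkappa X a - 1"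
    "m = \<rho> \<and> varkappa X a = varkappa X c + (if r = \<rho> then 1 else 0) \<Longrightarrow> l = \<rho> \<and> k' = varkappa X a - 1"
    by blast
  show ?thesis
  proof (cases "l = \<rho> \<and> k' = varkappa X a - 1")
    case True
    then show ?thesis using y by (intro exI[of _ y]) auto
  next
    case False
    then have "grows (conv ?q (row_sum c)) 0 (varkappa X a - 1) \<rho>"
      using y by (intro grows_weaken[OF y(2,3)]) auto
    then show ?thesis using False y(5) by (intro exI[of _ 0]) (auto simp: m_def)
  qed
qed

text \<open>The number of reachable indices drops strictly at an exit, because c cannot reach
  \<open>a\<close>. In \<open>row_sum_first_exit\<close> every term has a nonnegative limit at the
  scale of \<open>a\<close>, and \<open>varkappa_cases\<close> singles out a positive one.\<close>

lemma row_sum_grows: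
  assumes "a < d"
  shows "\<exists>C>0. grows (row_sum a) C (varkappa X a - 1) (max_radius X a)"
  using assms
proof (induction "card (reach a)" arbitrary: a rule: less_induct)
  case less
  note a = \<open>a < d\<close>
  define B where "B = block_of X a"
  define r where "r = block_radius X B"
  define \<rho> where "\<rho> = max_radius X a"
  define \<kappa> where "\<kappa> = varkappa X a - 1"
  let ?q = "\<lambda>b n. restricted_power B entry n a b"
  have aB: "a \<in> B" using mem_block_of_self a by (simp add: B_def)
  have B: "finite B" "B \<subseteq> {..<d}" using block_of_subset finite_block_of by (auto simp: B_def)
  have r: "r > 0" using block_radius_pos a by (simp add: r_def B_def)
  have le: "r \<le> \<rho>" using block_radius_le_max_radius[of a a] reaches_refl a by (simp add: r_def B_def \<rho>_def)
  \<comment> \<open>Paths that stay in the block are visible at this scale only if r = \<rho> and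
    the exponent is 0.\<close>
  have inner: "\<exists>y\<ge>0. grows (?q b) y \<kappa> \<rho> \<and> (r = \<rho> \<and> varkappa X a = 1 \<longrightarrow> y > 0)" if b: "b \<in> B" for b
  proof -
    have "primitive_mat (diagonal_block X B)"
      using prim a by (auto simp: primitive_frobenius_def blocks_eq B_def)
    with primitive_block_growth(2)[OF X B(2) _ this aB b] b
    obtain p where p: "p > 0" "grows (?q b) p 0 r" by (auto simp: r_def)
    show ?thesis
    proof (cases "r = \<rho> \<and> \<kappa> = 0")
      case True
      then show ?thesis using p by (intro exI[of _ p]) auto
    next
      case False
      then have "grows (?q b) 0 \<kappa> \<rho>" using le by (intro grows_weaken[OF p(2) r]) auto
      then show ?thesis using False by (intro exI[of _ 0]) (auto simp: \<kappa>_def)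
    qed
  qed
  have outer: "\<exists>y\<ge>0. grows (\<lambda>n. entry b c * conv (?q b) (row_sum c) n) y \<kappa> \<rho> \<and>
      ((b, c) \<in> exits a \<and> max_radius X c = \<rho> \<and> varkappa X a = varkappa X c + (if r = \<rho> then 1 else 0) \<longrightarrow> y > 0)"
    if b: "b \<in> B" "c \<in> {..<d} - B" for b c
  proof (cases "entry b c > 0")
    case False
    then have "entry b c = 0" using nonneg[of b c] b B by force
    then show ?thesis using False by (intro exI[of _ 0]) (auto simp: grows_def exits_def)
  next
    case True
    then have bc: "(b, c) \<in> exits a" using b by (auto simp: exits_def B_def)
    note ex = exitsD[OF a bc]
    have "reach c \<subseteq> reach a" using reaches_trans[OF a ex(2) _ ex(3)] by (auto simp: reach_def)
    moreover have "a \<in> reach a" "a \<notin> reach c" using a ex(4) reaches_refl[OF a] by (auto simp: reach_def)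
    ultimately have "reach c \<subset> reach a" by blast
    then have "card (reach c) < card (reach a)" by (intro psubset_card_mono) auto
    from less.hyps[OF this ex(2)] obtain C where "C > 0" "grows (row_sum c) C (varkappa X c - 1) (max_radius X c)"
      by blast
    from exit_term_grows[OF a bc this, folded B_def, folded r_def \<rho>_def \<kappa>_def] obtain y where y: "y \<ge> 0" "grows (conv (?q b) (row_sum c)) y \<kappa> \<rho>"
      "max_radius X c = \<rho> \<and> varkappa X a = varkappa X c + (if r = \<rho> then 1 else 0) \<longrightarrow> y > 0"
      by blast
    have "grows (\<lambda>n. entry b c * conv (?q b) (row_sum c) n) (entry b c * y) \<kappa> \<rho>"
      by (rule grows_cmult[OF y(2)])
    moreover have "entry b c * y \<ge> 0" "y > 0 \<Longrightarrow> entry b c * y > 0" using y(1) True by auto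
    ultimately show ?thesis using y(3) by blast
  qed
  obtain f where f: "\<And>b. b \<in> B \<Longrightarrow> f b \<ge> 0 \<and> grows (?q b) (f b) \<kappa> \<rho> \<and> (r = \<rho> \<and> varkappa X a = 1 \<longrightarrow> f b > 0)"
    using inner by metis
  have "\<exists>g. \<forall>b c. b \<in> B \<and> c \<in> {..<d} - B \<longrightarrow> g b c \<ge> 0 \<and> grows (\<lambda>n. entry b c * conv (?q b) (row_sum c) n) (g b c) \<kappa> \<rho> \<and>
      ((b, c) \<in> exits a \<and> max_radius X c = \<rho> \<and> varkappa X a = varkappa X c + (if r = \<rho> then 1 else 0) \<longrightarrow> g b c > 0)"
    by (intro choice allI) (use outer in blast)
  then obtain g where g: "\<And>b c. b \<in> B \<Longrightarrow> c \<in> {..<d} - B \<Longrightarrow> g b c \<ge> 0 \<and>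
      grows (\<lambda>n. entry b c * conv (?q b) (row_sum c) n) (g b c) \<kappa> \<rho> \<and>
      ((b, c) \<in> exits a \<and> max_radius X c = \<rho> \<and> varkappa X a = varkappa X c + (if r = \<rho> then 1 else 0) \<longrightarrow> g b c > 0)"
    by blast
  have "grows (row_sum a) ((\<Sum>b\<in>B. f b) + (\<Sum>b\<in>B. \<Sum>c\<in>{..<d} - B. g b c)) \<kappa> \<rho>"
    unfolding row_sum_first_exit[of a a, folded B_def, OF aB, abs_def]
    by (intro grows_add grows_sum) (use f g in auto)
  moreover have "(\<Sum>b\<in>B. f b) + (\<Sum>b\<in>B. \<Sum>c\<in>{..<d} - B. g b c) > 0"
  proof -
    have f0: "(\<Sum>b\<in>B. f b) \<ge> 0" using f by (intro sum_nonneg) auto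
    have g0: "(\<Sum>c\<in>{..<d} - B. g b c) \<ge> 0" if "b \<in> B" for b using g that by (intro sum_nonneg) auto
    consider "r = \<rho>" "varkappa X a = 1"
      | b c where "(b, c) \<in> exits a" "max_radius X c = \<rho>" "varkappa X a = varkappa X c + (if r = \<rho> then 1 else 0)"
      using varkappa_cases[OF a] unfolding r_def B_def \<rho>_def by auto
    then show ?thesis
    proof cases
      case 1
      then have "0 < f a" using f aB by auto
      also have "f a \<le> (\<Sum>b\<in>B. f b)" using B aB f by (intro member_le_sum) auto
      moreover have "(\<Sum>b\<in>B. \<Sum>c\<in>{..<d} - B. g b c) \<ge> 0" by (rule sum_nonneg) (rule g0)
      ultimately show ?thesis by linarith
    next
      case 2
      then have bc: "b \<in> B" "c \<in> {..<d} - B" by (auto simp: exits_def B_def)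
      have "0 < g b c" using g[OF bc] 2 by auto
      also have "\<dots> \<le> (\<Sum>c\<in>{..<d} - B. g b c)" using g bc by (intro member_le_sum) auto
      also have "\<dots> \<le> (\<Sum>b\<in>B. \<Sum>c\<in>{..<d} - B. g b c)"
        using g0 B bc by (intro member_le_sum[of b B "\<lambda>b. \<Sum>c\<in>{..<d} - B. g b c"]) auto
      finally show ?thesis using f0 by linarith
    qed
  qed
  ultimately show ?case unfolding \<kappa>_def \<rho>_def by blast
qed

end

section \<open>Degrees in the iterated graphs\<close>

text \<open>Choosing the end by the parity of the coordinate lets one argument cover outgoing and
  incoming edges.\<close>

definition arc_end :: "('v, 'e) cgraph \<Rightarrow> nat \<Rightarrow> 'e \<Rightarrow> 'v" where
  "arc_end G a e = (if even a then tail (graph G) e else head (graph G) e)"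

text \<open>A loop at \<open>v\<close> appears once for each parity, which is how
  \<open>kappa\<close> counts it.\<close>

definition half_edges :: "('v, 'e) cgraph \<Rightarrow> nat \<Rightarrow> 'v \<Rightarrow> 'e set" where
  "half_edges G a v = {e \<in> arcs (graph G).
     arc_end G a e = v \<and> colour G e = a div 2}"

lemma kappa_index: "a < 2 * K \<Longrightarrow> kappa K G v $ a = real (card (half_edges G a v))"
  unfolding kappa_def half_edges_def arc_end_def
  by (auto simp: out_arcs_def in_arcs_def intro!: arg_cong[of _ _ card])

lemma dim_kappa [simp]: "dim_vec (kappa K G v) = 2 * K"
  by (simp add: kappa_def)

lemma sum_even_odd: "(\<Sum>a<2 * K. f a) = (\<Sum>i<K. f (2 * i) + f (2 * i + 1))"
  for f :: "nat \<Rightarrow> 'a :: comm_monoid_add"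
  by (induction K) (auto simp: add_ac)

lemma deg_eq_sum_kappa:
  assumes fin: "finite (arcs (graph G))"
    and col: "\<And>e. e \<in> arcs (graph G) \<Longrightarrow> colour G e < K"
  shows "real (deg G v) = (\<Sum>a<2 * K. kappa K G v $ a)"
proof -
  have split: "card A = (\<Sum>i<K. card {e \<in> A. colour G e = i})"
    if "A \<subseteq> arcs (graph G)" for A
  proof -
    have A: "finite A" using fin that finite_subset by blast
    have "A = (\<Union>i<K. {e \<in> A. colour G e = i})" using that col by auto
    then have "card A = card (\<Union>i<K. {e \<in> A. colour G e = i})" by simp
    also have "\<dots> = (\<Sum>i<K. card {e \<in> A. colour G e = i})"
      by (rule card_UN_disjoint) (use A in auto)
    finally show ?thesis .
  qed
  have "out_degree (graph G) v = (\<Sum>i<K. card (half_edges G (2 * i) v))"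
    unfolding out_degree_def
    by (subst split) (auto simp: out_arcs_def half_edges_def arc_end_def intro!: sum.cong arg_cong[of _ _ card])
  moreover have "in_degree (graph G) v = (\<Sum>i<K. card (half_edges G (2 * i + 1) v))"
    unfolding in_degree_def
    by (subst split) (auto simp: in_arcs_def half_edges_def arc_end_def intro!: sum.cong arg_cong[of _ _ card])
  ultimately have "deg G v = (\<Sum>a<2 * K. card (half_edges G a v))"
    unfolding sum_even_odd by (simp add: deg_def sum.distrib)
  then show ?thesis by (simp add: kappa_index)
qed

text \<open>The empty walk costs 0. This turns a distance of at least 2 into distinctness of the
  planting vertices.\<close>

lemma undirected_dist_self:
  assumes "wf_digraph G" "u \<in> verts G"
  shows "undirected_dist G u u \<le> 0"
proof -
  interpret G: wf_digraph G by fact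
  interpret P: pair_wf_digraph "mk_symmetric G" by (rule G.wellformed_mk_symmetric)
  have "pre_digraph.awalk (with_proj (mk_symmetric G)) u [] u"
    using assms(2) by (simp add: P.awalk_Nil_iff)
  from P.min_cost_le_walk_cost[OF this, of "\<lambda>_. 1"] show ?thesis
    by (simp add: undirected_dist_def zero_ereal_def)
qed

text \<open>Take the first step of an undirected path from \<open>u\<close> to
  \<open>w\<close>.\<close>

lemma connected_incident_arc:
  assumes "Digraph_Component.connected G" "u \<in> verts G" "w \<in> verts G" "u \<noteq> w"
  obtains e where "e \<in> arcs G" "tail G e = u \<or> head G e = u"
proof -
  have "(u, w) \<in> rtrancl_on (verts (with_proj (mk_symmetric G))) (arcs_ends (with_proj (mk_symmetric G)))"
    using assms unfolding connected_def strongly_connected_def reachable_def by simp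
  then have "(u, w) \<in> (arcs_ends (with_proj (mk_symmetric G)))\<^sup>*"
    by (rule rtrancl_on_rtranclI)
  with assms(4) obtain y where "(u, y) \<in> arcs_ends (with_proj (mk_symmetric G))"
    by (meson converse_rtranclE)
  then have "(u, y) \<in> parcs (mk_symmetric G)" by (auto simp: arcs_ends_def arc_to_ends_def)
  then show ?thesis using that by (auto simp: parcs_mk_symmetric)
qed

locale edge_igs =
  fixes S :: "('v, 'e) eigs" and \<iota> :: nat
  assumes eigs: "is_eigs S" and iota: "\<iota> < num_colours S"
begin

abbreviation "K \<equiv> num_colours S"
abbreviation "R i \<equiv> repl S i"
abbreviation "\<Xi> n \<equiv> Xi S \<iota> n"

definition beta :: "nat \<Rightarrow> 'v" where
  "beta a = (if even a then beta_plus S (a div 2) else beta_minus S (a div 2))"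

lemma R_props:
  assumes "i < K"
  shows "fin_digraph (graph (R i))" "Digraph_Component.connected (graph (R i))"
    "\<And>e. e \<in> arcs (graph (R i)) \<Longrightarrow> colour (R i) e < K"
    "beta_plus S i \<in> verts (graph (R i))" "beta_minus S i \<in> verts (graph (R i))"
    "beta_plus S i \<noteq> beta_minus S i"
proof -
  show 1: "fin_digraph (graph (R i))" "Digraph_Component.connected (graph (R i))"
    "\<And>e. e \<in> arcs (graph (R i)) \<Longrightarrow> colour (R i) e < K"
    "beta_plus S i \<in> verts (graph (R i))" "beta_minus S i \<in> verts (graph (R i))"
    using eigs assms by (auto simp: is_eigs_def)
  have "wf_digraph (graph (R i))" using 1(1) by (simp add: fin_digraph_def)
  then have "undirected_dist (graph (R i)) (beta_plus S i) (beta_plus S i) \<le> 0"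
    using 1(4) by (rule undirected_dist_self)
  moreover have "undirected_dist (graph (R i)) (beta_plus S i) (beta_minus S i) \<ge> 2"
    using eigs assms by (auto simp: is_eigs_def)
  ultimately show "beta_plus S i \<noteq> beta_minus S i"
    by (auto dest: order_trans simp: numeral_eq_ereal zero_ereal_def)
qed

lemma finite_R: "i < K \<Longrightarrow> finite (arcs (graph (R i)))" "i < K \<Longrightarrow> finite (verts (graph (R i)))"
  using R_props(1)[of i] by (auto simp: fin_digraph_def fin_digraph_axioms_def)

lemma R_ends:
  "i < K \<Longrightarrow> e \<in> arcs (graph (R i)) \<Longrightarrow> tail (graph (R i)) e \<in> verts (graph (R i))"
  "i < K \<Longrightarrow> e \<in> arcs (graph (R i)) \<Longrightarrow> head (graph (R i)) e \<in> verts (graph (R i))"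
  using R_props(1)[of i] by (auto simp: fin_digraph_def wf_digraph_def)

text \<open>A connected graph with two distinct planting vertices has no isolated vertex. Both the
  nonzero birth types and the lower bound on the row sums of N rest on this.\<close>

lemma R_vertex_half_edge:
  assumes "i < K" "w \<in> verts (graph (R i))"
  obtains a where "a < 2 * K" "half_edges (R i) a w \<noteq> {}"
proof -
  obtain w' where "w' \<in> verts (graph (R i))" "w \<noteq> w'"
    using R_props[OF assms(1)] by metis
  then obtain e where e: "e \<in> arcs (graph (R i))"
    "tail (graph (R i)) e = w \<or> head (graph (R i)) e = w"
    using connected_incident_arc R_props(2)[OF assms(1)] assms(2) by metis
  have c: "colour (R i) e < K" using R_props(3) assms e by blast
  from e(2) show ?thesis
  proof
    assume "tail (graph (R i)) e = w"
    then have "e \<in> half_edges (R i) (2 * colour (R i) e) w" using e by (simp add: half_edges_def arc_end_def)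
    then show ?thesis using that[of "2 * colour (R i) e"] c by auto
  next
    assume "head (graph (R i)) e = w"
    then have "e \<in> half_edges (R i) (2 * colour (R i) e + 1) w" using e by (simp add: half_edges_def arc_end_def)
    then show ?thesis using that[of "2 * colour (R i) e + 1"] c by auto
  qed
qed

section \<open>Structure of one replacement step\<close>

lemma arcs_Suc:
  "arcs (graph (\<Xi> (Suc n))) = {e # p | e p. p \<in> arcs (graph (\<Xi> n)) \<and> e \<in> arcs (graph (R (colour (\<Xi> n) p)))}"
  by (simp add: replace_edges_def)

lemma colour_Suc: "colour (\<Xi> (Suc n)) (e # p) = colour (R (colour (\<Xi> n) p)) e"
  by (simp add: replace_edges_def)

lemma ends_Suc:
  "tail (graph (\<Xi> (Suc n))) (e # p) = place S (\<Xi> n) p (tail (graph (R (colour (\<Xi> n) p))) e)"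
  "head (graph (\<Xi> (Suc n))) (e # p) = place S (\<Xi> n) p (head (graph (R (colour (\<Xi> n) p))) e)"
  by (simp_all add: replace_edges_def)

lemma arc_end_Suc:
  "arc_end (\<Xi> (Suc n)) b (e # p) = place S (\<Xi> n) p (arc_end (R (colour (\<Xi> n) p)) b e)"
  by (simp add: arc_end_def ends_Suc del: Xi.simps)

lemma verts_Suc_raw:
  "verts (graph (\<Xi> (Suc n))) = verts (graph (\<Xi> n)) \<union>
    {place S (\<Xi> n) p w | p w. p \<in> arcs (graph (\<Xi> n)) \<and> w \<in> verts (graph (R (colour (\<Xi> n) p)))}"
  by (simp add: replace_edges_def)

text \<open>The length of an address records its generation; freshness of the inserted vertices is
  deduced from this.\<close>

lemma Xi_arcs:
  "finite (arcs (graph (\<Xi> n)))"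
  "p \<in> arcs (graph (\<Xi> n)) \<Longrightarrow> colour (\<Xi> n) p < K"
  "p \<in> arcs (graph (\<Xi> n)) \<Longrightarrow> length p = n"
  "p \<in> arcs (graph (\<Xi> n)) \<Longrightarrow> tail (graph (\<Xi> n)) p \<in> verts (graph (\<Xi> n))"
  "p \<in> arcs (graph (\<Xi> n)) \<Longrightarrow> head (graph (\<Xi> n)) p \<in> verts (graph (\<Xi> n))"
proof (induction n arbitrary: p)
  case 0
  { case 1 then show ?case by (simp add: single_edge_def) }
  { case 2 then show ?case using iota by (simp add: single_edge_def) }
  { case 3 then show ?case by (simp add: single_edge_def) }
  { case 4 then show ?case by (simp add: single_edge_def) }
  { case 5 then show ?case by (simp add: single_edge_def) }
next
  case (Suc n)
  { case 1
    have "arcs (graph (\<Xi> (Suc n))) =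
      (\<lambda>(p, e). e # p) ` (SIGMA p:arcs (graph (\<Xi> n)). arcs (graph (R (colour (\<Xi> n) p))))"
      unfolding arcs_Suc by force
    then show ?case using Suc.IH(1,2) finite_R by auto }
  { case 2 then show ?case using Suc.IH(2) R_props(3) unfolding arcs_Suc by (auto simp: colour_Suc simp del: Xi.simps) }
  { case 3 then show ?case using Suc.IH(3) unfolding arcs_Suc by auto }
  { case 4 then show ?case using Suc.IH(2) R_ends(1) unfolding arcs_Suc verts_Suc_raw by (fastforce simp: ends_Suc simp del: Xi.simps) }
  { case 5 then show ?case using Suc.IH(2) R_ends(2) unfolding arcs_Suc verts_Suc_raw by (fastforce simp: ends_Suc simp del: Xi.simps) }
qed

definition interior :: "nat \<Rightarrow> 'v set" where
  "interior i = verts (graph (R i)) - {beta_plus S i, beta_minus S i}"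

text \<open>The planting vertices of a copy are glued to the ends of the replaced edge, which exist
  already.\<close>

lemma verts_Suc:
  "verts (graph (\<Xi> (Suc n))) = verts (graph (\<Xi> n)) \<union>
    {Inner p w | p w. p \<in> arcs (graph (\<Xi> n)) \<and> w \<in> interior (colour (\<Xi> n) p)}"
proof -
  have "place S (\<Xi> n) p w \<in> verts (graph (\<Xi> n)) \<union> {Inner p w | p w. p \<in> arcs (graph (\<Xi> n)) \<and> w \<in> interior (colour (\<Xi> n) p)}"
    if "p \<in> arcs (graph (\<Xi> n))" "w \<in> verts (graph (R (colour (\<Xi> n) p)))" for p w
    using that Xi_arcs(4,5)[of p n] by (auto simp: place_def interior_def)
  moreover have "Inner p w = place S (\<Xi> n) p w" if "w \<in> interior (colour (\<Xi> n) p)" for p w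
    using that by (auto simp: place_def interior_def)
  ultimately show ?thesis unfolding verts_Suc_raw by (fastforce simp: interior_def)
qed

lemma verts_mono: "m \<le> n \<Longrightarrow> verts (graph (\<Xi> m)) \<subseteq> verts (graph (\<Xi> n))"
  by (rule lift_Suc_mono_le[of "\<lambda>n. verts (graph (\<Xi> n))"]) (unfold verts_Suc, auto)

text \<open>Freshness: an edge of generation n has an address of length n, so the inner vertices of
  its copy cannot occur in generation n.\<close>

lemma Inner_length: "Inner p w \<in> verts (graph (\<Xi> n)) \<Longrightarrow> length p < n"
proof (induction n)
  case (Suc n)
  then show ?case using Xi_arcs(3) unfolding verts_Suc by fastforce
qed (simp add: single_edge_def)

lemma finite_verts: "finite (verts (graph (\<Xi> n)))"
proof (induction n)
  case (Suc n)
  have "{Inner p w | p w. p \<in> arcs (graph (\<Xi> n)) \<and> w \<in> interior (colour (\<Xi> n) p)} =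
      (\<lambda>(p, w). Inner p w) ` (SIGMA p:arcs (graph (\<Xi> n)). interior (colour (\<Xi> n) p))"
    by force
  moreover have "finite (interior i)" if "i < K" for i using finite_R(2)[OF that] by (simp add: interior_def)
  ultimately show ?case using Suc Xi_arcs(1,2) unfolding verts_Suc by auto
qed (simp add: single_edge_def)

text \<open>\<open>place\<close> tests the plus vertex first; that both ends nevertheless enter
  symmetrically rests on the two planting vertices being distinct.\<close>

lemma place_eq_old:
  assumes "p \<in> arcs (graph (\<Xi> n))" "v \<in> verts (graph (\<Xi> n))"
  shows "place S (\<Xi> n) p w = v \<longleftrightarrow>
    w = beta_plus S (colour (\<Xi> n) p) \<and> tail (graph (\<Xi> n)) p = v \<or>
    w = beta_minus S (colour (\<Xi> n) p) \<and> head (graph (\<Xi> n)) p = v"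
proof -
  have "Inner p w \<noteq> v" using Inner_length assms Xi_arcs(3) by blast
  then show ?thesis using R_props(6) Xi_arcs(2)[OF assms(1)] by (auto simp: place_def)
qed

lemma place_eq_new:
  assumes "p \<in> arcs (graph (\<Xi> n))" "q \<in> arcs (graph (\<Xi> n))" "w \<in> interior (colour (\<Xi> n) q)"
  shows "place S (\<Xi> n) p x = Inner q w \<longleftrightarrow> p = q \<and> x = w"
proof -
  have "tail (graph (\<Xi> n)) p \<noteq> Inner q w" "head (graph (\<Xi> n)) p \<noteq> Inner q w"
    using Inner_length Xi_arcs assms by (metis less_irrefl)+
  then show ?thesis using assms(3) by (auto simp: place_def interior_def)
qed

lemma half_edges_Suc:
  "half_edges (\<Xi> (Suc n)) b v = {e # p | e p. p \<in> arcs (graph (\<Xi> n)) \<and>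
     e \<in> arcs (graph (R (colour (\<Xi> n) p))) \<and> colour (R (colour (\<Xi> n) p)) e = b div 2 \<and>
     place S (\<Xi> n) p (arc_end (R (colour (\<Xi> n) p)) b e) = v}"
  unfolding half_edges_def arcs_Suc
  by (auto simp: colour_Suc arc_end_Suc simp del: Xi.simps)

lemma card_half_edges_new:
  assumes "q \<in> arcs (graph (\<Xi> n))" "w \<in> interior (colour (\<Xi> n) q)"
  shows "card (half_edges (\<Xi> (Suc n)) b (Inner q w)) = card (half_edges (R (colour (\<Xi> n) q)) b w)"
proof -
  have "half_edges (\<Xi> (Suc n)) b (Inner q w) = (\<lambda>e. e # q) ` half_edges (R (colour (\<Xi> n) q)) b w"
    unfolding half_edges_Suc using assms place_eq_new by (auto simp: half_edges_def)
  then show ?thesis by (simp add: card_image inj_on_def)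
qed

lemma finite_half_edges: "finite (half_edges (\<Xi> n) a v)" "i < K \<Longrightarrow> finite (half_edges (R i) a w)"
  using Xi_arcs(1) finite_R by (auto simp: half_edges_def)

text \<open>A half-edge at \<open>v\<close> of coordinate a is replaced by a copy whose vertex
  \<open>beta a\<close> sits on \<open>v\<close>, so it splits into the half-edges at
  \<open>beta a\<close>. This is the multiplication by N on the right.\<close>

lemma card_half_edges_old:
  assumes v: "v \<in> verts (graph (\<Xi> n))"
  shows "card (half_edges (\<Xi> (Suc n)) b v) =
    (\<Sum>a<2 * K. card (half_edges (\<Xi> n) a v) * card (half_edges (R (a div 2)) b (beta a)))"
proof -
  define F where "F a = (\<lambda>(p, e). e # p) ` (half_edges (\<Xi> n) a v \<times> half_edges (R (a div 2)) b (beta a))" for a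
  have "half_edges (\<Xi> (Suc n)) b v \<subseteq> (\<Union>a<2 * K. F a)"
  proof
    fix q assume "q \<in> half_edges (\<Xi> (Suc n)) b v"
    then obtain e p where q: "q = e # p" "p \<in> arcs (graph (\<Xi> n))"
      "e \<in> arcs (graph (R (colour (\<Xi> n) p)))" "colour (R (colour (\<Xi> n) p)) e = b div 2"
      "place S (\<Xi> n) p (arc_end (R (colour (\<Xi> n) p)) b e) = v"
      unfolding half_edges_Suc by blast
    have c: "colour (\<Xi> n) p < K" using Xi_arcs(2) q by blast
    let ?a = "2 * colour (\<Xi> n) p"
    from q(5)[unfolded place_eq_old[OF q(2) v]] have "q \<in> F ?a \<or> q \<in> F (?a + 1)"
      using q(1-4) by (force simp: F_def half_edges_def beta_def arc_end_def[of "\<Xi> n"])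
    moreover have "?a < 2 * K" "?a + 1 < 2 * K" using c by auto
    ultimately show "q \<in> (\<Union>a<2 * K. F a)" by blast
  qed
  moreover have "(\<Union>a<2 * K. F a) \<subseteq> half_edges (\<Xi> (Suc n)) b v"
  proof
    fix q assume "q \<in> (\<Union>a<2 * K. F a)"
    then obtain a p e where q: "a < 2 * K" "q = e # p" "p \<in> half_edges (\<Xi> n) a v"
      "e \<in> half_edges (R (a div 2)) b (beta a)" by (auto simp: F_def)
    have p: "p \<in> arcs (graph (\<Xi> n))" "colour (\<Xi> n) p = a div 2" using q by (auto simp: half_edges_def)
    have "place S (\<Xi> n) p (beta a) = v"
      unfolding place_eq_old[OF p(1) v] using q(3) by (auto simp: half_edges_def beta_def arc_end_def)
    then show "q \<in> half_edges (\<Xi> (Suc n)) b v"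
      unfolding half_edges_Suc using p q by (auto simp: half_edges_def)
  qed
  ultimately have eq: "half_edges (\<Xi> (Suc n)) b v = (\<Union>a<2 * K. F a)" by blast
  \<comment> \<open>A loop at \<open>v\<close> is a half-edge for two coordinates, so p alone does
    not separate them. The end of e does, since it is \<open>beta a\<close> in one case and the
    other planting vertex in the other.\<close>
  have disj: "F a \<inter> F a' = {}" if "a < 2 * K" "a' < 2 * K" "a \<noteq> a'" for a a'
  proof (rule ccontr)
    assume "F a \<inter> F a' \<noteq> {}"
    then obtain p e where pe: "p \<in> half_edges (\<Xi> n) a v" "e \<in> half_edges (R (a div 2)) b (beta a)"
       "p \<in> half_edges (\<Xi> n) a' v" "e \<in> half_edges (R (a' div 2)) b (beta a')"
      by (auto simp: F_def)
    then have d: "a div 2 = a' div 2" by (auto simp: half_edges_def)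
    then have "beta a = beta a'" using pe(2,4) by (simp add: half_edges_def)
    moreover have "a div 2 < K" using that by auto
    ultimately have "even a \<longleftrightarrow> even a'"
      using R_props(6)[of "a div 2"] d by (auto simp: beta_def split: if_splits)
    then show False using d that(3) by (metis div_mult_mod_eq even_iff_mod_2_eq_zero odd_iff_mod_2_eq_one)
  qed
  have finF: "finite (F a)" if "a < 2 * K" for a
    using finite_half_edges(1)[of n a v] finite_half_edges(2)[of "a div 2" b "beta a"] that
    by (auto simp: F_def)
  have cardF: "card (F a) = card (half_edges (\<Xi> n) a v) * card (half_edges (R (a div 2)) b (beta a))" for a
    unfolding F_def by (subst card_image) (auto simp: inj_on_def card_cartesian_product)
  show ?thesis unfolding eq
    by (subst card_UN_disjoint) (use finF disj cardF in auto)
qed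

section \<open>Degree vectors and the degree matrix\<close>

abbreviation "N \<equiv> degree_matrix S"
abbreviation "M \<equiv> mass_matrix S"

lemma N_carrier: "N \<in> carrier_mat (2 * K) (2 * K)"
  by (simp add: degree_matrix_def)

lemma M_carrier: "M \<in> carrier_mat K K"
  by (simp add: mass_matrix_def)

lemma N_index:
  "a < 2 * K \<Longrightarrow> b < 2 * K \<Longrightarrow> N $$ (a, b) = real (card (half_edges (R (a div 2)) b (beta a)))"
  by (simp add: degree_matrix_def beta_def kappa_index)

lemma kappa_Suc:
  assumes "v \<in> verts (graph (\<Xi> n))" "b < 2 * K"
  shows "kappa K (\<Xi> (Suc n)) v $ b = (\<Sum>a<2 * K. kappa K (\<Xi> n) v $ a * N $$ (a, b))"
  using assms by (simp add: kappa_index card_half_edges_old N_index del: Xi.simps)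

lemma kappa_add:
  assumes "v \<in> verts (graph (\<Xi> m))" "b < 2 * K"
  shows "kappa K (\<Xi> (m + n)) v $ b = (\<Sum>a<2 * K. kappa K (\<Xi> m) v $ a * (N ^\<^sub>m n) $$ (a, b))"
  using assms(2)
proof (induction n arbitrary: b)
  case 0
  have "(\<Sum>a<2 * K. kappa K (\<Xi> m) v $ a * (N ^\<^sub>m 0) $$ (a, b)) =
      (\<Sum>a<2 * K. if a = b then kappa K (\<Xi> m) v $ a else 0)"
    using N_carrier 0 by (intro sum.cong) auto
  then show ?case using 0 by simp
next
  case (Suc n)
  have v: "v \<in> verts (graph (\<Xi> (m + n)))" using verts_mono[of m "m + n"] assms(1) by auto
  have "kappa K (\<Xi> (m + Suc n)) v $ b = (\<Sum>c<2 * K. kappa K (\<Xi> (m + n)) v $ c * N $$ (c, b))"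
    using kappa_Suc[OF v Suc.prems] by simp
  also have "\<dots> = (\<Sum>c<2 * K. \<Sum>a<2 * K. kappa K (\<Xi> m) v $ a * ((N ^\<^sub>m n) $$ (a, c) * N $$ (c, b)))"
    using Suc.IH by (intro sum.cong) (auto simp: sum_distrib_right mult.assoc)
  also have "\<dots> = (\<Sum>a<2 * K. kappa K (\<Xi> m) v $ a * (\<Sum>c<2 * K. (N ^\<^sub>m n) $$ (a, c) * N $$ (c, b)))"
    by (subst sum.swap) (simp add: sum_distrib_left)
  also have "\<dots> = (\<Sum>a<2 * K. kappa K (\<Xi> m) v $ a * (N ^\<^sub>m Suc n) $$ (a, b))"
    using N_carrier Suc.prems pow_mat_dim_square[OF N_carrier]
    by (intro sum.cong) (auto simp: scalar_prod_def lessThan_atLeast0)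
  finally show ?case .
qed

lemma deg_Xi: "real (deg (\<Xi> n) v) = (\<Sum>a<2 * K. kappa K (\<Xi> n) v $ a)"
  by (rule deg_eq_sum_kappa) (use Xi_arcs in auto)

text \<open>The l1 norm of u N^n for nonnegative \<open>u\<close>
  (\<open>l1_norm_eq_pushed\<close>), arranged so that the row sums of N^n stand alone.\<close>

definition pushed :: "real vec \<Rightarrow> nat \<Rightarrow> real" where
  "pushed u n = (\<Sum>a<2 * K. u $ a * (\<Sum>b<2 * K. (N ^\<^sub>m n) $$ (a, b)))"

lemma deg_Xi_add:
  assumes "v \<in> verts (graph (\<Xi> m))"
  shows "real (deg (\<Xi> (m + n)) v) = pushed (kappa K (\<Xi> m) v) n"
proof -
  have "real (deg (\<Xi> (m + n)) v) = (\<Sum>b<2 * K. \<Sum>a<2 * K. kappa K (\<Xi> m) v $ a * (N ^\<^sub>m n) $$ (a, b))"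
    unfolding deg_Xi using kappa_add[OF assms] by (intro sum.cong) auto
  also have "\<dots> = pushed (kappa K (\<Xi> m) v) n"
    unfolding pushed_def sum_distrib_left by (rule sum.swap)
  finally show ?thesis .
qed

section \<open>Occurring colours and birth types\<close>

lemma card_coloured_arcs:
  "k < K \<Longrightarrow> real (card {p \<in> arcs (graph (\<Xi> n)). colour (\<Xi> n) p = k}) = (M ^\<^sub>m n) $$ (\<iota>, k)"
proof (induction n arbitrary: k)
  case 0
  then show ?case using M_carrier iota by (auto simp: single_edge_def)
next
  case (Suc n)
  let ?A = "\<lambda>i. {p \<in> arcs (graph (\<Xi> n)). colour (\<Xi> n) p = i}"
  let ?E = "\<lambda>i. {e \<in> arcs (graph (R i)). colour (R i) e = k}"
  have eq: "{p \<in> arcs (graph (\<Xi> (Suc n))). colour (\<Xi> (Suc n)) p = k} =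
      (\<Union>i<K. (\<lambda>(p, e). e # p) ` (?A i \<times> ?E i))"
    unfolding arcs_Suc using Xi_arcs(2) by (fastforce simp: colour_Suc simp del: Xi.simps)
  have "card {p \<in> arcs (graph (\<Xi> (Suc n))). colour (\<Xi> (Suc n)) p = k} =
      (\<Sum>i<K. card ((\<lambda>(p, e). e # p) ` (?A i \<times> ?E i)))"
    unfolding eq using Xi_arcs(1) finite_R by (intro card_UN_disjoint) auto
  also have "\<dots> = (\<Sum>i<K. card (?A i) * card (?E i))"
    by (intro sum.cong refl, subst card_image) (auto simp: inj_on_def card_cartesian_product)
  finally have "real (card {p \<in> arcs (graph (\<Xi> (Suc n))). colour (\<Xi> (Suc n)) p = k}) =
      (\<Sum>i<K. (M ^\<^sub>m n) $$ (\<iota>, i) * M $$ (i, k))"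
    using Suc by (simp add: mass_matrix_def)
  also have "\<dots> = (M ^\<^sub>m Suc n) $$ (\<iota>, k)"
    using M_carrier Suc.prems iota pow_mat_dim_square[OF M_carrier]
    by (auto simp: scalar_prod_def lessThan_atLeast0)
  finally show ?case .
qed

text \<open>Entries of M^n count edges by colour, so a positive entry means that such an edge
  occurs. This ties the algebraic definition of \<open>birth_types\<close> to the graphs.\<close>

lemma reachable_colour_iff:
  "j \<in> reachable_indices M \<iota> \<longleftrightarrow> (\<exists>n. \<exists>p\<in>arcs (graph (\<Xi> n)). colour (\<Xi> n) p = j)"
proof -
  have "(M ^\<^sub>m n) $$ (\<iota>, j) > 0 \<longleftrightarrow> (\<exists>p\<in>arcs (graph (\<Xi> n)). colour (\<Xi> n) p = j)" if "j < K" for n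
    unfolding card_coloured_arcs[OF that, symmetric] using Xi_arcs(1)[of n]
    by (auto simp: card_gt_0_iff)
  then show ?thesis
    using M_carrier Xi_arcs(2) by (auto simp: reachable_indices_def reaches_def)
qed

lemma kappa_new:
  assumes "p \<in> arcs (graph (\<Xi> n))" "w \<in> interior (colour (\<Xi> n) p)"
  shows "kappa K (\<Xi> (Suc n)) (Inner p w) = kappa K (R (colour (\<Xi> n) p)) w"
  by (rule eq_vecI) (use card_half_edges_new[OF assms] in \<open>auto simp: kappa_index simp del: Xi.simps\<close>)

lemma birth_gen_mem: "v \<in> Xi_verts S \<iota> \<Longrightarrow> v \<in> verts (graph (\<Xi> (birth_gen S \<iota> v)))"
  unfolding birth_gen_def Xi_verts_def by (rule LeastI_ex) auto

lemma birth_gen_le: "v \<in> verts (graph (\<Xi> n)) \<Longrightarrow> birth_gen S \<iota> v \<le> n"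
  unfolding birth_gen_def by (rule Least_le)

lemma birth_types_eq:
  "birth_types S \<iota> = kappa K (\<Xi> 0) ` verts (graph (\<Xi> 0)) \<union>
     (\<Union>j\<in>reachable_indices M \<iota>. kappa K (R j) ` interior j)"
  by (simp add: birth_types_def interior_def)

lemma birth_type_mem:
  assumes "v \<in> Xi_verts S \<iota>"
  shows "birth_type S \<iota> v \<in> birth_types S \<iota>"
proof (cases "birth_gen S \<iota> v")
  case 0
  then show ?thesis using birth_gen_mem[OF assms] unfolding birth_types_eq birth_type_def by auto
next
  case (Suc n)
  then have "v \<notin> verts (graph (\<Xi> n))" using birth_gen_le[of v n] by auto
  then obtain p w where pw: "v = Inner p w" "p \<in> arcs (graph (\<Xi> n))" "w \<in> interior (colour (\<Xi> n) p)"
    using birth_gen_mem[OF assms] unfolding Suc verts_Suc by blast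
  then have "birth_type S \<iota> v = kappa K (R (colour (\<Xi> n) p)) w"
    using kappa_new unfolding birth_type_def Suc by blast
  moreover have "colour (\<Xi> n) p \<in> reachable_indices M \<iota>"
    using pw reachable_colour_iff by blast
  ultimately show ?thesis using pw unfolding birth_types_eq by blast
qed

text \<open>The lower bound for the maximum degree needs every listed type to occur. An edge of
  reachable colour receives a copy, and by \<open>Inner_length\<close> the inner vertices of that
  copy are born exactly then.\<close>

lemma birth_type_realised:
  assumes "u \<in> birth_types S \<iota>"
  obtains v where "v \<in> Xi_verts S \<iota>" "birth_type S \<iota> v = u"
proof -
  consider v where "v \<in> verts (graph (\<Xi> 0))" "u = kappa K (\<Xi> 0) v"
    | j w where "j \<in> reachable_indices M \<iota>" "w \<in> interior j" "u = kappa K (R j) w"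
    using assms unfolding birth_types_eq by blast
  then show ?thesis
  proof cases
    case 1
    then have "birth_gen S \<iota> v = 0" using birth_gen_le[of v 0] by simp
    then show ?thesis using that[of v] 1 unfolding Xi_verts_def birth_type_def by (metis UN_iff UNIV_I)
  next
    case 2
    then obtain n p where p: "p \<in> arcs (graph (\<Xi> n))" "colour (\<Xi> n) p = j"
      using reachable_colour_iff by blast
    define v where "v = Inner p w"
    have v: "v \<in> verts (graph (\<Xi> (Suc n)))" using p 2 unfolding verts_Suc v_def by blast
    then have vX: "v \<in> Xi_verts S \<iota>" unfolding Xi_verts_def by blast
    have "birth_gen S \<iota> v > n"
      using Inner_length[of p w "birth_gen S \<iota> v"] birth_gen_mem[OF vX] Xi_arcs(3)[OF p(1)]
      by (simp add: v_def)
    with birth_gen_le[OF v] have "birth_gen S \<iota> v = Suc n" by simp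
    then have "birth_type S \<iota> v = u" using kappa_new[OF p(1)] p 2 unfolding birth_type_def v_def by simp
    with vX that show ?thesis by blast
  qed
qed

lemma finite_birth_types: "finite (birth_types S \<iota>)"
proof -
  have "finite (reachable_indices M \<iota>)" by (simp add: reachable_indices_def)
  moreover have "finite (interior j)" if "j \<in> reachable_indices M \<iota>" for j
    using that M_carrier finite_R(2)[of j] by (auto simp: reachable_indices_def interior_def)
  ultimately show ?thesis unfolding birth_types_eq
    using finite_verts[of 0] by (auto simp del: Xi.simps)
qed

lemma birth_types_ne: "birth_types S \<iota> \<noteq> {}"
  unfolding birth_types_eq by (simp add: single_edge_def)

text \<open>A positive coordinate keeps the set under the \<open>Max\<close> in
  \<open>growth\<close> nonempty.\<close>

lemma birth_types_props:
  assumes "u \<in> birth_types S \<iota>"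
  shows "dim_vec u = 2 * K" "\<And>a. a < 2 * K \<Longrightarrow> u $ a \<ge> 0" "\<exists>a<2 * K. u $ a > 0"
proof -
  consider v where "v \<in> verts (graph (\<Xi> 0))" "u = kappa K (\<Xi> 0) v"
    | j w where "j \<in> reachable_indices M \<iota>" "w \<in> interior j" "u = kappa K (R j) w"
    using assms unfolding birth_types_eq by blast
  note cases = this
  then show "dim_vec u = 2 * K" by cases auto
  from cases show "u $ a \<ge> 0" if "a < 2 * K" for a using that by cases (auto simp: kappa_index)
  from cases show "\<exists>a<2 * K. u $ a > 0"
  proof cases
    case 1
    \<comment> \<open>The only arc of generation 0 leaves \<open>Seed_tail\<close> and enters
      \<open>Seed_head\<close>.\<close>
    then have "[] \<in> half_edges (\<Xi> 0) (if v = Seed_tail then 2 * \<iota> else 2 * \<iota> + 1) v"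
      by (auto simp: half_edges_def arc_end_def single_edge_def)
    moreover have "(if v = Seed_tail then 2 * \<iota> else 2 * \<iota> + 1) < 2 * K" using iota by auto
    ultimately show ?thesis using 1(2) finite_half_edges(1) kappa_index
      by (metis card_gt_0_iff empty_iff of_nat_0_less_iff)
  next
    case 2
    then have j: "j < K" "w \<in> verts (graph (R j))"
      using M_carrier by (auto simp: reachable_indices_def interior_def)
    obtain a where a: "a < 2 * K" "half_edges (R j) a w \<noteq> {}" using R_vertex_half_edge[OF j] .
    then have "u $ a > 0" using finite_half_edges(2)[OF j(1)] 2(3) by (simp add: kappa_index card_gt_0_iff)
    with a show ?thesis by blast
  qed
qed

section \<open>Monotonicity of degrees in time\<close>

lemma N_row_sum_ge_1:
  assumes "a < 2 * K"
  shows "(\<Sum>b<2 * K. N $$ (a, b)) \<ge> 1"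
proof -
  have i: "a div 2 < K" using assms by auto
  then have "beta a \<in> verts (graph (R (a div 2)))" using R_props by (auto simp: beta_def)
  then obtain b where b: "b < 2 * K" "half_edges (R (a div 2)) b (beta a) \<noteq> {}"
    using R_vertex_half_edge[OF i] by blast
  then have "card (half_edges (R (a div 2)) b (beta a)) \<ge> 1"
    using finite_half_edges(2)[OF i] by (simp add: Suc_leI card_gt_0_iff)
  then have "1 \<le> N $$ (a, b)" using assms b N_index by simp
  also have "\<dots> \<le> (\<Sum>b<2 * K. N $$ (a, b))"
    using b assms N_index by (intro member_le_sum) auto
  finally show ?thesis .
qed

lemma N_nonneg: "a < 2 * K \<Longrightarrow> b < 2 * K \<Longrightarrow> N $$ (a, b) \<ge> 0"
  by (simp add: N_index)

lemma N_pow_nonneg: "a < 2 * K \<Longrightarrow> b < 2 * K \<Longrightarrow> (N ^\<^sub>m n) $$ (a, b) \<ge> 0"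
  using pow_mat_restricted_power[OF N_carrier, of id "{..<2 * K}" "\<lambda>a b. N $$ (a, b)" a b n]
    restricted_power_nonneg[of "{..<2 * K}" "\<lambda>a b. N $$ (a, b)" a b n] N_nonneg
  by simp

lemma pushed_mono:
  assumes "\<And>a. a < 2 * K \<Longrightarrow> u $ a \<ge> 0" "m \<le> n"
  shows "pushed u m \<le> pushed u n"
proof -
  have "(\<Sum>b<2 * K. (N ^\<^sub>m n) $$ (a, b)) \<le> (\<Sum>b<2 * K. (N ^\<^sub>m Suc n) $$ (a, b))" if a: "a < 2 * K" for a n
  proof -
    have "(\<Sum>b<2 * K. (N ^\<^sub>m Suc n) $$ (a, b)) = (\<Sum>b<2 * K. \<Sum>c<2 * K. (N ^\<^sub>m n) $$ (a, c) * N $$ (c, b))"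
      using N_carrier a pow_mat_dim_square[OF N_carrier]
      by (intro sum.cong) (auto simp: scalar_prod_def lessThan_atLeast0)
    also have "\<dots> = (\<Sum>c<2 * K. (N ^\<^sub>m n) $$ (a, c) * (\<Sum>b<2 * K. N $$ (c, b)))"
      by (subst sum.swap) (simp add: sum_distrib_left)
    \<comment> \<open>N maps the all-ones vector to a vector above it, and the nonnegative N^n
      preserves this order.\<close>
    also have "\<dots> \<ge> (\<Sum>c<2 * K. (N ^\<^sub>m n) $$ (a, c) * 1)"
      using N_row_sum_ge_1 N_pow_nonneg a by (intro sum_mono mult_left_mono) auto
    finally show ?thesis by simp
  qed
  then have "pushed u n \<le> pushed u (Suc n)" for n
    unfolding pushed_def using assms(1) by (intro sum_mono, intro mult_left_mono) auto
  then show ?thesis using assms(2) by (rule lift_Suc_mono_le)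
qed

lemma l1_norm_eq_pushed:
  assumes "dim_vec u = 2 * K" "\<And>a. a < 2 * K \<Longrightarrow> u $ a \<ge> 0"
  shows "l1_norm (row (mat_of_row u * N ^\<^sub>m n) 0) = pushed u n"
proof -
  have "l1_norm (row (mat_of_row u * N ^\<^sub>m n) 0) = (\<Sum>b<2 * K. \<bar>\<Sum>a<2 * K. u $ a * (N ^\<^sub>m n) $$ (a, b)\<bar>)"
    using assms(1) N_carrier pow_mat_dim_square[OF N_carrier]
    unfolding l1_norm_def by (auto simp: scalar_prod_def lessThan_atLeast0 intro!: sum.cong)
  also have "\<dots> = (\<Sum>b<2 * K. \<Sum>a<2 * K. u $ a * (N ^\<^sub>m n) $$ (a, b))"
    using assms(2) N_pow_nonneg by (intro sum.cong refl abs_of_nonneg sum_nonneg) auto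
  also have "\<dots> = pushed u n" unfolding pushed_def sum_distrib_left by (rule sum.swap)
  finally show ?thesis .
qed

lemma max_deg_eq: "real (max_deg (\<Xi> n)) = Max ((\<lambda>v. real (deg (\<Xi> n) v)) ` verts (graph (\<Xi> n)))"
proof -
  have ne: "verts (graph (\<Xi> n)) \<noteq> {}" using verts_mono[of 0 n] by (auto simp: single_edge_def)
  have "real (Max A) = Max (real ` A)" if "finite A" "A \<noteq> {}" for A
    by (rule mono_Max_commute) (use that in \<open>auto simp: mono_def\<close>)
  then show ?thesis unfolding max_deg_def using finite_verts ne by (simp add: image_image)
qed

end

section \<open>Asymptotics of the maximum degree\<close>

lemma tendsto_Max_image:
  fixes f :: "'i \<Rightarrow> nat \<Rightarrow> real"
  assumes "finite A" "A \<noteq> {}" "\<And>i. i \<in> A \<Longrightarrow> f i \<longlonglongrightarrow> l i"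
  shows "(\<lambda>n. Max ((\<lambda>i. f i n) ` A)) \<longlonglongrightarrow> Max (l ` A)"
  using assms by (induction rule: finite_ne_induct) (auto intro!: tendsto_max)

lemma Max_divide:
  fixes x :: real
  assumes "finite A" "A \<noteq> {}" "x > 0"
  shows "Max (f ` A) / x = Max ((\<lambda>i. f i / x) ` A)"
  using mono_Max_commute[of "\<lambda>y. y / x" "f ` A"] assms
  by (auto simp: mono_def divide_right_mono image_image)

lemma grows_cong:
  assumes "grows f c k l" "eventually (\<lambda>n. f n = g n) sequentially"
  shows "grows g c k l"
  using assms(1) unfolding grows_def
  by (rule Lim_transform_eventually) (use assms(2) in \<open>auto elim: eventually_mono\<close>)

lemma grows_Max:
  assumes "finite A" "A \<noteq> {}" "l > 0" "\<And>i. i \<in> A \<Longrightarrow> grows (f i) (c i) k l"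
  shows "grows (\<lambda>n. Max ((\<lambda>i. f i n) ` A)) (Max (c ` A)) k l"
  using tendsto_Max_image[OF assms(1,2), of "\<lambda>i n. f i n / (real (Suc n) ^ k * l ^ n)" c] assms
  unfolding grows_def by (subst Max_divide) (simp_all del: of_nat_Suc)

lemma grows_ratio:
  assumes "grows f c k l" "grows g d k l" "d \<noteq> 0" "l > 0"
  shows "(\<lambda>n. f n / g n) \<longlonglongrightarrow> c / d"
proof -
  have "(\<lambda>n. (f n / (real (Suc n) ^ k * l ^ n)) / (g n / (real (Suc n) ^ k * l ^ n))) \<longlonglongrightarrow> c / d"
    using assms unfolding grows_def by (intro tendsto_divide)
  then show ?thesis using assms(4) by (simp del: of_nat_Suc)
qed

locale primitive_eigs = edge_igs S \<iota> for S :: "('v, 'e) eigs" and \<iota> +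
  assumes prim_N: "primitive_frobenius (degree_matrix S)"
begin

sublocale PB: primitive_blocks N "2 * K"
  by unfold_locales (use N_carrier N_nonneg prim_N in auto)

lemma pushed_eq: "pushed u n = (\<Sum>a<2 * K. u $ a * PB.row_sum a n)"
  by (simp add: pushed_def PB.row_sum_def)

section \<open>Growth of a single birth type\<close>

lemma growth_tau_props:
  assumes "dim_vec u = 2 * K" "\<exists>a<2 * K. u $ a > 0"
  shows "growth S u > 0" "tau S u \<ge> 1"
    "\<And>a. a < 2 * K \<Longrightarrow> u $ a > 0 \<Longrightarrow> max_radius N a \<le> growth S u"
    "\<And>a. a < 2 * K \<Longrightarrow> u $ a > 0 \<Longrightarrow> max_radius N a = growth S u \<Longrightarrow> varkappa N a \<le> tau S u"
    "\<exists>a<2 * K. u $ a > 0 \<and> max_radius N a = growth S u \<and> varkappa N a = tau S u"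
proof -
  let ?A = "{max_radius N a | a. a < dim_vec u \<and> u $ a > 0}"
  let ?B = "{varkappa N a | a. a < dim_vec u \<and> u $ a > 0 \<and> max_radius N a = growth S u}"
  show le: "max_radius N a \<le> growth S u" if "a < 2 * K" "u $ a > 0" for a
    unfolding growth_def by (rule Max_ge) (use that assms in auto)
  show "varkappa N a \<le> tau S u" if "a < 2 * K" "u $ a > 0" "max_radius N a = growth S u" for a
    unfolding tau_def by (rule Max_ge) (use that assms in auto)
  have "growth S u \<in> ?A" unfolding growth_def by (rule Max_in) (use assms in auto)
  then have "?B \<noteq> {}" by auto
  then have "tau S u \<in> ?B" unfolding tau_def by (intro Max_in) auto
  then show *: "\<exists>a<2 * K. u $ a > 0 \<and> max_radius N a = growth S u \<and> varkappa N a = tau S u"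
    using assms by auto
  then show "growth S u > 0" "tau S u \<ge> 1" using PB.max_radius_pos PB.varkappa_pos by metis+
qed

text \<open>Each coordinate is viewed at the scale of \<open>u\<close>: one with smaller radius, or
  equal radius and smaller \<open>varkappa\<close>, has limit 0, and some positive coordinate
  attains both maxima.\<close>

lemma pushed_grows:
  assumes "dim_vec u = 2 * K" "\<And>a. a < 2 * K \<Longrightarrow> u $ a \<ge> 0" "\<exists>a<2 * K. u $ a > 0"
  shows "\<exists>c>0. grows (pushed u) c (tau S u - 1) (growth S u)"
proof -
  note gt = growth_tau_props[OF assms(1,3)]
  have "\<exists>c\<ge>0. grows (\<lambda>n. u $ a * PB.row_sum a n) c (tau S u - 1) (growth S u) \<and>
      (u $ a > 0 \<and> max_radius N a = growth S u \<and> varkappa N a = tau S u \<longrightarrow> c > 0)"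
    if a: "a < 2 * K" for a
  proof (cases "u $ a = 0")
    case True
    then show ?thesis by (intro exI[of _ 0]) (auto simp: grows_def)
  next
    case False
    then have ua: "u $ a > 0" using assms(2)[OF a] by simp
    obtain C where C: "C > 0" "grows (PB.row_sum a) C (varkappa N a - 1) (max_radius N a)"
      using PB.row_sum_grows[OF a] by blast
    have le: "max_radius N a \<le> growth S u" using gt(3)[OF a ua] .
    show ?thesis
    proof (cases "max_radius N a = growth S u \<and> varkappa N a = tau S u")
      case True
      then show ?thesis using C ua grows_cmult[OF C(2), of "u $ a"]
        by (intro exI[of _ "u $ a * C"]) auto
    next
      case False
      have "varkappa N a \<ge> 1" using PB.varkappa_pos a by simp
      then have "grows (PB.row_sum a) 0 (tau S u - 1) (growth S u)"
        using False le gt(4)[OF a ua] PB.max_radius_pos[OF a]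
        by (intro grows_weaken[OF C(2)]) linarith+
      from grows_cmult[OF this, of "u $ a"] show ?thesis using False by (intro exI[of _ 0]) auto
    qed
  qed
  then obtain f where f: "\<And>a. a < 2 * K \<Longrightarrow> f a \<ge> 0 \<and>
      grows (\<lambda>n. u $ a * PB.row_sum a n) (f a) (tau S u - 1) (growth S u) \<and>
      (u $ a > 0 \<and> max_radius N a = growth S u \<and> varkappa N a = tau S u \<longrightarrow> f a > 0)"
    by metis
  have "grows (pushed u) (\<Sum>a<2 * K. f a) (tau S u - 1) (growth S u)"
    unfolding pushed_eq[abs_def] by (rule grows_sum) (use f in auto)
  moreover obtain a where "a < 2 * K" "f a > 0" using gt(5) f by blast
  then have "(\<Sum>a<2 * K. f a) > 0" using f by (intro sum_pos2[of _ a]) auto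
  ultimately show ?thesis by blast
qed

text \<open>The description in \<open>c_deg\<close> denotes: existence is
  \<open>pushed_grows\<close>, and a second constant would be another limit of the same normalised
  sequence.\<close>

lemma c_deg_props:
  assumes u: "u \<in> birth_types S \<iota>"
  shows "c_deg S u > 0" "grows (pushed u) (c_deg S u) (tau S u - 1) (growth S u)"
proof -
  note p = birth_types_props[OF u]
  have g: "growth S u > 0" using growth_tau_props(1)[OF p(1,3)] .
  obtain c where c: "c > 0" "grows (pushed u) c (tau S u - 1) (growth S u)"
    using pushed_grows[OF p] by blast
  have eq: "c_deg S u = (THE c. c > 0 \<and>
      pushed u \<sim>[sequentially] (\<lambda>n. c * real n ^ (tau S u - 1) * growth S u ^ n))"
    by (simp add: c_deg_def l1_norm_eq_pushed[OF p(1,2)])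
  have "c_deg S u = c"
    unfolding eq
  proof (rule the_equality)
    show "c > 0 \<and> pushed u \<sim>[sequentially] (\<lambda>n. c * real n ^ (tau S u - 1) * growth S u ^ n)"
      using c g grows_asymp_equiv by blast
    show "c' = c"
      if "c' > 0 \<and> pushed u \<sim>[sequentially] (\<lambda>n. c' * real n ^ (tau S u - 1) * growth S u ^ n)" for c'
      using that asymp_equiv_grows g c(2) grows_unique by blast
  qed
  with c show "c_deg S u > 0" "grows (pushed u) (c_deg S u) (tau S u - 1) (growth S u)" by auto
qed

section \<open>The common scale of all birth types\<close>

definition dominant :: "real vec \<Rightarrow> bool" where
  "dominant u \<longleftrightarrow> growth S u = max_growth S \<iota> \<and> tau S u = tau_deg S \<iota>"

text \<open>The limit of \<open>pushed u\<close> at the scale of the dominant types; all other types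
  are of lower order, hence the 0.\<close>

definition limit_weight :: "real vec \<Rightarrow> real" where
  "limit_weight u = (if dominant u then c_deg S u else 0)"

lemma max_growth_props:
  shows "\<And>u. u \<in> birth_types S \<iota> \<Longrightarrow> growth S u \<le> max_growth S \<iota>"
    "\<And>u. u \<in> birth_types S \<iota> \<Longrightarrow> growth S u = max_growth S \<iota> \<Longrightarrow> tau S u \<le> tau_deg S \<iota>"
    "\<exists>u\<in>birth_types S \<iota>. dominant u"
    "max_growth S \<iota> > 0"
proof -
  let ?B = "{tau S u | u. u \<in> birth_types S \<iota> \<and> growth S u = max_growth S \<iota>}"
  have fin: "finite ?B" using finite_birth_types by auto
  show "growth S u \<le> max_growth S \<iota>" if "u \<in> birth_types S \<iota>" for u
    unfolding max_growth_def using finite_birth_types that by auto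
  show "tau S u \<le> tau_deg S \<iota>" if "u \<in> birth_types S \<iota>" "growth S u = max_growth S \<iota>" for u
    unfolding tau_deg_def using fin that by (intro Max_ge) auto
  have "max_growth S \<iota> \<in> growth S ` birth_types S \<iota>"
    unfolding max_growth_def using finite_birth_types birth_types_ne by (intro Max_in) auto
  then have "?B \<noteq> {}" by auto
  with fin have "tau_deg S \<iota> \<in> ?B" unfolding tau_deg_def by (intro Max_in)
  then show *: "\<exists>u\<in>birth_types S \<iota>. dominant u" by (auto simp: dominant_def)
  then show "max_growth S \<iota> > 0"
    using growth_tau_props(1) birth_types_props(1,3) unfolding dominant_def by metis
qed

lemma pushed_grows_limit_weight:
  assumes u: "u \<in> birth_types S \<iota>"
  shows "grows (pushed u) (limit_weight u) (tau_deg S \<iota> - 1) (max_growth S \<iota>)"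
proof (cases "dominant u")
  case True
  then show ?thesis using c_deg_props(2)[OF u] by (simp add: limit_weight_def dominant_def)
next
  case False
  note p = birth_types_props[OF u]
  note gt = growth_tau_props(1,2)[OF p(1,3)]
  have "grows (pushed u) 0 (tau_deg S \<iota> - 1) (max_growth S \<iota>)"
    using False max_growth_props(1,2)[OF u] gt unfolding dominant_def
    by (intro grows_weaken[OF c_deg_props(2)[OF u]]) linarith+
  then show ?thesis using False by (simp add: limit_weight_def)
qed

definition first_gen :: "real vec \<Rightarrow> nat" where
  "first_gen u = (LEAST m. \<exists>v\<in>Xi_verts S \<iota>. birth_type S \<iota> v = u \<and> birth_gen S \<iota> v = m)"

lemma first_gen_attained:
  assumes "u \<in> birth_types S \<iota>"
  obtains v where "v \<in> Xi_verts S \<iota>" "birth_type S \<iota> v = u" "birth_gen S \<iota> v = first_gen u"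
proof -
  have "\<exists>v\<in>Xi_verts S \<iota>. birth_type S \<iota> v = u \<and> birth_gen S \<iota> v = first_gen u"
    unfolding first_gen_def by (rule LeastI_ex) (use birth_type_realised[OF assms] in metis)
  then show ?thesis using that by blast
qed

lemma first_gen_le: "v \<in> Xi_verts S \<iota> \<Longrightarrow> first_gen (birth_type S \<iota> v) \<le> birth_gen S \<iota> v"
  unfolding first_gen_def by (rule Least_le) auto

lemma deg_eq_pushed:
  assumes "v \<in> Xi_verts S \<iota>" "birth_gen S \<iota> v \<le> n"
  shows "real (deg (\<Xi> n) v) = pushed (birth_type S \<iota> v) (n - birth_gen S \<iota> v)"
  using deg_Xi_add[OF birth_gen_mem[OF assms(1)], of "n - birth_gen S \<iota> v"] assms(2)
  by (simp add: birth_type_def)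

text \<open>Since \<open>pushed u\<close> is nondecreasing, among the vertices of a given birth type the oldest ones
  have the largest degree; so the maximum runs over a fixed finite set.\<close>

lemma max_deg_eq_Max:
  assumes n: "\<And>u. u \<in> birth_types S \<iota> \<Longrightarrow> first_gen u \<le> n"
  shows "real (max_deg (\<Xi> n)) = Max ((\<lambda>u. pushed u (n - first_gen u)) ` birth_types S \<iota>)"
  unfolding max_deg_eq
proof (rule antisym)
  have ne: "verts (graph (\<Xi> n)) \<noteq> {}" using verts_mono[of 0 n] by (auto simp: single_edge_def)
  show "Max ((\<lambda>v. real (deg (\<Xi> n) v)) ` verts (graph (\<Xi> n)))
      \<le> Max ((\<lambda>u. pushed u (n - first_gen u)) ` birth_types S \<iota>)"
  proof (rule Max.boundedI)
    fix x assume "x \<in> (\<lambda>v. real (deg (\<Xi> n) v)) ` verts (graph (\<Xi> n))"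
    then obtain v where v: "v \<in> verts (graph (\<Xi> n))" "x = real (deg (\<Xi> n) v)" by blast
    then have vX: "v \<in> Xi_verts S \<iota>" by (auto simp: Xi_verts_def)
    let ?u = "birth_type S \<iota> v"
    have "x = pushed ?u (n - birth_gen S \<iota> v)"
      using deg_eq_pushed[OF vX birth_gen_le[OF v(1)]] v(2) by simp
    also have "\<dots> \<le> pushed ?u (n - first_gen ?u)"
      using first_gen_le[OF vX] birth_types_props(2)[OF birth_type_mem[OF vX]] by (intro pushed_mono) auto
    also have "\<dots> \<le> Max ((\<lambda>u. pushed u (n - first_gen u)) ` birth_types S \<iota>)"
      using finite_birth_types birth_type_mem[OF vX] by (intro Max_ge) auto
    finally show "x \<le> Max ((\<lambda>u. pushed u (n - first_gen u)) ` birth_types S \<iota>)" .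
  qed (use finite_verts ne in auto)
  show "Max ((\<lambda>u. pushed u (n - first_gen u)) ` birth_types S \<iota>)
      \<le> Max ((\<lambda>v. real (deg (\<Xi> n) v)) ` verts (graph (\<Xi> n)))"
  proof (rule Max.boundedI)
    fix x assume "x \<in> (\<lambda>u. pushed u (n - first_gen u)) ` birth_types S \<iota>"
    then obtain u where u: "u \<in> birth_types S \<iota>" "x = pushed u (n - first_gen u)" by blast
    obtain v where v: "v \<in> Xi_verts S \<iota>" "birth_type S \<iota> v = u" "birth_gen S \<iota> v = first_gen u"
      using first_gen_attained[OF u(1)] .
    have le: "birth_gen S \<iota> v \<le> n" using v(3) n[OF u(1)] by simp
    have "v \<in> verts (graph (\<Xi> n))" using birth_gen_mem[OF v(1)] verts_mono[OF le] by blast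
    moreover have "x = real (deg (\<Xi> n) v)" using deg_eq_pushed[OF v(1) le] u v by simp
    ultimately show "x \<le> Max ((\<lambda>v. real (deg (\<Xi> n) v)) ` verts (graph (\<Xi> n)))"
      using finite_verts by (intro Max_ge) auto
  qed (use finite_birth_types birth_types_ne in auto)
qed

text \<open>The oldest vertex of type u is delayed by \<open>first_gen u\<close> generations, which
  divides its leading constant by that power of \<Lambda>. The maximum passes to the limit because
  the set of types is finite.\<close>

definition C_deg :: real where
  "C_deg = Max ((\<lambda>u. limit_weight u / max_growth S \<iota> ^ first_gen u) ` birth_types S \<iota>)"

lemma C_deg_pos: "C_deg > 0"
proof -
  obtain u where u: "u \<in> birth_types S \<iota>" "dominant u" using max_growth_props(3) by blast
  then have "0 < limit_weight u / max_growth S \<iota> ^ first_gen u"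
    using c_deg_props(1) max_growth_props(4) by (simp add: limit_weight_def)
  also have "\<dots> \<le> C_deg" unfolding C_deg_def using finite_birth_types u by (intro Max_ge) auto
  finally show ?thesis .
qed

lemma max_deg_grows:
  "grows (\<lambda>n. real (max_deg (\<Xi> n))) C_deg (tau_deg S \<iota> - 1) (max_growth S \<iota>)"
proof (rule grows_cong)
  show "grows (\<lambda>n. Max ((\<lambda>u. pushed u (n - first_gen u)) ` birth_types S \<iota>))
      C_deg (tau_deg S \<iota> - 1) (max_growth S \<iota>)"
    unfolding C_deg_def
    by (intro grows_Max grows_shift pushed_grows_limit_weight finite_birth_types birth_types_ne max_growth_props(4))
  \<comment> \<open>Eventually every type has been born, as \<open>max_deg_eq_Max\<close>
    requires.\<close>
  have "\<forall>\<^sub>F n in sequentially. \<forall>u\<in>birth_types S \<iota>. first_gen u \<le> n"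
    by (intro eventually_ball_finite finite_birth_types ballI eventually_ge_at_top)
  then show "\<forall>\<^sub>F n in sequentially.
      Max ((\<lambda>u. pushed u (n - first_gen u)) ` birth_types S \<iota>) = real (max_deg (\<Xi> n))"
    by eventually_elim (use max_deg_eq_Max in auto)
qed

text \<open>Degree and maximum degree are compared at the same scale, so the limit is the quotient
  of their constants. It is 0 for a non-dominant type because \<open>limit_weight\<close>
  is.\<close>

lemma deg_ratio_tendsto:
  assumes v: "v \<in> Xi_verts S \<iota>"
  shows "deg_ratio S \<iota> v \<longlonglongrightarrow>
    limit_weight (birth_type S \<iota> v) / max_growth S \<iota> ^ birth_gen S \<iota> v / C_deg"
  unfolding deg_ratio_def[abs_def]
proof (rule grows_ratio[OF grows_cong max_deg_grows])
  show "grows (\<lambda>n. pushed (birth_type S \<iota> v) (n - birth_gen S \<iota> v))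
      (limit_weight (birth_type S \<iota> v) / max_growth S \<iota> ^ birth_gen S \<iota> v) (tau_deg S \<iota> - 1) (max_growth S \<iota>)"
    using birth_type_mem[OF v] max_growth_props(4) by (intro grows_shift pushed_grows_limit_weight)
  show "\<forall>\<^sub>F n in sequentially. pushed (birth_type S \<iota> v) (n - birth_gen S \<iota> v) = real (deg (\<Xi> n) v)"
    using eventually_ge_at_top[of "birth_gen S \<iota> v"] by eventually_elim (use deg_eq_pushed[OF v] in auto)
qed (use C_deg_pos max_growth_props(4) in auto)

end

theorem theorem4p4:
  fixes S :: "('v, 'e) eigs" and \<iota> :: nat
  assumes "is_eigs S"
    and "\<iota> < num_colours S"
    and "primitive_frobenius (degree_matrix S)"
    and "primitive_frobenius (mass_matrix S)"
    and "max_growth S \<iota> > 1"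
  shows "(\<forall>v \<in> Xi_verts S \<iota>. convergent (deg_ratio S \<iota> v)) \<and>
    (\<exists>C :: real. C > 0 \<and>
      (\<lambda>n. real (max_deg (Xi S \<iota> n))) \<sim>[sequentially]
        (\<lambda>n. C * real n ^ (tau_deg S \<iota> - 1) * max_growth S \<iota> ^ n) \<and>
      (\<forall>v \<in> Xi_verts S \<iota>.
        deg_hat S \<iota> v =
          (if growth S (birth_type S \<iota> v) = max_growth S \<iota> \<and>
              tau S (birth_type S \<iota> v) = tau_deg S \<iota>
           then c_deg S (birth_type S \<iota> v) / C * inverse (max_growth S \<iota> ^ birth_gen S \<iota> v)
           else 0)))"
proof -
  interpret primitive_eigs S \<iota>
    using assms by unfold_locales
  show ?thesis
  proof (intro conjI exI[of _ C_deg] ballI)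
    show "convergent (deg_ratio S \<iota> v)" if "v \<in> Xi_verts S \<iota>" for v
      using deg_ratio_tendsto[OF that] by (rule convergentI)
    show "(\<lambda>n. real (max_deg (Xi S \<iota> n))) \<sim>[sequentially]
        (\<lambda>n. C_deg * real n ^ (tau_deg S \<iota> - 1) * max_growth S \<iota> ^ n)"
      by (rule grows_asymp_equiv[OF max_deg_grows C_deg_pos max_growth_props(4)])
    show "deg_hat S \<iota> v =
          (if growth S (birth_type S \<iota> v) = max_growth S \<iota> \<and>
              tau S (birth_type S \<iota> v) = tau_deg S \<iota>
           then c_deg S (birth_type S \<iota> v) / C_deg * inverse (max_growth S \<iota> ^ birth_gen S \<iota> v)
           else 0)" if "v \<in> Xi_verts S \<iota>" for v
      using limI[OF deg_ratio_tendsto[OF that]]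
      by (simp add: deg_hat_def limit_weight_def dominant_def divide_inverse mult_ac)
  qed (rule C_deg_pos)
qed

end
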